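(* Let $R$ be a (not necessarily commutative) ring whose additive group is finitely generated and let $\mathbf{k}$ be a field. For every $i \ge 0$ there exists a polynomial $f_i(t) \in \mathbb{Q}[t]$ such that $\dim_{\mathbf{k}} \mathrm{H}_i(U_n(R), \mathbf{k}) = f_i(n)$ for all sufficiently large $n$.
   Context: Rings are associative and unital with $1 \neq 0$. $U_n(R) \subset \mathbf{GL}_n(R)$ is the group of upper-triangular matrices with entries in $R$ whose diagonal entries are all equal to $1$. $\mathrm{H}_i(U_n(R),\mathbf{k})$ is the group homology with coefficients in the trivial representation $\mathbf{k}$. *)

theory Defs
  imports
    "Jordan_Normal_Form.VS_Connect"
    "HOL-Algebra.AbelCoset"
    "HOL-Library.Poly_Mapping"
    "HOL-Computational_Algebra.Group_Closure"
begin

section \<open>The group of unitriangular matrices\<close>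

definition unitriangular_group :: "nat \<Rightarrow> 'r::ring_1 mat monoid" where
  "unitriangular_group n =
    \<lparr>carrier = {A \<in> carrier_mat n n. upper_triangular A \<and> (\<forall>i<n. A $$ (i, i) = 1)},
     mult = (*), one = 1\<^sub>m n\<rparr>"


section \<open>Quotient modules\<close>

text \<open>As for \<^const>\<open>module_vec\<close>, the ring multiplication and unit that the record type
  \<^typ>\<open>('k, 'v) module\<close> carries along play no role.\<close>

definition quotient_module :: "('k, 'v, 'm) module_scheme \<Rightarrow> 'v set \<Rightarrow> ('k, 'v set) module" where
  "quotient_module V W =
    \<lparr>carrier = a_rcosets\<^bsub>V\<^esub> W, mult = undefined, one = undefined, zero = W, add = set_add V,
     smult = (\<lambda>a X. \<Union>x\<in>X. W +>\<^bsub>V\<^esub> (a \<odot>\<^bsub>V\<^esub> x))\<rparr>"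


section \<open>Group homology with trivial coefficients in a field\<close>

text \<open>
  Homology is computed by the inhomogeneous bar complex: the chains of degree \<open>i\<close> are the finite
  formal \<open>k\<close>-linear combinations of \<open>i\<close>-tuples \<open>[g\<^sub>1|\<dots>|g\<^sub>i]\<close> of group elements, and
  \<open>d [g\<^sub>1|\<dots>|g\<^sub>i] = [g\<^sub>2|\<dots>|g\<^sub>i] + (\<Sum>0<j<i. (-1)^j [g\<^sub>1|\<dots>|g\<^sub>j g\<^sub>j\<^sub>+\<^sub>1|\<dots>|g\<^sub>i])
    + (-1)^i [g\<^sub>1|\<dots>|g\<^sub>i\<^sub>-\<^sub>1]\<close>.
\<close>

definition scale_chain :: "'k::field \<Rightarrow> ('a \<Rightarrow>\<^sub>0 'k) \<Rightarrow> ('a \<Rightarrow>\<^sub>0 'k)" where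
  "scale_chain a c = Poly_Mapping.map ((*) a) c"

definition bar_chains :: "('g, 'm) monoid_scheme \<Rightarrow> nat \<Rightarrow> ('k::field, 'g list \<Rightarrow>\<^sub>0 'k) module" where
  "bar_chains G i =
    \<lparr>carrier = {c. Poly_Mapping.keys c \<subseteq> {gs. length gs = i \<and> set gs \<subseteq> carrier G}},
     mult = undefined, one = undefined, zero = 0, add = (+), smult = scale_chain\<rparr>"

text \<open>Lists are indexed from \<open>0\<close>, so \<open>g\<^sub>j\<close> is \<open>gs ! (j - 1)\<close>.\<close>

definition bar_face :: "('g, 'm) monoid_scheme \<Rightarrow> nat \<Rightarrow> 'g list \<Rightarrow> 'g list" where
  "bar_face G j gs =
    (if j = 0 then tl gs
     else if j = length gs then butlast gs
     else take (j - 1) gs @ (gs ! (j - 1) \<otimes>\<^bsub>G\<^esub> gs ! j) # drop (j + 1) gs)"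

definition bar_boundary_basis :: "('g, 'm) monoid_scheme \<Rightarrow> 'g list \<Rightarrow> ('g list \<Rightarrow>\<^sub>0 'k::field)" where
  "bar_boundary_basis G gs =
    (if gs = [] then 0
     else (\<Sum>j\<le>length gs. Poly_Mapping.single (bar_face G j gs) ((-1) ^ j)))"

definition bar_boundary ::
    "('g, 'm) monoid_scheme \<Rightarrow> ('g list \<Rightarrow>\<^sub>0 'k::field) \<Rightarrow> ('g list \<Rightarrow>\<^sub>0 'k)" where
  "bar_boundary G c =
    (\<Sum>gs\<in>Poly_Mapping.keys c. scale_chain (Poly_Mapping.lookup c gs) (bar_boundary_basis G gs))"

definition bar_cycles :: "('g, 'm) monoid_scheme \<Rightarrow> nat \<Rightarrow> ('g list \<Rightarrow>\<^sub>0 'k::field) set" where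
  "bar_cycles G i = {c \<in> carrier (bar_chains G i). bar_boundary G c = 0}"

definition bar_boundaries :: "('g, 'm) monoid_scheme \<Rightarrow> nat \<Rightarrow> ('g list \<Rightarrow>\<^sub>0 'k::field) set" where
  "bar_boundaries G i = bar_boundary G ` carrier (bar_chains G (Suc i))"

definition group_homology ::
    "('g, 'm) monoid_scheme \<Rightarrow> nat \<Rightarrow> ('k::field, ('g list \<Rightarrow>\<^sub>0 'k) set) module" where
  "group_homology G i =
    quotient_module ((bar_chains G i)\<lparr>carrier := bar_cycles G i\<rparr>) (bar_boundaries G i)"


section \<open>Well-definedness\<close>

text \<open>The unitriangular matrices form a group, and the homology of a group is a vector space, so that
  \<^const>\<open>vectorspace.fin_dim\<close> and \<^const>\<open>vectorspace.dim\<close> have their intended meaning for it.\<close>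

lemma unitriangular_mult_entry:
  assumes "A \<in> carrier_mat n n" "B \<in> carrier_mat n n" "i < n" "j < n"
  shows "(A * B) $$ (i, j) = (\<Sum>k<n. A $$ (i, k) * B $$ (k, j))"
  using assms by (simp add: scalar_prod_def atLeast0LessThan)

lemma unitriangular_group_is_group: "group (unitriangular_group n :: 'r::ring_1 mat monoid)"
proof -
  define U :: "'r mat set" where "U = carrier (unitriangular_group n)"
  have UD: "A \<in> carrier_mat n n" "\<And>i j. j < i \<Longrightarrow> i < n \<Longrightarrow> A $$ (i, j) = 0" "\<And>i. i < n \<Longrightarrow> A $$ (i, i) = 1"
    if "A \<in> U" for A
    using that unfolding U_def unitriangular_group_def by auto
  have UI: "A \<in> U" if "A \<in> carrier_mat n n" "\<And>i j. j < i \<Longrightarrow> i < n \<Longrightarrow> A $$ (i, j) = 0" "\<And>i. i < n \<Longrightarrow> A $$ (i, i) = 1" for A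
    using that unfolding U_def unitriangular_group_def by auto
  have one: "1\<^sub>m n \<in> U" by (rule UI) auto
  have mult: "A * B \<in> U" if A: "A \<in> U" and B: "B \<in> U" for A B
  proof (rule UI)
    show "A * B \<in> carrier_mat n n" using UD(1)[OF A] UD(1)[OF B] by auto
    show "(A * B) $$ (i, j) = 0" if "j < i" "i < n" for i j
    proof -
      have "A $$ (i, k) * B $$ (k, j) = 0" if "k < n" for k
        using UD(2)[OF A, of k i] UD(2)[OF B, of j k] that \<open>j < i\<close> \<open>i < n\<close> by (cases "k < i") auto
      then show ?thesis using UD(1)[OF A] UD(1)[OF B] that by (subst unitriangular_mult_entry[of _ n]) auto
    qed
    show "(A * B) $$ (i, i) = 1" if "i < n" for i
    proof -
      have "(\<Sum>k<n. A $$ (i, k) * B $$ (k, i)) = (\<Sum>k<n. if k = i then 1 else 0)"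
      proof (rule sum.cong, goal_cases)
        case (2 k)
        then show ?case using UD(2)[OF A, of k i] UD(2)[OF B, of i k] UD(3)[OF A] UD(3)[OF B] that
          by (cases k i rule: linorder_cases) auto
      qed simp
      then show ?thesis using UD(1)[OF A] UD(1)[OF B] that by (subst unitriangular_mult_entry[of _ n]) auto
    qed
  qed
  have inv: "\<exists>B\<in>U. \<forall>i<n. \<forall>j<n. j < i + Suc k \<longrightarrow> (B * A) $$ (i, j) = (if i = j then 1 else 0)"
    if A: "A \<in> U" for A k
  proof (induction k)
    case 0
    then show ?case using UD[OF A] one
      by (intro bexI[of _ "1\<^sub>m n"]) (auto simp: less_Suc_eq left_mult_one_mat[OF UD(1)[OF A]])
  next
    case (Suc k)
    then obtain B where B: "B \<in> U"
      and BA: "\<And>i j. i < n \<Longrightarrow> j < n \<Longrightarrow> j < i + Suc k \<Longrightarrow> (B * A) $$ (i, j) = (if i = j then 1 else 0)"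
      by blast
    define C where "C = B * A"
    have C: "C \<in> U" using mult A B by (simp add: C_def)
    have Cc: "C \<in> carrier_mat n n" using UD(1)[OF C] .
    define D where "D = mat n n (\<lambda>(i, j). (if i = j then 2 else 0) - C $$ (i, j))"
    have Dc: "D \<in> carrier_mat n n" by (simp add: D_def)
    have D: "D \<in> U" by (rule UI) (use UD[OF C] in \<open>auto simp: D_def\<close>)
    have "(D * C) $$ (i, j) = (if i = j then 1 else 0)" if ij: "i < n" "j < n" "j < i + Suc (Suc k)" for i j
    proof (cases "j \<le> i")
      case True
      then show ?thesis using UD[OF mult[OF D C]] ij by (cases "j = i") auto
    next
      case False
      have "D $$ (i, l) * C $$ (l, j) =
         (if l = i then C $$ (i, j) else 0) + (if l = j then - C $$ (i, j) else 0)" if "l < n" for l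
      proof -
        consider "l = i" | "l = j" | "l \<noteq> i" "l \<noteq> j" "l < i + Suc k" | "l \<noteq> i" "l \<noteq> j" "j < l + Suc k"
          using ij by linarith
        then show ?thesis
        proof cases
          case 1 then show ?thesis using UD(3)[OF C] ij False by (simp add: D_def)
        next
          case 2 then show ?thesis using UD(3)[OF C] ij False by (simp add: D_def)
        next
          case 3 then show ?thesis using BA[of i l] ij that by (simp add: D_def C_def)
        next
          case 4 then show ?thesis using BA[of l j] ij that by (simp add: C_def)
        qed
      qed
      then have "(\<Sum>l<n. D $$ (i, l) * C $$ (l, j)) =
         (\<Sum>l<n. (if l = i then C $$ (i, j) else 0) + (if l = j then - C $$ (i, j) else 0))"
        by (intro sum.cong) auto
      also have "\<dots> = 0" using ij by (simp add: sum.distrib)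
      finally show ?thesis using ij False Cc Dc by (subst unitriangular_mult_entry[of _ n]) auto
    qed
    moreover have "D * C = (D * B) * A"
      using UD(1)[OF A] UD(1)[OF B] Dc by (simp add: C_def)
    ultimately show ?case using mult[OF D B] by (intro bexI[of _ "D * B"]) auto
  qed
  show ?thesis
  proof (rule groupI, goal_cases)
    case (5 A)
    then have A: "A \<in> U" by (simp add: U_def)
    from inv[OF A, of n] obtain B where B: "B \<in> U"
      and BA: "\<forall>i<n. \<forall>j<n. j < i + Suc n \<longrightarrow> (B * A) $$ (i, j) = (if i = j then 1 else 0)" by blast
    have "B * A = 1\<^sub>m n"
      by (rule eq_matI) (use BA UD(1)[OF A] UD(1)[OF B] in auto)
    then show ?case using B by (auto simp: U_def unitriangular_group_def)
  next
    case (3 A B C)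
    then have "A \<in> U" "B \<in> U" "C \<in> U" by (simp_all add: U_def)
    from this[THEN UD(1)] show ?case by (simp add: unitriangular_group_def)
  next
    case (4 A)
    then have "A \<in> U" by (simp add: U_def)
    from this[THEN UD(1)] show ?case by (simp add: unitriangular_group_def)
  next
    case (1 A B)
    then show ?case using mult[of A B] by (simp add: U_def unitriangular_group_def)
  next
    case 2
    then show ?case using one by (simp add: U_def unitriangular_group_def)
  qed
qed

lemma module_quotient_module:
  assumes mod: "Module.module K V" and sub: "LinearCombinations.submodule K W V"
  shows "Module.module K (quotient_module V W)"
proof -
  interpret Module.module K V by (rule mod)
  interpret W: LinearCombinations.submodule K W V by (rule sub)
  have neg: "\<ominus>\<^bsub>V\<^esub> w \<in> W" if "w \<in> W" for w
  proof -
    have "(\<ominus>\<^bsub>K\<^esub> \<one>\<^bsub>K\<^esub>) \<odot>\<^bsub>V\<^esub> w \<in> W" using that by auto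
    moreover have "(\<ominus>\<^bsub>K\<^esub> \<one>\<^bsub>K\<^esub>) \<odot>\<^bsub>V\<^esub> w = \<ominus>\<^bsub>V\<^esub> w"
      using that W.subset by (subst smult_l_minus) auto
    ultimately show ?thesis by simp
  qed
  have "subgroup W (add_monoid V)"
    using W.subset neg by (intro add.subgroupI) (auto simp: a_inv_def[symmetric] intro: W.zero_closed)
  then interpret A: abelian_subgroup W V
    by (intro abelian_subgroupI3 additive_subgroupI) (auto intro: M.abelian_group_axioms)
  have smult_coset: "smult (quotient_module V W) a (W +>\<^bsub>V\<^esub> x) = W +>\<^bsub>V\<^esub> (a \<odot>\<^bsub>V\<^esub> x)"
    if a: "a \<in> carrier K" and x: "x \<in> carrier V" for a x
  proof -
    have "W +>\<^bsub>V\<^esub> (a \<odot>\<^bsub>V\<^esub> y) = W +>\<^bsub>V\<^esub> (a \<odot>\<^bsub>V\<^esub> x)" if y: "y \<in> W +>\<^bsub>V\<^esub> x" for y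
    proof -
      obtain w where w: "w \<in> W" "y = w \<oplus>\<^bsub>V\<^esub> x"
        using y by (auto simp: a_r_coset_def')
      have wc: "w \<in> carrier V" using w W.subset by auto
      have "a \<odot>\<^bsub>V\<^esub> y = (a \<odot>\<^bsub>V\<^esub> w) \<oplus>\<^bsub>V\<^esub> (a \<odot>\<^bsub>V\<^esub> x)"
        using w wc a x by (simp add: smult_r_distr)
      moreover have "a \<odot>\<^bsub>V\<^esub> w \<in> W" using a w by blast
      ultimately have "a \<odot>\<^bsub>V\<^esub> y \<in> W +>\<^bsub>V\<^esub> (a \<odot>\<^bsub>V\<^esub> x)"
        by (auto simp: a_r_coset_def')
      then show ?thesis
        using a x A.a_repr_independence' by (metis smult_closed)
    qed
    then have "(\<Union>y\<in>W +>\<^bsub>V\<^esub> x. W +>\<^bsub>V\<^esub> (a \<odot>\<^bsub>V\<^esub> y)) = (\<Union>y\<in>W +>\<^bsub>V\<^esub> x. W +>\<^bsub>V\<^esub> (a \<odot>\<^bsub>V\<^esub> x))"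
      by (intro SUP_cong refl)
    also have "\<dots> = W +>\<^bsub>V\<^esub> (a \<odot>\<^bsub>V\<^esub> x)"
      using A.a_rcos_self[OF x] by (intro SUP_const) blast
    finally show ?thesis by (simp add: quotient_module_def)
  qed
  have add_coset: "(W +>\<^bsub>V\<^esub> x) \<oplus>\<^bsub>quotient_module V W\<^esub> (W +>\<^bsub>V\<^esub> y) = W +>\<^bsub>V\<^esub> (x \<oplus>\<^bsub>V\<^esub> y)"
    if "x \<in> carrier V" "y \<in> carrier V" for x y
    using that A.a_rcos_sum by (simp add: quotient_module_def)
  have carr: "carrier (quotient_module V W) = (\<lambda>x. W +>\<^bsub>V\<^esub> x) ` carrier V"
    by (simp add: quotient_module_def A_RCOSETS_def' UNION_singleton_eq_range)
  have zero: "\<zero>\<^bsub>quotient_module V W\<^esub> = W +>\<^bsub>V\<^esub> \<zero>\<^bsub>V\<^esub>"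
    using W.subset by (simp add: quotient_module_def)
  show ?thesis
  proof (rule moduleI)
    show "cring K" by (rule R.is_cring)
    show "abelian_group (quotient_module V W)"
    proof (rule abelian_groupI, goal_cases)
      case (6 X)
      then obtain x where x: "x \<in> carrier V" "X = W +>\<^bsub>V\<^esub> x" by (auto simp: carr)
      show ?case using x
        by (intro bexI[of _ "W +>\<^bsub>V\<^esub> (\<ominus>\<^bsub>V\<^esub> x)"]) (auto simp: carr add_coset zero M.l_neg)
    qed (auto simp: carr add_coset zero M.a_ac)
  qed (auto simp: carr smult_coset add_coset smult_l_distr smult_r_distr smult_assoc1)
qed

lemma lookup_scale_chain [simp]: "Poly_Mapping.lookup (scale_chain a c) x = a * Poly_Mapping.lookup c x"
  by (simp add: scale_chain_def Poly_Mapping.map.rep_eq when_def)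

lemma scale_chain_distrib:
  "scale_chain a (c + d) = scale_chain a c + scale_chain a d"
  "scale_chain (a + b) c = scale_chain a c + scale_chain b c"
  "scale_chain (a * b) c = scale_chain a (scale_chain b c)"
  "scale_chain 1 c = c"
  "scale_chain 0 c = 0"
  "scale_chain a 0 = 0"
  by (rule poly_mapping_eqI; simp add: lookup_add algebra_simps)+

lemma scale_chain_sum: "scale_chain a (sum f S) = (\<Sum>x\<in>S. scale_chain a (f x))"
  by (induction S rule: infinite_finite_induct) (auto simp: scale_chain_distrib)

lemma scale_chain_single: "scale_chain a (Poly_Mapping.single x b) = Poly_Mapping.single x (a * b)"
  by (rule poly_mapping_eqI) (simp add: lookup_single when_def)

lemma keys_scale_chain: "Poly_Mapping.keys (scale_chain a c) \<subseteq> Poly_Mapping.keys c"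
  by (auto simp: in_keys_iff)

lemma carrier_bar_chains:
  "c \<in> carrier (bar_chains G i) \<longleftrightarrow> (\<forall>gs\<in>Poly_Mapping.keys c. length gs = i \<and> set gs \<subseteq> carrier G)"
  by (auto simp: bar_chains_def)

lemma bar_chains_add:
  "c \<in> carrier (bar_chains G i) \<Longrightarrow> d \<in> carrier (bar_chains G i) \<Longrightarrow> c + d \<in> carrier (bar_chains G i)"
  using Poly_Mapping.keys_add[of c d] unfolding carrier_bar_chains by blast

lemma bar_chains_scale:
  "c \<in> carrier (bar_chains G i) \<Longrightarrow> scale_chain a c \<in> carrier (bar_chains G i)"
  using keys_scale_chain[of a c] unfolding carrier_bar_chains by blast

lemma bar_chains_zero: "0 \<in> carrier (bar_chains G i)"
  by (simp add: carrier_bar_chains)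

lemma bar_chains_uminus: "c \<in> carrier (bar_chains G i) \<Longrightarrow> - c \<in> carrier (bar_chains G i)"
  by (simp add: carrier_bar_chains)

lemma bar_chains_sum:
  "(\<And>x. x \<in> S \<Longrightarrow> f x \<in> carrier (bar_chains G i)) \<Longrightarrow> sum f S \<in> carrier (bar_chains G i)"
  by (induction S rule: infinite_finite_induct) (simp_all add: bar_chains_zero bar_chains_add)

lemma bar_chains_ops:
  "add (bar_chains G i) = (+)" "zero (bar_chains G i) = 0" "smult (bar_chains G i) = scale_chain"
  by (simp_all add: bar_chains_def)

lemma vectorspace_bar_chains: "vectorspace class_ring (bar_chains G i :: ('k::field, _) module)"
proof -
  have "Module.module (class_ring :: 'k ring) (bar_chains G i)"
  proof (rule moduleI)
    show "cring (class_ring :: 'k ring)"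
      using class_field.field_axioms[where 'a = 'k] by (simp add: field_def domain_def)
    show "abelian_group (bar_chains G i :: ('k::field, _) module)"
    proof (rule abelian_groupI, goal_cases)
      case (6 x) then show ?case
        by (intro bexI[of _ "- x"]) (simp_all add: bar_chains_uminus bar_chains_ops)
    qed (simp_all add: bar_chains_add bar_chains_zero bar_chains_ops add_ac)
  qed (simp_all add: bar_chains_scale bar_chains_ops scale_chain_distrib)
  then show ?thesis by (simp add: vectorspace_def class_field.field_axioms[where 'a = 'k])
qed

lemma bar_boundary_superset:
  assumes "finite S" "Poly_Mapping.keys c \<subseteq> S"
  shows "bar_boundary G c = (\<Sum>gs\<in>S. scale_chain (Poly_Mapping.lookup c gs) (bar_boundary_basis G gs))"
  unfolding bar_boundary_def using assms
  by (intro sum.mono_neutral_left) (auto simp: in_keys_iff scale_chain_distrib)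

lemma bar_boundary_add: "bar_boundary G (c + d) = bar_boundary G c + bar_boundary G d"
proof -
  let ?S = "Poly_Mapping.keys c \<union> Poly_Mapping.keys d"
  show ?thesis
    using Poly_Mapping.keys_add[of c d]
    by (simp add: bar_boundary_superset[of ?S] lookup_add scale_chain_distrib sum.distrib)
qed

lemma bar_boundary_scale: "bar_boundary G (scale_chain a c) = scale_chain a (bar_boundary G c)"
  using keys_scale_chain[of a c]
  by (simp add: bar_boundary_superset[of "Poly_Mapping.keys c"] scale_chain_sum scale_chain_distrib)

lemma bar_boundary_0 [simp]: "bar_boundary G 0 = 0"
  by (simp add: bar_boundary_def)

lemma bar_boundary_sum: "bar_boundary G (sum f S) = (\<Sum>x\<in>S. bar_boundary G (f x))"
  by (induction S rule: infinite_finite_induct) (auto simp: bar_boundary_add)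

lemma bar_boundary_single:
  "bar_boundary G (Poly_Mapping.single gs a) = scale_chain a (bar_boundary_basis G gs)"
  by (subst bar_boundary_superset[of "{gs}"]) auto

lemma length_bar_face: "gs \<noteq> [] \<Longrightarrow> j \<le> length gs \<Longrightarrow> length (bar_face G j gs) = length gs - 1"
  by (auto simp: bar_face_def)

lemma nth_bar_face:
  assumes "t < length gs - 1" "j \<le> length gs"
  shows "bar_face G j gs ! t =
    (if t + 1 < j then gs ! t else if t + 1 = j then gs ! t \<otimes>\<^bsub>G\<^esub> gs ! (t + 1) else gs ! (t + 1))"
  using assms by (auto simp: bar_face_def nth_tl nth_butlast nth_append nth_Cons' min_def)

lemma set_bar_face:
  assumes "monoid G" "gs \<noteq> []" "set gs \<subseteq> carrier G" "j \<le> length gs"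
  shows "set (bar_face G j gs) \<subseteq> carrier G"
proof
  fix x assume "x \<in> set (bar_face G j gs)"
  then obtain t where t: "t < length gs - 1" "x = bar_face G j gs ! t"
    using length_bar_face[OF assms(2,4)] by (metis in_set_conv_nth)
  have "gs ! t \<in> carrier G" "gs ! (t + 1) \<in> carrier G"
    using t assms(3) by (auto simp: subset_iff)
  then show "x \<in> carrier G"
    using t assms(1,4) by (auto simp: nth_bar_face monoid.m_closed)
qed

lemma bar_face_face:
  assumes G: "monoid G" and gs: "set gs \<subseteq> carrier G" "length gs \<ge> 2"
    and kj: "k < j" "j \<le> length gs"
  shows "bar_face G k (bar_face G j gs) = bar_face G (j - 1) (bar_face G k gs)"
proof (rule nth_equalityI)
  have ne: "gs \<noteq> []" using gs by auto
  have l: "length (bar_face G j gs) = length gs - 1" "length (bar_face G k gs) = length gs - 1"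
    using kj ne by (auto simp: length_bar_face)
  have ne': "bar_face G j gs \<noteq> []" "bar_face G k gs \<noteq> []"
    using l gs(2) by auto
  show "length (bar_face G k (bar_face G j gs)) = length (bar_face G (j - 1) (bar_face G k gs))"
    using kj gs(2) ne' by (simp add: length_bar_face l)
  fix t assume "t < length (bar_face G k (bar_face G j gs))"
  then have t: "t < length gs - 2" using kj ne' l by (simp add: length_bar_face)
  have c: "gs ! t \<in> carrier G" "gs ! (t + 1) \<in> carrier G" "gs ! (t + 2) \<in> carrier G"
    using t gs by (auto simp: subset_iff)
  show "bar_face G k (bar_face G j gs) ! t = bar_face G (j - 1) (bar_face G k gs) ! t"
    using t kj gs(2) c G
    by (auto simp: nth_bar_face l monoid.m_assoc numeral_2_eq_2)
qed

lemma bar_boundary_boundary_basis: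
  assumes G: "monoid G" and gs: "set gs \<subseteq> carrier G"
  shows "bar_boundary G (bar_boundary_basis G gs :: _ \<Rightarrow>\<^sub>0 'k::field) = 0"
proof -
  consider "gs = []" | g where "gs = [g]" | "length gs \<ge> 2"
    by (cases gs; cases "tl gs") auto
  then show ?thesis
  proof cases
    case 3
    define n where "n = length gs"
    have n: "n \<ge> 2" using 3 by (simp add: n_def)
    define F :: "nat \<times> nat \<Rightarrow> 'a list \<Rightarrow>\<^sub>0 'k" where
      "F = (\<lambda>(j, k). Poly_Mapping.single (bar_face G k (bar_face G j gs)) ((-1) ^ (j + k)))"
    have gne: "gs \<noteq> []" using 3 by auto
    have len: "length (bar_face G j gs) = n - 1" if "j \<le> n" for j
      using that length_bar_face[OF gne, of j G] unfolding n_def by blast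
    have ne: "bar_face G j gs \<noteq> []" if "j \<le> n" for j
      using len[OF that] n by (cases "bar_face G j gs") simp_all
    have "bar_boundary_basis G gs = (\<Sum>j\<le>n. Poly_Mapping.single (bar_face G j gs) ((-1) ^ j :: 'k))"
      using gne by (simp add: bar_boundary_basis_def n_def)
    also have "bar_boundary G \<dots> = (\<Sum>j\<le>n. scale_chain ((-1) ^ j) (bar_boundary_basis G (bar_face G j gs)))"
      by (simp only: bar_boundary_sum bar_boundary_single)
    also have "\<dots> = (\<Sum>j\<le>n. \<Sum>k\<le>n-1. F (j, k))"
    proof (rule sum.cong[OF refl])
      fix j assume "j \<in> {..n}"
      then have j: "j \<le> n" by simp
      show "scale_chain ((-1) ^ j) (bar_boundary_basis G (bar_face G j gs)) = (\<Sum>k\<le>n-1. F (j, k))"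
        unfolding bar_boundary_basis_def F_def
        by (simp add: ne[OF j] len[OF j] scale_chain_sum scale_chain_single power_add)
    qed
    finally have "bar_boundary G (bar_boundary_basis G gs) = (\<Sum>j\<le>n. \<Sum>k\<le>n-1. F (j, k))" .
    also have "\<dots> = sum F ({..n} \<times> {..n-1})"
      by (simp add: sum.cartesian_product)
    also have "\<dots> = sum F {(j, k). j \<le> n \<and> k < j} + sum F {(j, k). j \<le> k \<and> k \<le> n - 1}"
    proof -
      have eq: "{..n} \<times> {..n-1} = {(j, k). j \<le> n \<and> k < j} \<union> {(j, k). j \<le> k \<and> k \<le> n - 1}"
        using n by auto
      have "finite ({(j, k). j \<le> n \<and> k < j} \<union> {(j, k). j \<le> k \<and> k \<le> n - 1})"
        unfolding eq[symmetric] by simp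
      then have fin: "finite {(j, k). j \<le> n \<and> k < j}" "finite {(j, k). j \<le> k \<and> k \<le> n - 1}"
        by simp_all
      show ?thesis unfolding eq by (rule sum.union_disjoint[OF fin]) auto
    qed
    also have "sum F {(j, k). j \<le> n \<and> k < j} = (\<Sum>p\<in>{(j, k). j \<le> k \<and> k \<le> n - 1}. - F p)"
    proof (rule sum.reindex_bij_witness[of _ "\<lambda>(j, k). (k + 1, j)" "\<lambda>(j, k). (k, j - 1)"], goal_cases)
      case (5 p)
      then obtain j k where p: "p = (j, k)" "k < j" "j \<le> n" by auto
      then have "bar_face G k (bar_face G j gs) = bar_face G (j - 1) (bar_face G k gs)"
        using bar_face_face[OF G gs] 3 n_def by auto
      moreover have "(-1::'k) ^ (j + k) = - ((-1) ^ (k + (j - 1)))"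
        using p by (cases j) (auto simp: add.commute)
      ultimately show ?case using p by (simp add: F_def single_uminus)
    qed (use n in auto)
    finally show ?thesis by (simp add: sum_negf)
  qed (auto simp: bar_boundary_basis_def bar_face_def single_uminus)
qed

lemma bar_boundary_in_chains:
  fixes c :: "'a list \<Rightarrow>\<^sub>0 'k::field"
  assumes G: "monoid G" and c: "c \<in> carrier (bar_chains G (Suc i))"
  shows "bar_boundary G c \<in> carrier (bar_chains G i)"
  unfolding bar_boundary_def
proof (intro bar_chains_sum bar_chains_scale)
  fix gs assume "gs \<in> Poly_Mapping.keys c"
  then have gs: "length gs = Suc i" "set gs \<subseteq> carrier G" using c by (auto simp: carrier_bar_chains)
  then have ne: "gs \<noteq> []" by auto
  have "Poly_Mapping.single (bar_face G j gs) ((-1) ^ j :: 'k) \<in> carrier (bar_chains G i)" if "j \<le> length gs" for j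
    using set_bar_face[OF G ne gs(2) that] length_bar_face[OF ne that, of G] gs(1)
    by (simp add: carrier_bar_chains)
  then show "(bar_boundary_basis G gs :: _ \<Rightarrow>\<^sub>0 'k) \<in> carrier (bar_chains G i)"
    unfolding bar_boundary_basis_def using ne by (auto intro!: bar_chains_sum)
qed

lemma bar_boundaries_subset:
  assumes G: "monoid G"
  shows "(bar_boundaries G i :: (_ \<Rightarrow>\<^sub>0 'k::field) set) \<subseteq> bar_cycles G i"
proof -
  have "bar_boundary G (bar_boundary G c) = 0" if "c \<in> carrier (bar_chains G (Suc i))" for c :: "_ \<Rightarrow>\<^sub>0 'k"
    unfolding bar_boundary_def[of G c] bar_boundary_sum bar_boundary_scale
    using that
    by (intro sum.neutral ballI, subst bar_boundary_boundary_basis[OF G])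
       (auto simp: bar_chains_def scale_chain_distrib)
  then show ?thesis
    by (auto simp: bar_boundaries_def bar_cycles_def intro: bar_boundary_in_chains[OF G])
qed

theorem vectorspace_group_homology:
  assumes G: "monoid G"
  shows "vectorspace class_ring (group_homology G i :: ('k::field, _) module)"
proof -
  let ?C = "\<lambda>i. bar_chains G i :: ('k, _) module"
  interpret V: vectorspace class_ring "?C i" by (rule vectorspace_bar_chains)
  have z: "LinearCombinations.submodule class_ring (bar_cycles G i) (?C i)"
    by (intro LinearCombinations.submodule.intro V.module_axioms)
       (auto simp: bar_cycles_def bar_chains_ops bar_chains_add bar_chains_scale bar_chains_zero
          bar_boundary_add bar_boundary_scale scale_chain_distrib)
  have b: "LinearCombinations.submodule class_ring (bar_boundaries G i) ((?C i)\<lparr>carrier := bar_cycles G i\<rparr>)"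
  proof -
    have "v + w \<in> bar_boundaries G i" if "v \<in> bar_boundaries G i" "w \<in> bar_boundaries G i" for v w :: "_ \<Rightarrow>\<^sub>0 'k"
    proof -
      obtain c d where "v = bar_boundary G c" "w = bar_boundary G d"
        "c \<in> carrier (?C (Suc i))" "d \<in> carrier (?C (Suc i))"
        using \<open>v \<in> _\<close> \<open>w \<in> _\<close> unfolding bar_boundaries_def by auto
      then show ?thesis unfolding bar_boundaries_def using bar_chains_add[of c]
        by (auto intro!: image_eqI[of _ _ "c + d"] simp: bar_boundary_add)
    qed
    moreover have "scale_chain a w \<in> bar_boundaries G i" if "w \<in> bar_boundaries G i" for a :: 'k and w
    proof -
      obtain d where "w = bar_boundary G d" "d \<in> carrier (?C (Suc i))"
        using \<open>w \<in> _\<close> unfolding bar_boundaries_def by auto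
      then show ?thesis unfolding bar_boundaries_def using bar_chains_scale[of d]
        by (auto intro!: image_eqI[of _ _ "scale_chain a d"] simp: bar_boundary_scale)
    qed
    moreover have "0 \<in> bar_boundaries G i"
      unfolding bar_boundaries_def by (rule image_eqI[of _ _ 0]) (auto simp: bar_chains_zero)
    ultimately show ?thesis
      using bar_boundaries_subset[OF G, of i, where 'k = 'k] V.submodule_is_module[OF z]
      by (intro LinearCombinations.submodule.intro) (auto simp: bar_chains_ops dest: subsetD[of "bar_boundaries G i" "bar_cycles G i"])
  qed
  show ?thesis
    unfolding group_homology_def vectorspace_def
    using module_quotient_module[OF V.submodule_is_module[OF z] b] class_field.field_axioms[where 'a = 'k] by simp
qed

end

theory Submission
  imports
    Defs
    "HOL-Library.List_Lexorder"
    "HOL-Library.Product_Lexorder"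
    "Jordan_Normal_Form.Determinant"
begin

text \<open>
  Fix a finite generating system \<open>s\<^sub>0, \<dots>, s\<^sub>r\<^sub>-\<^sub>1\<close> of the additive group of \<open>R\<close>. Taking the orders of the
  successive cyclic quotients into account, every element of \<open>R\<close> is a unique reduced word in finitely many
  letters (multiples of the \<open>s\<^sub>c\<close>), and hence every unitriangular matrix is a unique reduced word in finitely
  many elementary matrices. These normal forms come from a terminating quadratic rewriting system, so
  the collapsing scheme of Brown and Anick applies: a matching on the cells of the bar complex leaves as
  critical cells of degree \<open>p\<close> only the finitely many words \<open>x\<^sub>1 \<dots> x\<^sub>p\<close> of letters none of whose factors
  \<open>x\<^sub>i x\<^sub>i\<^sub>+\<^sub>1\<close> is reduced. Every chain has a critical part, which depends linearly on it, and a cycle whose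
  critical part vanishes is a boundary.

  Inserting a row and a column of the identity matrix is a homomorphism \<open>U\<^sub>n \<rightarrow> U\<^sub>n\<^sub>+\<^sub>1\<close> that respects the
  letters, their order and the reduced words, and therefore commutes with taking critical parts. As
  the dimension of homology is the number of leading words of critical parts of cycles minus that
  of boundaries, and both sets of leading words are stable under insertions, it remains to count such
  stable sets. They correspond to finitely many monomial ideals, whose Hilbert functions are
  eventually polynomial.
\<close>

text \<open>The matching splits the bar chains of degree \<open>p\<close> into \<open>High\<close>
  chains, boundaries of \<open>High\<close> chains of degree \<open>p + 1\<close>, and the span of
  the critical words. The boundary is injective on \<open>High\<close> chains, so a cycle without
  critical component has no \<open>High\<close> component either and is a boundary. This is why no
  differential on critical cells is ever computed. The matching inverts only signs, hence it works
  over every field. Two demands shape the alphabet: it has to be finite, and every relation has to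
  concern two adjacent letters only. Homology is merely a quotient, so its classes carry no leading
  words of their own. The critical parts of cycles and those of boundaries, however, both live in a
  space with a finite ordered basis that is compatible with insertions. The two are therefore
  counted separately and subtracted: a leading word of a cycle that comes from no boundary may
  acquire one after an insertion, so the difference set itself need not be stable.\<close>

section \<open>Rewriting words to normal form\<close>

text \<open>Exchanging two letters that are out of order, or merging two letters of equal level, may create
  arbitrarily many letters of higher level. Counting, for each letter of level \<open>l\<close>, the letter itself and
  all later letters of lower level gives weights that decrease lexicographically nevertheless.\<close>

primrec level_weight :: "nat \<Rightarrow> nat list \<Rightarrow> nat" where
  "level_weight l [] = 0"
| "level_weight l (a # w) =
    (if a = l then Suc (length (filter (\<lambda>b. b < l) w)) else 0) + level_weight l w"

lemma level_weight_append:
  "level_weight l (u @ v) =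
     level_weight l u + level_weight l v +
     length (filter ((=) l) u) * length (filter (\<lambda>b. b < l) v)"
  by (induction u) (auto simp: algebra_simps)

lemma level_weight_eq_0: "l \<notin> set w \<Longrightarrow> level_weight l w = 0"
  by (induction w) auto

text \<open>The lowest level is the most significant one, because a rewriting step at level
  \<open>l\<close> may raise the weights of all higher levels.\<close>

definition word_less :: "nat \<Rightarrow> (nat list \<times> nat list) set" where
  "word_less N = inv_image (lex less_than) (\<lambda>w. map (\<lambda>l. level_weight l w) [0..<N])"

lemma wf_word_less: "wf (word_less N)"
  unfolding word_less_def by (intro wf_inv_image wf_lex wf_less_than)

lemma trans_word_less: "trans (word_less N)"
  unfolding word_less_def by (intro trans_inv_image) (auto intro: lex_transI)

lemma word_lessI:
  assumes "l < N" "level_weight l u < level_weight l v"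
    "\<And>l'. l' < l \<Longrightarrow> level_weight l' u = level_weight l' v"
  shows "(u, v) \<in> word_less N"
proof -
  have split: "[0..<N] = [0..<l] @ l # [Suc l..<N]"
    using assms(1) by (metis less_imp_le_nat upt_add_eq_append upt_conv_Cons le_add_diff_inverse zero_le add_0)
  show ?thesis
    unfolding word_less_def in_inv_image lex_conv
    using assms(2,3) by (auto simp: split intro!: exI[of _ "map (\<lambda>l. level_weight l v) [0..<l]"])
qed

text \<open>The letter \<open>a\<close> loses the smaller letter \<open>b\<close> behind it, so the
  weight at level \<open>a\<close> drops by one. Levels below \<open>a\<close> notice neither the
  exchange nor the new letters \<open>cs\<close>.\<close>

lemma word_less_swap:
  assumes "b < a" "a < N" "\<forall>c\<in>set cs. a < c"
  shows "(p @ b # a # cs @ q, p @ a # b # q) \<in> word_less N"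
proof (rule word_lessI[of a])
  have "filter (\<lambda>b. b < a) cs = []" "filter ((=) a) cs = []" "level_weight a cs = 0"
    using assms by (auto simp: filter_empty_conv intro: level_weight_eq_0)
  then show "level_weight a (p @ b # a # cs @ q) < level_weight a (p @ a # b # q)"
    using assms by (simp add: level_weight_append)
  fix l assume l: "l < a"
  have "filter (\<lambda>b. b < l) cs = []" "filter ((=) l) cs = []" "level_weight l cs = 0"
    using assms l by (auto simp: filter_empty_conv intro!: level_weight_eq_0)
  then show "level_weight l (p @ b # a # cs @ q) = level_weight l (p @ a # b # q)"
    using assms l by (simp add: level_weight_append)
qed (use assms in auto)

text \<open>Every letter counts itself in its weight, so losing at least one of the two copies of
  \<open>a\<close> lowers the weight at level \<open>a\<close>, while lower levels do not
  change.\<close>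

lemma word_less_merge:
  assumes "a < N" "zs \<in> {[], [a]}" "\<forall>c\<in>set cs. a < c"
  shows "(p @ zs @ cs @ q, p @ a # a # q) \<in> word_less N"
proof (rule word_lessI[of a])
  have "filter (\<lambda>b. b < a) cs = []" "filter ((=) a) cs = []" "level_weight a cs = 0"
    using assms by (auto simp: filter_empty_conv intro: level_weight_eq_0)
  then show "level_weight a (p @ zs @ cs @ q) < level_weight a (p @ a # a # q)"
    using assms by (auto simp add: level_weight_append)
  fix l assume l: "l < a"
  have "filter (\<lambda>b. b < l) cs = []" "filter ((=) l) cs = []" "level_weight l cs = 0"
    using assms l by (auto simp: filter_empty_conv intro!: level_weight_eq_0)
  then show "level_weight l (p @ zs @ cs @ q) = level_weight l (p @ a # a # q)"
    using assms l by (auto simp add: level_weight_append)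
qed (use assms in auto)

lemma word_less_Cons:
  assumes "a < N"
  shows "(w, a # w) \<in> word_less N"
  by (rule word_lessI[of a]) (use assms in auto)

text \<open>Reducedness is a condition \<open>R\<close> on adjacent letters, which makes the system
  quadratic. The levels serve termination: a bad pair is exchanged or merged, up to a tail of
  letters above the level of \<open>x\<close>, which is the shape that \<open>word_less\<close> can
  handle.\<close>

locale quadratic_normal_form =
  fixes G :: "'g monoid" (structure) and X :: "'x set" and e :: "'x \<Rightarrow> 'g"
    and R :: "'x \<Rightarrow> 'x \<Rightarrow> bool" and nf :: "'g \<Rightarrow> 'x list" and lev :: "'x \<Rightarrow> nat" and N :: nat
  assumes monoid: "monoid G"
    and letter: "x \<in> X \<Longrightarrow> e x \<in> carrier G"
    and nf_letters: "g \<in> carrier G \<Longrightarrow> set (nf g) \<subseteq> X"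
    and nf_reduced: "g \<in> carrier G \<Longrightarrow> successively R (nf g)"
    and eval_nf: "g \<in> carrier G \<Longrightarrow> foldr (\<lambda>x h. e x \<otimes>\<^bsub>G\<^esub> h) (nf g) \<one>\<^bsub>G\<^esub> = g"
    and nf_eval: "set w \<subseteq> X \<Longrightarrow> successively R w \<Longrightarrow> nf (foldr (\<lambda>x h. e x \<otimes>\<^bsub>G\<^esub> h) w \<one>\<^bsub>G\<^esub>) = w"
    and lev_less: "x \<in> X \<Longrightarrow> lev x < N"
    and rewrite: "x \<in> X \<Longrightarrow> y \<in> X \<Longrightarrow> \<not> R x y \<Longrightarrow>
      \<exists>zs cs. map lev (nf (e x \<otimes> e y)) = zs @ cs \<and> (\<forall>c\<in>set cs. lev x < c) \<and>
        (lev y < lev x \<and> zs = [lev y, lev x] \<or> lev y = lev x \<and> (zs = [] \<or> zs = [lev x]))"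
begin

sublocale monoid G by (rule monoid)

definition eval :: "'x list \<Rightarrow> 'g" where
  "eval w = foldr (\<lambda>x h. e x \<otimes> h) w \<one>"

lemma eval_simps [simp]: "eval [] = \<one>" "eval (x # w) = e x \<otimes> eval w"
  by (simp_all add: eval_def)

lemmas eval_nf' [simp] = eval_nf[folded eval_def] and nf_eval' = nf_eval[folded eval_def]

lemma eval_closed: "set w \<subseteq> X \<Longrightarrow> eval w \<in> carrier G"
  by (induction w) (auto simp: letter)

lemma eval_append: "set u \<subseteq> X \<Longrightarrow> set v \<subseteq> X \<Longrightarrow> eval (u @ v) = eval u \<otimes> eval v"
  by (induction u) (auto simp: letter eval_closed m_assoc)

lemma nf_one [simp]: "nf \<one> = []"
  using nf_eval'[of "[]"] by simp

lemma nf_e [simp]: "x \<in> X \<Longrightarrow> nf (e x) = [x]"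
  using nf_eval'[of "[x]"] by (simp add: letter)

lemma nf_Nil_iff: "g \<in> carrier G \<Longrightarrow> nf g = [] \<longleftrightarrow> g = \<one>"
  by (metis eval_nf' eval_simps(1) nf_one)

lemma nf_single: "g \<in> carrier G \<Longrightarrow> nf g = [x] \<Longrightarrow> x \<in> X \<and> g = e x"
  by (metis eval_nf' eval_simps letter list.set_intros(1) nf_letters r_one subsetD)

definition below :: "'x list \<Rightarrow> 'x list \<Rightarrow> bool" (infix \<open>\<prec>\<close> 50) where
  "u \<prec> v \<longleftrightarrow> (map lev u, map lev v) \<in> word_less N"

end

section \<open>Faces of concatenated cells\<close>

lemma bar_face_append_left:
  "j < length u \<Longrightarrow> bar_face G j (u @ v) = bar_face G j u @ v"
  by (cases "u = []") (auto simp: bar_face_def nth_append)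

lemma bar_face_append_right:
  assumes "length u < j" "j \<le> length (u @ v)"
  shows "bar_face G j (u @ v) = u @ bar_face G (j - length u) v"
  using assms by (auto simp: bar_face_def nth_append butlast_append Suc_diff_le)

lemma bar_face_middle:
  "bar_face G (Suc (length u)) (u @ g # h # v) = u @ (g \<otimes>\<^bsub>G\<^esub> h) # v"
  by (auto simp: bar_face_def nth_append)

lemma bar_face_length: "gs \<noteq> [] \<Longrightarrow> bar_face G (length gs) gs = butlast gs"
  by (simp add: bar_face_def)

lemma not_successivelyE:
  assumes "\<not> successively P w"
  obtains u x y v where "w = u @ x # y # v" "\<not> P x y"
  using assms
proof (induction w arbitrary: thesis)
  case (Cons a w)
  show ?case
  proof (cases "w \<noteq> [] \<and> \<not> P a (hd w)")
    case True
    then show ?thesis using Cons.prems(1)[of "[]" a "hd w" "tl w"] by simp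
  next
    case False
    with Cons.prems(2) have *: "\<not> successively P w" by (auto simp: successively_Cons)
    show ?thesis
    proof (rule Cons.IH[OF _ *])
      fix u x y v assume "w = u @ x # y # v" "\<not> P x y"
      then show ?thesis using Cons.prems(1)[of "a # u"] by simp
    qed
  qed
qed simp

datatype cell_kind = Crit | Low | High

context quadratic_normal_form
begin

lemma wf_below: "wf {(u, v). u \<prec> v}"
proof -
  have "{(u, v). u \<prec> v} = inv_image (word_less N) (map lev)"
    by (auto simp: below_def)
  then show ?thesis by (simp add: wf_word_less wf_inv_image)
qed

lemma below_trans: "u \<prec> v \<Longrightarrow> v \<prec> w \<Longrightarrow> u \<prec> w"
  using trans_word_less unfolding below_def by (meson transD)

lemma below_irrefl: "\<not> u \<prec> u"
  using wf_not_refl[OF wf_below, of u] by simp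

lemma below_Cons: "x \<in> X \<Longrightarrow> w \<prec> x # w"
  unfolding below_def using word_less_Cons lev_less by simp

lemma below_rewrite:
  assumes "x \<in> X" "y \<in> X" "\<not> R x y"
  shows "p @ nf (e x \<otimes> e y) @ q \<prec> p @ x # y # q"
proof -
  obtain zs cs where zs: "map lev (nf (e x \<otimes> e y)) = zs @ cs" and cs: "\<forall>c\<in>set cs. lev x < c"
    and or: "lev y < lev x \<and> zs = [lev y, lev x] \<or> lev y = lev x \<and> (zs = [] \<or> zs = [lev x])"
    using rewrite[OF assms] by (elim exE conjE) (rule that)
  have "(map lev p @ zs @ cs @ map lev q, map lev p @ lev x # lev y # map lev q) \<in> word_less N"
    using or
  proof
    assume "lev y < lev x \<and> zs = [lev y, lev x]"
    then show ?thesis using word_less_swap[OF _ lev_less[OF assms(1)] cs, of "lev y"] by simp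
  next
    assume "lev y = lev x \<and> (zs = [] \<or> zs = [lev x])"
    then show ?thesis using word_less_merge[OF lev_less[OF assms(1)] _ cs, of zs] by simp
  qed
  then show ?thesis by (simp add: below_def zs)
qed

text \<open>Rewriting one bad pair keeps the value and lowers the word, and the induction hypothesis
  does the rest; a reduced word is its own normal form. The context \<open>p\<close>,
  \<open>q\<close> is carried along because entries of a cell are rewritten inside the word of the
  whole cell.\<close>

lemma below_nf:
  assumes "set u \<subseteq> X" "\<not> successively R u"
  shows "p @ nf (eval u) @ q \<prec> p @ u @ q"
  using assms
proof (induction u rule: wf_induct_rule[OF wf_below])
  case (1 u)
  from 1(3) obtain p' x y q' where u: "u = p' @ x # y # q'" "\<not> R x y"
    by (rule not_successivelyE)
  have X: "x \<in> X" "y \<in> X" "set p' \<subseteq> X" "set q' \<subseteq> X" using u 1(2) by auto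
  define u1 where "u1 = p' @ nf (e x \<otimes> e y) @ q'"
  have nfX: "set (nf (e x \<otimes> e y)) \<subseteq> X" using X by (intro nf_letters) (simp add: letter)
  have u1: "u1 \<prec> u" unfolding u1_def u(1) using X u by (intro below_rewrite)
  have 2: "p @ u1 @ q \<prec> p @ u @ q" unfolding u1_def u(1)
    using below_rewrite[OF X(1,2) u(2), of "p @ p'" "q' @ q"] by simp
  have ev: "eval u1 = eval u" unfolding u1_def u(1)
    using X nfX by (simp add: eval_append letter eval_closed m_assoc)
  have u1X: "set u1 \<subseteq> X" using X nfX by (auto simp: u1_def)
  show ?case
  proof (cases "successively R u1")
    case True
    then have "nf (eval u) = u1" using ev nf_eval'[OF u1X] by simp
    then show ?thesis using 2 by simp
  next
    case False
    have "p @ nf (eval u1) @ q \<prec> p @ u1 @ q" using 1(1)[of u1] u1 u1X False by simp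
    then show ?thesis using 2 ev below_trans by auto
  qed
qed

text \<open>A face that multiplies two entries either leaves the concatenated word unchanged or
  lowers it strictly. This dichotomy is behind the acyclicity of the matching.\<close>

lemma nf_mult:
  assumes "g \<in> carrier G" "h \<in> carrier G"
  shows "successively R (nf g @ nf h) \<Longrightarrow> nf (g \<otimes> h) = nf g @ nf h"
    and "\<not> successively R (nf g @ nf h) \<Longrightarrow> p @ nf (g \<otimes> h) @ q \<prec> p @ nf g @ nf h @ q"
proof -
  have ev: "eval (nf g @ nf h) = g \<otimes> h"
    using assms by (simp add: eval_append nf_letters)
  have X: "set (nf g @ nf h) \<subseteq> X" using assms nf_letters by auto
  show "successively R (nf g @ nf h) \<Longrightarrow> nf (g \<otimes> h) = nf g @ nf h"
    using nf_eval'[OF X] ev by simp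
  show "\<not> successively R (nf g @ nf h) \<Longrightarrow> p @ nf (g \<otimes> h) @ q \<prec> p @ nf g @ nf h @ q"
    using below_nf[OF X] ev by simp
qed

section \<open>Classification of bar cells\<close>

definition word :: "'g list \<Rightarrow> 'x list" where
  "word gs = concat (map nf gs)"

lemma word_simps [simp]:
  "word [] = []" "word (g # gs) = nf g @ word gs" "word (gs @ hs) = word gs @ word hs"
  by (simp_all add: word_def)

lemma word_map_e [simp]: "set p \<subseteq> X \<Longrightarrow> word (map e p) = p"
  by (induction p) auto

text \<open>The Anick chains of a quadratic system: all adjacent pairs are bad.\<close>

definition essential :: "'x list \<Rightarrow> bool" where
  "essential p \<longleftrightarrow> set p \<subseteq> X \<and> successively (\<lambda>x y. \<not> R x y) p"

lemma essential_letters: "essential p \<Longrightarrow> set p \<subseteq> X"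
  by (simp add: essential_def)

lemma essential_simps [simp]: "essential []" "essential [x] \<longleftrightarrow> x \<in> X"
  by (simp_all add: essential_def)

lemma essential_append_iff:
  "essential (p @ q) \<longleftrightarrow> essential p \<and> essential q \<and> (p = [] \<or> q = [] \<or> \<not> R (last p) (hd q))"
  by (auto simp: essential_def successively_append_iff)

definition run :: "'g list \<Rightarrow> nat" where
  "run gs = length (takeWhile ((=) \<one>) gs)"

text \<open>The argument \<open>p\<close> of \<open>kind\<close> is the essential prefix read so far. The first entry that does not extend
  it decides: an entry of length at least two is split into its first letter and the rest (\<open>Low\<close>), an
  entry whose product with the last letter of \<open>p\<close> is reduced results from such a split (\<open>High\<close>). Runs of
  the identity, which occur since the bar complex is not normalized, are matched by parity: the
  alternating sum of the faces that shorten a run is 0 or a unit depending on the parity of its length.\<close>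

fun kind :: "'x list \<Rightarrow> 'g list \<Rightarrow> cell_kind" where
  "kind p [] = Crit"
| "kind p (g # gs) =
    (case nf g of
      [] \<Rightarrow> if odd (run (g # gs)) then Low else High
    | y # ys \<Rightarrow>
        if p \<noteq> [] \<and> R (last p) y then High
        else if ys \<noteq> [] then Low
        else kind (p @ [y]) gs)"

text \<open>Meaningful on \<open>Low\<close> cells: a run of ones gets one more, and an entry with
  at least two letters is split after its first letter.\<close>

fun partner :: "'g list \<Rightarrow> 'g list" where
  "partner [] = []"
| "partner (g # gs) =
    (case nf g of
      [] \<Rightarrow> g # g # gs
    | y # ys \<Rightarrow> if ys = [] then g # partner gs else e y # eval ys # gs)"

lemma kind_append:
  "essential (p @ q) \<Longrightarrow> kind p (map e q @ gs) = kind (p @ q) gs"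
proof (induction q arbitrary: p)
  case (Cons x q)
  have x: "x \<in> X" using essential_letters[OF Cons.prems] by auto
  have "p = [] \<or> \<not> R (last p) x"
    using Cons.prems by (auto simp: essential_append_iff)
  then have "kind p (e x # map e q @ gs) = kind (p @ [x]) (map e q @ gs)"
    using x by auto
  then show ?case using Cons.IH[of "p @ [x]"] Cons.prems by simp
qed simp

lemma kind_essential: "essential p \<Longrightarrow> kind [] (map e p) = Crit"
  using kind_append[of "[]" p "[]"] by simp

lemma partner_append: "set p \<subseteq> X \<Longrightarrow> partner (map e p @ gs) = map e p @ partner gs"
  by (induction p) auto

text \<open>The scan stops at the first entry that is not a single letter extending the essential
  prefix, so everything before the deciding entry is a word \<open>q\<close> of letters. All later
  case distinctions on cells use this split.\<close>

lemma kind_cases: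
  assumes "set gs \<subseteq> carrier G" "essential p"
  obtains (Crit) q where "gs = map e q" "essential (p @ q)" "kind p gs = Crit"
  | (One) q hs where "gs = map e q @ \<one> # hs" "essential (p @ q)"
      "kind p gs = (if odd (run (\<one> # hs)) then Low else High)"
  | (High) q y ys g hs where "gs = map e q @ g # hs" "essential (p @ q)" "nf g = y # ys"
      "p @ q \<noteq> []" "R (last (p @ q)) y" "kind p gs = High"
  | (Low) q y ys g hs where "gs = map e q @ g # hs" "essential (p @ q @ [y])" "nf g = y # ys"
      "ys \<noteq> []" "kind p gs = Low"
  using assms
proof (induction gs arbitrary: p thesis)
  case Nil
  show ?case by (rule Nil.prems(1)[of "[]"]) (use Nil.prems(6) in simp_all)
next
  case (Cons g gs)
  have g: "g \<in> carrier G" and gs: "set gs \<subseteq> carrier G" using Cons.prems by auto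
  show ?case
  proof (cases "nf g")
    case Nil
    then have "g = \<one>" using g nf_Nil_iff by simp
    then show ?thesis using Cons.prems(2)[of "[]" gs] Cons.prems(6) by simp
  next
    case (Cons y ys)
    have y: "y \<in> X" using nf_letters[OF g] Cons by auto
    consider "p \<noteq> []" "R (last p) y" | "p = [] \<or> \<not> R (last p) y" "ys \<noteq> []"
      | "p = [] \<or> \<not> R (last p) y" "ys = []" by blast
    then show ?thesis
    proof cases
      case 1
      then show ?thesis using Cons.prems(3)[of "[]" g gs y ys] Cons.prems(6) Cons by simp
    next
      case 2
      then have "essential (p @ [] @ [y])"
        using y Cons.prems(6) by (auto simp: essential_append_iff)
      then show ?thesis using Cons.prems(4)[of "[]" g gs y ys] 2 Cons by auto
    next
      case 3
      then have ess: "essential (p @ [y])"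
        using y Cons.prems(6) by (auto simp: essential_append_iff)
      have k: "kind p (g # gs) = kind (p @ [y]) gs" using 3 Cons by auto
      have ge: "g = e y" using Cons 3 nf_single[OF g] by auto
      show ?thesis
      proof (rule Cons.IH[OF _ _ _ _ gs ess], goal_cases)
        case (1 q) then show ?case using Cons.prems(1)[of "y # q"] k ge by simp
      next
        case (2 q hs) then show ?case using Cons.prems(2)[of "y # q" hs] k ge by simp
      next
        case (3 q g' hs y' ys') then show ?case using Cons.prems(3)[of "y # q" g' hs y' ys'] k ge by simp
      next
        case (4 q g' hs y' ys') then show ?case using Cons.prems(4)[of "y # q" g' hs y' ys'] k ge by simp
      qed
    qed
  qed
qed

end

text \<open>Consecutive signs cancel in pairs, and the one left over is a unit in every
  characteristic. It is the coefficient of a \<open>Low\<close> cell in the boundary of its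
  partner.\<close>

lemma sum_alternating_odd:
  "(\<Sum>j = m..m + 2 * s. (- 1) ^ j) = ((- 1) ^ m :: 'k::field)"
  by (induction s) (simp_all add: sum.cl_ivl_Suc)

section \<open>Faces of matched cells\<close>

context quadratic_normal_form
begin

lemma bar_face_one:
  assumes "set u \<subseteq> carrier G" "set v \<subseteq> carrier G" "j = length u \<or> j = Suc (length u)"
  shows "bar_face G j (u @ \<one> # v) = u @ v"
  using assms(3)
proof
  assume j: "j = length u"
  show ?thesis
  proof (cases u rule: rev_cases)
    case (snoc u' g)
    then show ?thesis using bar_face_middle[of G u' g \<one> v] assms(1) j by simp
  qed (simp add: j bar_face_def)
next
  assume j: "j = Suc (length u)"
  show ?thesis
  proof (cases v)
    case (Cons g v')
    then show ?thesis using bar_face_middle[of G u \<one> g v'] assms(2) j by simp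
  qed (simp add: j bar_face_def butlast_append)
qed

text \<open>Such a face either drops the first letter or multiplies a bad pair, which has to be
  rewritten; both lower the word.\<close>

lemma word_face_left:
  assumes "essential p" "j < length p"
  shows "word (bar_face G j (map e p)) @ q \<prec> p @ q"
proof (cases "j = 0")
  case True
  obtain x p' where p: "p = x # p'" using assms(2) by (cases p) auto
  have "x \<in> X" "set p' \<subseteq> X" using essential_letters[OF assms(1)] p by auto
  then show ?thesis using True p below_Cons by (simp add: bar_face_def)
next
  case False
  define u where "u = take (j - 1) p"
  define v where "v = drop (Suc j) p"
  have p: "p = u @ p ! (j - 1) # p ! j # v"
    using False assms(2) unfolding u_def v_def
    by (metis Cons_nth_drop_Suc One_nat_def Suc_pred append_take_drop_id less_imp_diff_less not_gr_zero)
  have ju: "j = Suc (length (map e u))" using False assms(2) by (simp add: u_def)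
  have X: "p ! (j - 1) \<in> X" "p ! j \<in> X" "set u \<subseteq> X" "set v \<subseteq> X"
    using essential_letters[OF assms(1)] by (subst (asm) p, auto)+
  have nR: "\<not> R (p ! (j - 1)) (p ! j)"
    using assms(1) by (subst (asm) p) (auto simp: essential_def successively_append_iff)
  have "bar_face G j (map e p) = map e u @ (e (p ! (j - 1)) \<otimes> e (p ! j)) # map e v"
    using bar_face_middle[of G "map e u" "e (p ! (j - 1))" "e (p ! j)" "map e v"] ju
    by (subst p) simp
  then have "word (bar_face G j (map e p)) @ q = u @ nf (e (p ! (j - 1)) \<otimes> e (p ! j)) @ v @ q"
    using X by simp
  also have "\<dots> \<prec> u @ p ! (j - 1) # p ! j # v @ q"
    using X(1,2) nR by (rule below_rewrite)
  also have "u @ p ! (j - 1) # p ! j # v @ q = p @ q" by (subst (3) p) simp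
  finally show ?thesis .
qed

lemma kind_High:
  assumes "essential p" "p \<noteq> []" "nf h = z # zs" "R (last p) z"
  shows "kind [] (map e p @ h # hs) = High"
  using assms kind_append[of "[]" p] by simp

lemma run_replicate:
  assumes "post = [] \<or> hd post \<noteq> \<one>"
  shows "run (replicate r \<one> @ post) = r"
  using assms by (induction r) (cases post; auto simp: run_def)+

lemma kind_ones:
  assumes "essential p" "post = [] \<or> hd post \<noteq> \<one>" "r > 0"
  shows "kind [] (map e p @ replicate r \<one> @ post) = (if odd r then Low else High)"
proof -
  obtain r' where r: "r = Suc r'" using assms(3) by (cases r) auto
  have "run (\<one> # replicate r' \<one> @ post) = r"
    using run_replicate[OF assms(2), of r] r by simp
  then show ?thesis using kind_append[of "[]" p] assms(1) r by simp
qed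

text \<open>The faces of \<open>b\<close> with index in \<open>I\<close> are \<open>gs\<close>; all other \<open>Low\<close> faces have smaller words, so the
  matching is acyclic.\<close>

definition matched :: "'g list \<Rightarrow> 'g list \<Rightarrow> nat set \<Rightarrow> bool" where
  "matched gs b I \<longleftrightarrow> set b \<subseteq> carrier G \<and> length b = Suc (length gs) \<and> kind [] b = High \<and>
     I \<subseteq> {..length b} \<and> (\<forall>j\<in>I. bar_face G j b = gs) \<and>
     (\<forall>j\<in>{..length b} - I. kind [] (bar_face G j b) = Low \<longrightarrow> word (bar_face G j b) \<prec> word gs)"

text \<open>The entry \<open>g\<close> is split after its first letter \<open>y\<close>, and one
  face multiplies the pieces back together. Faces further left hit the essential word
  \<open>q @ [y]\<close> and lower the word. Faces further right leave the split visible and stay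
  \<open>High\<close>, except possibly the one that multiplies the rest of \<open>g\<close> with the
  next entry.\<close>

lemma matched_Low:
  assumes gs: "set gs \<subseteq> carrier G" "gs = map e q @ g # hs"
    and q: "essential (q @ [y])" and g: "nf g = y # ys" "ys \<noteq> []"
  shows "matched gs (map e q @ e y # eval ys # hs) {Suc (length q)}"
  unfolding matched_def
proof (intro conjI ballI impI)
  let ?b = "map e q @ e y # eval ys # hs"
  have gc: "g \<in> carrier G" and hs: "set hs \<subseteq> carrier G" using gs by auto
  have X: "set q \<subseteq> X" "y \<in> X" using essential_letters[OF q] by auto
  have ys: "set ys \<subseteq> X" "successively R (y # ys)"
    using nf_letters[OF gc] nf_reduced[OF gc] g by auto
  obtain z zs where z: "ys = z # zs" "R y z" using ys(2) g(2) by (cases ys) auto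
  have nys: "nf (eval ys) = ys" using ys nf_eval' by (auto simp: successively_Cons)
  have ec: "eval ys \<in> carrier G" using ys eval_closed by auto
  have ge: "g = e y \<otimes> eval ys" using eval_nf'[OF gc] g by simp
  have wgs: "word gs = q @ y # ys @ word hs" using gs(2) g X by simp
  show "set ?b \<subseteq> carrier G" using X letter ec hs by auto
  show len: "length ?b = Suc (length gs)" using gs by simp
  show "kind [] ?b = High"
    using kind_High[of "q @ [y]" "eval ys" z zs hs] q nys z by simp
  show "{Suc (length q)} \<subseteq> {..length ?b}" by simp
  show "bar_face G j ?b = gs" if "j \<in> {Suc (length q)}" for j
    using that bar_face_middle[of G "map e q" "e y" "eval ys" hs] gs ge by simp
  fix j assume j: "j \<in> {..length ?b} - {Suc (length q)}" and low: "kind [] (bar_face G j ?b) = Low"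
  consider "j < Suc (length q)" | "j = Suc (Suc (length q))" | "j > Suc (Suc (length q))"
    using j by fastforce
  then show "word (bar_face G j ?b) \<prec> word gs"
  proof cases
    case 1
    then have "bar_face G j ?b = bar_face G j (map e (q @ [y])) @ eval ys # hs"
      using bar_face_append_left[of j "map e (q @ [y])" G "eval ys # hs"] by simp
    then show ?thesis
      using word_face_left[OF q, of j "ys @ word hs"] 1 wgs nys by simp
  next
    case 2
    show ?thesis
    proof (cases hs)
      \<comment> \<open>The last face drops the rest of \<open>g\<close> and leaves an essential
        word, that is, a critical cell.\<close>
      case Nil
      then have "bar_face G j ?b = map e (q @ [y])"
        using bar_face_length[of ?b G] 2 by (simp add: butlast_append)
      then show ?thesis using low kind_essential[OF q] by simp
    next
      case (Cons h hs')
      have h: "h \<in> carrier G" using hs Cons by simp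
      have f: "bar_face G j ?b = map e (q @ [y]) @ (eval ys \<otimes> h) # hs'"
        using bar_face_middle[of G "map e (q @ [y])" "eval ys" h hs'] 2 Cons by simp
      \<comment> \<open>If the product were reduced, its normal form would still begin with
        \<open>z\<close>, and \<open>R y z\<close> would keep the face \<open>High\<close>.\<close>
      have "\<not> successively R (nf (eval ys) @ nf h)"
      proof
        assume "successively R (nf (eval ys) @ nf h)"
        from nf_mult(1)[OF ec h this] have "nf (eval ys \<otimes> h) = z # zs @ nf h"
          using nys z by simp
        from kind_High[OF q _ this] z low f show False by simp
      qed
      from nf_mult(2)[OF ec h this, of "q @ [y]" "word hs'"]
      show ?thesis using f wgs nys Cons X by simp
    qed
  next
    case 3
    have "bar_face G j ?b = (map e (q @ [y]) @ [eval ys]) @ bar_face G (j - Suc (Suc (length q))) hs"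
      using bar_face_append_right[of "map e (q @ [y]) @ [eval ys]" j hs G] 3 j by simp
    then have "kind [] (bar_face G j ?b) = High"
      using kind_High[OF q _ _ , of "eval ys" z zs] nys z by simp
    then show ?thesis using low by simp
  qed
qed

text \<open>Each of the \<open>r + 2\<close> faces at the run of \<open>r + 1\<close> ones deletes
  one of them and gives \<open>gs\<close>. As \<open>r\<close> is odd, so is the number of these
  faces, and their signs add up to a unit.\<close>

lemma matched_ones:
  assumes gs: "set gs \<subseteq> carrier G" "gs = map e q @ replicate r \<one> @ post"
    and q: "essential q" and r: "odd r" and post: "post = [] \<or> hd post \<noteq> \<one>"
  shows "matched gs (map e q @ replicate (Suc r) \<one> @ post) {length q..Suc (length q + r)}"
  unfolding matched_def
proof (intro conjI ballI impI)
  let ?b = "map e q @ replicate (Suc r) \<one> @ post"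
  have qc: "set (map e q) \<subseteq> carrier G" and pc: "set post \<subseteq> carrier G" using gs by auto
  have X: "set q \<subseteq> X" using essential_letters[OF q] by auto
  have wr: "word (replicate n \<one>) = []" for n by (induction n) auto
  have wgs: "word gs = q @ word post" using gs(2) X wr by simp
  show "set ?b \<subseteq> carrier G" using qc pc by auto
  show "length ?b = Suc (length gs)" using gs by simp
  show "kind [] ?b = High" using kind_ones[OF q post, of "Suc r"] r by simp
  show "{length q..Suc (length q + r)} \<subseteq> {..length ?b}" by auto
  show "bar_face G j ?b = gs" if "j \<in> {length q..Suc (length q + r)}" for j
  proof -
    \<comment> \<open>The ones have offsets \<open>0\<close> to \<open>r\<close>, but there are
      \<open>r + 2\<close> faces; the \<open>min\<close> lets the last face act on the last one from
      its right.\<close>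
    define i where "i = min (j - length q) r"
    have i: "i \<le> r" "j = length q + i \<or> j = Suc (length q + i)" using that by (auto simp: i_def)
    have ones: "replicate (Suc r) \<one> = replicate i \<one> @ \<one> # replicate (r - i) \<one>"
      by (metis i(1) le_add_diff_inverse replicate_add replicate_app_Cons_same replicate_Suc append_Cons)
    have ones': "replicate r \<one> = replicate i \<one> @ replicate (r - i) \<one>"
      by (metis i(1) le_add_diff_inverse replicate_add)
    have "set (map e q @ replicate i \<one>) \<subseteq> carrier G" "set (replicate (r - i) \<one> @ post) \<subseteq> carrier G"
      using qc pc by (auto simp: set_replicate_conv_if)
    from bar_face_one[OF this, of j] i(2) show ?thesis
      unfolding gs(2) ones ones' by auto
  qed
  fix j assume j: "j \<in> {..length ?b} - {length q..Suc (length q + r)}"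
    and low: "kind [] (bar_face G j ?b) = Low"
  then consider "j < length q" | "j > Suc (length q + r)" by fastforce
  then show "word (bar_face G j ?b) \<prec> word gs"
  proof cases
    case 1
    then show ?thesis
      using word_face_left[OF q, of j "word post"] wgs wr[of "Suc r"]
      by (simp add: bar_face_append_left)
  next
    case 2
    define k where "k = j - Suc (length q + r)"
    have k: "0 < k" "k \<le> length post" using 2 j by (auto simp: k_def)
    have f: "bar_face G j ?b = map e q @ replicate (Suc r) \<one> @ bar_face G k post"
      using bar_face_append_right[of "map e q @ replicate (Suc r) \<one>" j post G] 2 j by (simp add: k_def)
    \<comment> \<open>A \<open>Low\<close> face needs an odd run of ones, so the even run must have
      grown. A face to its right achieves this only if the first two entries of \<open>post\<close>
      multiply to the identity; then their product is not reduced and the word drops.\<close>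
    have bad: "\<not> (bar_face G k post = [] \<or> hd (bar_face G k post) \<noteq> \<one>)"
      using kind_ones[OF q, of "bar_face G k post" "Suc r"] low r unfolding f by auto
    obtain h post' where h: "post = h # post'" "h \<noteq> \<one>" "h \<in> carrier G"
      using k post pc by (cases post) auto
    have "k = 1"
    proof (rule ccontr)
      assume "k \<noteq> 1"
      then have "bar_face G k post = h # bar_face G (k - 1) post'"
        using bar_face_append_right[of "[h]" k post' G] k h by simp
      then show False using bad h by simp
    qed
    then obtain h2 hs where h2: "post' = h2 # hs"
      using bad h by (cases post') (auto simp: bar_face_def)
    have f1: "bar_face G k post = (h \<otimes> h2) # hs"
      using \<open>k = 1\<close> bar_face_middle[of G "[]" h h2 hs] h h2 by simp
    have h2c: "h2 \<in> carrier G" using pc h h2 by simp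
    have "h \<otimes> h2 = \<one>" using bad f1 by simp
    moreover have "nf h \<noteq> []" using nf_Nil_iff h by simp
    ultimately have "\<not> successively R (nf h @ nf h2)"
      using nf_mult(1)[OF h(3) h2c] by auto
    from nf_mult(2)[OF h(3) h2c this, of q "word hs"]
    show ?thesis unfolding f f1 using wgs h h2 X wr[of "Suc r"] by simp
  qed
qed

lemma ones_decomp:
  obtains post where "\<one> # hs = replicate (run (\<one> # hs)) \<one> @ post" "post = [] \<or> hd post \<noteq> \<one>"
proof -
  let ?P = "(=) \<one>"
  have "takeWhile ?P (\<one> # hs) = replicate (run (\<one> # hs)) \<one>"
    unfolding run_def by (rule replicate_length_same[symmetric]) (auto dest: set_takeWhileD)
  then have "\<one> # hs = replicate (run (\<one> # hs)) \<one> @ dropWhile ?P (\<one> # hs)"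
    by (metis takeWhile_dropWhile_id)
  moreover have "dropWhile ?P (\<one> # hs) = [] \<or> hd (dropWhile ?P (\<one> # hs)) \<noteq> \<one>"
    using hd_dropWhile[of ?P "\<one> # hs"] by metis
  ultimately show ?thesis using that by blast
qed

lemma matched_partner:
  assumes "set gs \<subseteq> carrier G" "kind [] gs = Low"
  obtains m s where "matched gs (partner gs) {m..m + 2 * s}"
  using assms(1) essential_simps(1)
proof (cases gs rule: kind_cases)
  case (Crit q)
  then show ?thesis using assms(2) by simp
next
  case (One q hs)
  obtain post where post: "\<one> # hs = replicate (run (\<one> # hs)) \<one> @ post" "post = [] \<or> hd post \<noteq> \<one>"
    by (rule ones_decomp)
  have r: "odd (run (\<one> # hs))" using One assms(2) by (auto split: if_splits)
  then obtain s where s: "run (\<one> # hs) = 2 * s + 1" by (elim oddE)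
  have q: "essential q" using One by simp
  have p: "partner gs = map e q @ replicate (Suc (run (\<one> # hs))) \<one> @ post"
    using One(1) essential_letters[OF q] post(1) by (simp add: partner_append)
  have "matched gs (partner gs) {length q..Suc (length q + run (\<one> # hs))}"
    unfolding p by (rule matched_ones[OF assms(1) _ q r post(2)]) (use One(1) post(1) in simp)
  moreover have "Suc (length q + run (\<one> # hs)) = length q + 2 * (s + 1)" using s by simp
  ultimately show ?thesis using that by metis
next
  case (High q y ys g hs)
  then show ?thesis using assms(2) by simp
next
  case (Low q y ys g hs)
  have q: "essential (q @ [y])" using Low by simp
  have p: "partner gs = map e q @ e y # eval ys # hs"
    using Low essential_letters[OF q] by (simp add: partner_append)
  have "matched gs (partner gs) {Suc (length q)..Suc (length q) + 2 * 0}"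
    unfolding p using matched_Low[OF assms(1) Low(1) q Low(3,4)] by simp
  then show ?thesis using that by metis
qed

text \<open>The inverse of the matching: an even run of ones has length at least two and is
  shortened by one; otherwise the deciding entry is multiplied with the last letter of the prefix,
  which gives a reduced product with at least two letters.\<close>

lemma High_is_partner:
  assumes "set b \<subseteq> carrier G" "kind [] b = High"
  obtains gs where "set gs \<subseteq> carrier G" "kind [] gs = Low" "partner gs = b"
  using assms(1) essential_simps(1)
proof (cases b rule: kind_cases)
  case (Crit q)
  then show ?thesis using assms(2) by simp
next
  case (One q hs)
  obtain post where post: "\<one> # hs = replicate (run (\<one> # hs)) \<one> @ post" "post = [] \<or> hd post \<noteq> \<one>"
    by (rule ones_decomp)
  have r: "even (run (\<one> # hs))" using One assms(2) by (auto split: if_splits)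
  have "run (\<one> # hs) > 0" by (simp add: run_def)
  then obtain r' where r': "run (\<one> # hs) = Suc (Suc r')" "odd (Suc r')" using r
    by (metis even_Suc gr0_implies_Suc odd_pos even_zero)
  have q: "essential q" using One by simp
  let ?gs = "map e q @ replicate (Suc r') \<one> @ post"
  show ?thesis
  proof (rule that)
    have "b = map e q @ \<one> # replicate (Suc r') \<one> @ post" using One(1) post(1) r' by simp
    then show "set ?gs \<subseteq> carrier G" "partner ?gs = b"
      using assms(1) essential_letters[OF q] by (auto simp: partner_append)
    show "kind [] ?gs = Low" using kind_ones[OF q post(2), of "Suc r'"] r' by simp
  qed
next
  case (High q y ys g hs)
  then obtain q' x where qx: "q = q' @ [x]" by (cases q rule: rev_cases) auto
  have g: "g \<in> carrier G" and hs: "set hs \<subseteq> carrier G" using High assms(1) by auto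
  have ess: "essential (q' @ [x])" using High qx by simp
  have X: "set q' \<subseteq> X" "x \<in> X" using essential_letters[OF ess] by auto
  have nf: "nf (e x \<otimes> g) = x # y # ys"
    using nf_mult(1)[of "e x" g] X letter g High qx nf_reduced[OF g] by (simp add: successively_Cons)
  let ?gs = "map e q' @ (e x \<otimes> g) # hs"
  show ?thesis
  proof (rule that)
    show "set ?gs \<subseteq> carrier G" using X letter g hs by auto
    have "eval (y # ys) = g" using eval_nf'[OF g] High by simp
    then show "partner ?gs = b" using X nf High(1) qx by (simp add: partner_append)
    show "kind [] ?gs = Low"
      using kind_append[of "[]" q'] ess nf by (auto simp: essential_append_iff)
  qed
next
  case (Low q y ys g hs)
  then show ?thesis using assms(2) by simp
qed

end

section \<open>The critical part of a chain\<close>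

definition push :: "('a \<Rightarrow> 'b) \<Rightarrow> ('a \<Rightarrow>\<^sub>0 'k::field) \<Rightarrow> ('b \<Rightarrow>\<^sub>0 'k)" where
  "push f c = (\<Sum>x\<in>Poly_Mapping.keys c. Poly_Mapping.single (f x) (Poly_Mapping.lookup c x))"

lemma push_superset:
  assumes "finite S" "Poly_Mapping.keys c \<subseteq> S"
  shows "push f c = (\<Sum>x\<in>S. Poly_Mapping.single (f x) (Poly_Mapping.lookup c x))"
  unfolding push_def using assms
  by (intro sum.mono_neutral_left) (auto simp: in_keys_iff)

lemma push_0 [simp]: "push f 0 = 0"
  by (simp add: push_def)

lemma push_add: "push f (c + d) = push f c + push f d"
proof -
  let ?S = "Poly_Mapping.keys c \<union> Poly_Mapping.keys d"
  show ?thesis using Poly_Mapping.keys_add[of c d]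
    by (simp add: push_superset[of ?S] lookup_add single_add sum.distrib)
qed

lemma push_scale: "push f (scale_chain a c) = scale_chain a (push f c)"
  using keys_scale_chain[of a c]
  by (simp add: push_superset[of "Poly_Mapping.keys c"] scale_chain_sum scale_chain_single)

lemma push_sum: "push f (sum g S) = (\<Sum>x\<in>S. push f (g x))"
  by (induction S rule: infinite_finite_induct) (auto simp: push_add)

lemma push_single [simp]: "push f (Poly_Mapping.single x a) = Poly_Mapping.single (f x) a"
  by (subst push_superset[of "{x}"]) auto

lemma keys_push_subset: "Poly_Mapping.keys (push f c) \<subseteq> f ` Poly_Mapping.keys c"
  unfolding push_def using keys_sum by (fastforce split: if_splits)

lemma keys_pushE:
  assumes "y \<in> Poly_Mapping.keys (push f c)"
  obtains x where "x \<in> Poly_Mapping.keys c" "y = f x"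
  using subsetD[OF keys_push_subset assms] by (elim imageE) (rule that)

lemma lookup_push_inj:
  assumes "inj_on f A" "Poly_Mapping.keys c \<subseteq> A" "x \<in> A"
  shows "Poly_Mapping.lookup (push f c) (f x) = Poly_Mapping.lookup c x"
proof -
  have "Poly_Mapping.lookup (push f c) (f x) =
      (\<Sum>y\<in>Poly_Mapping.keys c. if y = x then Poly_Mapping.lookup c y else 0)"
    unfolding push_def lookup_sum
    by (intro sum.cong refl) (use assms in \<open>auto simp: lookup_single when_def dest: inj_onD\<close>)
  also have "\<dots> = Poly_Mapping.lookup c x"
    by (simp add: in_keys_iff)
  finally show ?thesis .
qed

lemma keys_push_inj:
  assumes "inj_on f A" "Poly_Mapping.keys c \<subseteq> A"
  shows "Poly_Mapping.keys (push f c) = f ` Poly_Mapping.keys c"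
  using keys_push_subset[of f c] lookup_push_inj[OF assms] assms(2)
  by (auto simp: in_keys_iff)

lemma chain_eq_sum:
  "c = (\<Sum>x\<in>Poly_Mapping.keys c. scale_chain (Poly_Mapping.lookup c x) (Poly_Mapping.single x 1))"
proof (rule poly_mapping_eqI)
  fix y
  have "(\<Sum>x\<in>Poly_Mapping.keys c. Poly_Mapping.lookup c x * Poly_Mapping.lookup (Poly_Mapping.single x 1) y) =
      (\<Sum>x\<in>Poly_Mapping.keys c. if x = y then Poly_Mapping.lookup c x else 0)"
    by (intro sum.cong) (auto simp: lookup_single)
  then show "Poly_Mapping.lookup c y = Poly_Mapping.lookup
      (\<Sum>x\<in>Poly_Mapping.keys c. scale_chain (Poly_Mapping.lookup c x) (Poly_Mapping.single x 1)) y"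
    by (simp add: lookup_sum in_keys_iff)
qed

lemma scale_chain_minus_one: "scale_chain (- 1) c = - c"
  by (rule poly_mapping_eqI) simp

lemma keys_add_subset:
  "Poly_Mapping.keys c \<subseteq> A \<Longrightarrow> Poly_Mapping.keys d \<subseteq> A \<Longrightarrow> Poly_Mapping.keys (c + d) \<subseteq> A"
  using Poly_Mapping.keys_add[of c d] by blast

lemma push_push: "push f (push g c) = push (f \<circ> g) (c :: _ \<Rightarrow>\<^sub>0 'k::field)"
  by (simp add: push_def[of g] push_sum) (simp add: push_def)

lemma push_cong: "(\<And>x. x \<in> Poly_Mapping.keys c \<Longrightarrow> f x = g x) \<Longrightarrow> push f c = push g c"
  unfolding push_def by (intro sum.cong) auto

section \<open>Splitting chains along the matching\<close>

context quadratic_normal_form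
begin

definition cells :: "cell_kind \<Rightarrow> nat \<Rightarrow> 'g list set" where
  "cells K p = {gs. set gs \<subseteq> carrier G \<and> length gs = p \<and> kind [] gs = K}"

definition crit_words :: "nat \<Rightarrow> 'x list set" where
  "crit_words p = {w. essential w \<and> length w = p}"

lemma crit_wordsD: "w \<in> crit_words p \<Longrightarrow> length w = p \<and> set w \<subseteq> X"
  by (simp add: crit_words_def essential_def)

lemma cells_Crit: "cells Crit p = map e ` crit_words p"
proof -
  have "gs \<in> map e ` crit_words p" if gs: "set gs \<subseteq> carrier G" "length gs = p" "kind [] gs = Crit" for gs
    using gs(1) essential_simps(1)
    by (cases gs rule: kind_cases) (use gs in \<open>auto simp: crit_words_def split: if_splits\<close>)
  moreover have "gs \<in> cells Crit p" if "gs \<in> map e ` crit_words p" for gs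
  proof -
    from that obtain w where w: "gs = map e w" "essential w" "length w = p"
      by (auto simp: crit_words_def)
    have "e x \<in> carrier G" if "x \<in> set w" for x
      using that essential_letters[OF w(2)] letter by auto
    then show ?thesis using w kind_essential[OF w(2)] by (auto simp: cells_def)
  qed
  ultimately show ?thesis unfolding cells_def by blast
qed

lemma inj_on_map_e: "inj_on (map e) (crit_words p)"
proof (rule inj_onI)
  fix v w assume "v \<in> crit_words p" "w \<in> crit_words p" "map e v = map e w"
  then show "v = w" using word_map_e essential_letters unfolding crit_words_def
    by (metis (mono_tags, lifting) mem_Collect_eq)
qed

lemma boundary_matched:
  assumes "matched gs b I"
  shows "(bar_boundary_basis G b :: _ \<Rightarrow>\<^sub>0 'k::field) =
    scale_chain (\<Sum>j\<in>I. (- 1) ^ j) (Poly_Mapping.single gs 1) +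
    (\<Sum>j\<in>{..length b} - I. scale_chain ((- 1) ^ j) (Poly_Mapping.single (bar_face G j b) 1))"
proof -
  have b: "b \<noteq> []" and I: "I \<subseteq> {..length b}" "\<And>j. j \<in> I \<Longrightarrow> bar_face G j b = gs"
    using assms by (auto simp: matched_def)
  have "(bar_boundary_basis G b :: _ \<Rightarrow>\<^sub>0 'k) =
      (\<Sum>j\<le>length b. Poly_Mapping.single (bar_face G j b) ((- 1) ^ j))"
    using b by (simp add: bar_boundary_basis_def)
  also have "\<dots> = (\<Sum>j\<in>I. Poly_Mapping.single (bar_face G j b) ((- 1) ^ j)) +
      (\<Sum>j\<in>{..length b} - I. Poly_Mapping.single (bar_face G j b) ((- 1) ^ j))"
    by (subst sum.subset_diff[OF I(1)]) (simp_all add: add.commute)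
  also have "(\<Sum>j\<in>I. Poly_Mapping.single (bar_face G j b) ((- 1) ^ j :: 'k)) =
      (\<Sum>j\<in>I. Poly_Mapping.single gs ((- 1) ^ j))"
    by (intro sum.cong) (auto simp: I(2))
  also have "\<dots> = scale_chain (\<Sum>j\<in>I. (- 1) ^ j) (Poly_Mapping.single gs 1)"
  proof (rule poly_mapping_eqI)
    show "Poly_Mapping.lookup (\<Sum>j\<in>I. Poly_Mapping.single gs ((- 1) ^ j)) k =
        Poly_Mapping.lookup (scale_chain (\<Sum>j\<in>I. (- 1) ^ j) (Poly_Mapping.single gs 1)) k" for k
      by (cases "k = gs") (simp_all add: lookup_sum lookup_single)
  qed
  finally show ?thesis by (simp add: scale_chain_single)
qed

text \<open>The critical coordinate of \<open>c\<close> in the direct sum of the span of the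
  \<open>High\<close> cells, the boundaries of \<open>High\<close> cells one degree up, and the span
  of the critical cells. That the sum is direct and exhausts all chains is shown below.\<close>

definition decomposes :: "nat \<Rightarrow> ('g list \<Rightarrow>\<^sub>0 'k::field) \<Rightarrow> ('x list \<Rightarrow>\<^sub>0 'k) \<Rightarrow> bool" where
  "decomposes p c r \<longleftrightarrow> (\<exists>b b'. Poly_Mapping.keys b \<subseteq> cells High p \<and>
     Poly_Mapping.keys b' \<subseteq> cells High (Suc p) \<and> Poly_Mapping.keys r \<subseteq> crit_words p \<and>
     c = b + bar_boundary G b' + push (map e) r)"

lemma decomposesI:
  assumes "Poly_Mapping.keys b \<subseteq> cells High p" "Poly_Mapping.keys b' \<subseteq> cells High (Suc p)"
    "Poly_Mapping.keys r \<subseteq> crit_words p" "c = b + bar_boundary G b' + push (map e) r"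
  shows "decomposes p c r"
  unfolding decomposes_def by (intro exI conjI) (rule assms)+

lemma decomposesE:
  assumes "decomposes p c r"
  obtains b b' where "Poly_Mapping.keys b \<subseteq> cells High p" "Poly_Mapping.keys b' \<subseteq> cells High (Suc p)"
    "Poly_Mapping.keys r \<subseteq> crit_words p" "c = b + bar_boundary G b' + push (map e) r"
  using assms unfolding decomposes_def by (elim exE conjE) (rule that)

lemma decomposes_add:
  assumes "decomposes p c r" "decomposes p d s"
  shows "decomposes p (c + d) (r + s)"
proof -
  obtain b b' where c: "Poly_Mapping.keys b \<subseteq> cells High p"
     "Poly_Mapping.keys b' \<subseteq> cells High (Suc p)" "Poly_Mapping.keys r \<subseteq> crit_words p"
     "c = b + bar_boundary G b' + push (map e) r" using assms(1) by (rule decomposesE)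
  obtain a a' where d: "Poly_Mapping.keys a \<subseteq> cells High p"
     "Poly_Mapping.keys a' \<subseteq> cells High (Suc p)" "Poly_Mapping.keys s \<subseteq> crit_words p"
     "d = a + bar_boundary G a' + push (map e) s" using assms(2) by (rule decomposesE)
  show ?thesis
  proof (rule decomposesI)
    show "Poly_Mapping.keys (b + a) \<subseteq> cells High p" by (rule keys_add_subset[OF c(1) d(1)])
    show "Poly_Mapping.keys (b' + a') \<subseteq> cells High (Suc p)" by (rule keys_add_subset[OF c(2) d(2)])
    show "Poly_Mapping.keys (r + s) \<subseteq> crit_words p" by (rule keys_add_subset[OF c(3) d(3)])
    show "c + d = (b + a) + bar_boundary G (b' + a') + push (map e) (r + s)"
      by (simp add: c(4) d(4) bar_boundary_add push_add)
  qed
qed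

lemma decomposes_scale:
  assumes "decomposes p c r"
  shows "decomposes p (scale_chain a c) (scale_chain a r)"
proof -
  obtain b b' where c: "Poly_Mapping.keys b \<subseteq> cells High p"
     "Poly_Mapping.keys b' \<subseteq> cells High (Suc p)" "Poly_Mapping.keys r \<subseteq> crit_words p"
     "c = b + bar_boundary G b' + push (map e) r" using assms(1) by (rule decomposesE)
  show ?thesis
  proof (rule decomposesI)
    show "scale_chain a c = scale_chain a b + bar_boundary G (scale_chain a b') + push (map e) (scale_chain a r)"
      by (simp add: c(4) bar_boundary_scale push_scale scale_chain_distrib)
  qed (rule order_trans[OF keys_scale_chain] c(1-3))+
qed

lemma decomposes_0: "decomposes p 0 0"
  by (rule decomposesI[of 0 p 0]) simp_all

lemma decomposes_sum:
  "(\<And>x. x \<in> S \<Longrightarrow> \<exists>r. decomposes p (f x) r) \<Longrightarrow> \<exists>r. decomposes p (sum f S) r"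
proof (induction S rule: infinite_finite_induct)
  case (insert x S)
  then show ?case using decomposes_add by (metis insertCI sum.insert)
qed (use decomposes_0 in auto)

text \<open>Solving the boundary of the partner for a \<open>Low\<close> cell rewrites it in terms of smaller cells.\<close>

lemma decomposes_cell:
  assumes "set gs \<subseteq> carrier G"
  shows "\<exists>r. decomposes (length gs) (Poly_Mapping.single gs (1::'k::field)) r"
  using assms
proof (induction gs rule: wf_induct_rule[OF wf_inv_image[OF wf_below, of word]])
  case (1 gs)
  show ?case
  proof (cases "kind [] gs")
    case Crit
    then have "gs \<in> cells Crit (length gs)" using 1(2) by (simp add: cells_def)
    then obtain w where w: "w \<in> crit_words (length gs)" "gs = map e w"
      unfolding cells_Crit by blast
    show ?thesis
      by (rule exI[of _ "Poly_Mapping.single w 1"], rule decomposesI[of 0 _ 0]) (use w in auto)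
  next
    case High
    show ?thesis
      by (rule exI[of _ 0], rule decomposesI[of "Poly_Mapping.single gs 1" _ 0])
        (use High 1(2) in \<open>auto simp: cells_def\<close>)
  next
    case Low
    from matched_partner[OF 1(2) Low] obtain m s where M: "matched gs (partner gs) {m..m + 2 * s}" .
    define b where "b = partner gs"
    define I where "I = {m..m + 2 * s}"
    define \<epsilon> where "\<epsilon> = (\<Sum>j\<in>I. (- 1) ^ j :: 'k)"
    have \<epsilon>: "\<epsilon> \<noteq> 0" by (simp add: \<epsilon>_def I_def sum_alternating_odd)
    have M: "matched gs b I" using M by (simp add: b_def I_def)
    have b: "set b \<subseteq> carrier G" "length b = Suc (length gs)" "kind [] b = High" "b \<noteq> []"
      using M by (auto simp: matched_def)
    let ?d = "bar_boundary G (Poly_Mapping.single b (1::'k))"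
    let ?rest = "\<Sum>j\<in>{..length b} - I. scale_chain ((- 1) ^ j) (Poly_Mapping.single (bar_face G j b) (1::'k))"
    have d: "?d = scale_chain \<epsilon> (Poly_Mapping.single gs 1) + ?rest"
      using boundary_matched[OF M, where 'k = 'k]
      by (simp add: bar_boundary_single scale_chain_distrib \<epsilon>_def)
    have dd: "decomposes (length gs) ?d 0"
      by (rule decomposesI[of 0 _ "Poly_Mapping.single b 1"]) (use b in \<open>auto simp: cells_def\<close>)
    have "\<exists>r. decomposes (length gs) ?rest r"
    proof (rule decomposes_sum)
      fix j assume j: "j \<in> {..length b} - I"
      have f: "set (bar_face G j b) \<subseteq> carrier G" "length (bar_face G j b) = length gs"
        using j b(2) set_bar_face[OF monoid b(4) b(1), of j] length_bar_face[OF b(4), of j G] by simp_all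
      have "\<exists>r. decomposes (length gs) (Poly_Mapping.single (bar_face G j b) (1::'k)) r"
      proof (cases "kind [] (bar_face G j b) = Low")
        case True
        then have "word (bar_face G j b) \<prec> word gs" using M j by (auto simp: matched_def)
        then show ?thesis using 1(1)[of "bar_face G j b"] f by simp
      next
        case False
        then consider "kind [] (bar_face G j b) = Crit" | "kind [] (bar_face G j b) = High"
          by (cases "kind [] (bar_face G j b)") auto
        then show ?thesis
        proof cases
          case 1
          then have "bar_face G j b \<in> cells Crit (length gs)" using f by (simp add: cells_def)
          then obtain w where w: "w \<in> crit_words (length gs)" "bar_face G j b = map e w"
            unfolding cells_Crit by blast
          show ?thesis
            by (rule exI[of _ "Poly_Mapping.single w 1"], rule decomposesI[of 0 _ 0]) (use w in auto)
        next
          case 2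
          show ?thesis
            by (rule exI[of _ 0], rule decomposesI[of "Poly_Mapping.single (bar_face G j b) 1" _ 0])
              (use 2 f in \<open>auto simp: cells_def\<close>)
        qed
      qed
      then show "\<exists>r. decomposes (length gs) (scale_chain ((- 1) ^ j) (Poly_Mapping.single (bar_face G j b) (1::'k))) r"
        using decomposes_scale by blast
    qed
    then obtain r where "decomposes (length gs) ?rest r" ..
    note r = decomposes_add[OF dd decomposes_scale[OF this, of "- 1"]]
    have "Poly_Mapping.single gs 1 = scale_chain (inverse \<epsilon>) (?d + scale_chain (- 1) ?rest)"
      unfolding d using \<epsilon> by (simp add: scale_chain_minus_one scale_chain_distrib(3)[symmetric] scale_chain_distrib(4))
    with decomposes_scale[OF r, of "inverse \<epsilon>"] show ?thesis by (intro exI) simp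
  qed
qed

lemma decomposes_exists:
  assumes "c \<in> carrier (bar_chains G p)"
  shows "\<exists>r. decomposes p (c :: _ \<Rightarrow>\<^sub>0 'k::field) r"
proof -
  have "\<exists>r. decomposes p (\<Sum>x\<in>Poly_Mapping.keys c. scale_chain (Poly_Mapping.lookup c x) (Poly_Mapping.single x 1)) r"
  proof (rule decomposes_sum)
    fix gs assume "gs \<in> Poly_Mapping.keys c"
    then have "set gs \<subseteq> carrier G" "length gs = p" using assms by (auto simp: carrier_bar_chains)
    then obtain r where "decomposes p (Poly_Mapping.single gs (1::'k)) r"
      using decomposes_cell[of gs] by auto
    then show "\<exists>r. decomposes p (scale_chain (Poly_Mapping.lookup c gs) (Poly_Mapping.single gs 1)) r"
      using decomposes_scale by blast
  qed
  then show ?thesis using chain_eq_sum[of c] by simp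
qed

text \<open>Coefficient form of triangularity: the \<open>Low\<close> part of the boundary of
  \<open>High\<close> cells is triangular for the word order, with signs on the diagonal.\<close>

lemma lookup_boundary_matched:
  assumes M: "matched gs b {m..m + 2 * s}" and a: "kind [] a = Low" "\<not> word a \<prec> word gs"
  shows "Poly_Mapping.lookup (bar_boundary_basis G b) a = (if a = gs then (- 1) ^ m else (0::'k::field))"
proof -
  let ?I = "{m..m + 2 * s}"
  have "(\<Sum>j\<in>{..length b} - ?I. (- 1) ^ j * Poly_Mapping.lookup (Poly_Mapping.single (bar_face G j b) (1::'k)) a) = 0"
  proof (rule sum.neutral, rule ballI)
    fix j assume j: "j \<in> {..length b} - ?I"
    have "bar_face G j b \<noteq> a" using M j a unfolding matched_def by blast
    then show "(- 1) ^ j * Poly_Mapping.lookup (Poly_Mapping.single (bar_face G j b) (1::'k)) a = 0"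
      by (simp add: lookup_single)
  qed
  then show ?thesis
    unfolding boundary_matched[OF M, where 'k = 'k]
    by (simp add: lookup_add lookup_sum lookup_single when_def sum_alternating_odd)
qed

text \<open>A triangular system with units on the diagonal has trivial kernel. Take a cell of
  \<open>c\<close> whose \<open>Low\<close> partner has a maximal word: no other cell of
  \<open>c\<close> contributes to the coefficient of this partner.\<close>

lemma boundary_High_inj:
  fixes c :: "'g list \<Rightarrow>\<^sub>0 'k::field"
  assumes c: "\<And>b. b \<in> Poly_Mapping.keys c \<Longrightarrow> set b \<subseteq> carrier G \<and> kind [] b = High"
    and d: "\<And>a. kind [] a = Low \<Longrightarrow> Poly_Mapping.lookup (bar_boundary G c) a = 0"
  shows "c = 0"
proof (rule ccontr)
  assume "c \<noteq> 0"
  have "\<forall>b\<in>Poly_Mapping.keys c. \<exists>gs. set gs \<subseteq> carrier G \<and> kind [] gs = Low \<and> partner gs = b"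
    using c High_is_partner by metis
  then obtain \<nu> where \<nu>: "\<And>b. b \<in> Poly_Mapping.keys c \<Longrightarrow>
      set (\<nu> b) \<subseteq> carrier G \<and> kind [] (\<nu> b) = Low \<and> partner (\<nu> b) = b" by metis
  define Q where "Q = (\<lambda>b b'. word (\<nu> b) \<prec> word (\<nu> b'))"
  have "asymp_on (Poly_Mapping.keys c) Q" "transp_on (Poly_Mapping.keys c) Q"
    unfolding Q_def using below_trans below_irrefl by (auto intro!: asymp_onI transp_onI)
  then obtain b0 where b0: "b0 \<in> Poly_Mapping.keys c"
    "\<And>b. b \<in> Poly_Mapping.keys c \<Longrightarrow> b \<noteq> b0 \<Longrightarrow> \<not> word (\<nu> b0) \<prec> word (\<nu> b)"
    using Finite_Set.bex_max_element[of "Poly_Mapping.keys c" Q] \<open>c \<noteq> 0\<close> unfolding Q_def by auto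
  obtain m0 s0 where M0: "matched (\<nu> b0) b0 {m0..m0 + 2 * s0}"
    using matched_partner[of "\<nu> b0"] \<nu>[OF b0(1)] by auto
  have "Poly_Mapping.lookup (bar_boundary_basis G b) (\<nu> b0) = (if b = b0 then (- 1) ^ m0 else (0::'k))"
    if b: "b \<in> Poly_Mapping.keys c" for b
  proof (cases "b = b0")
    case True
    then show ?thesis using lookup_boundary_matched[OF M0, of "\<nu> b0"] \<nu>[OF b0(1)] below_irrefl by auto
  next
    case False
    obtain m s where M: "matched (\<nu> b) b {m..m + 2 * s}"
      using matched_partner[of "\<nu> b"] \<nu>[OF b] by auto
    have "\<nu> b0 \<noteq> \<nu> b" using \<nu>[OF b] \<nu>[OF b0(1)] False by metis
    then show ?thesis using lookup_boundary_matched[OF M, of "\<nu> b0"] \<nu>[OF b0(1)] b0(2)[OF b False] False by auto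
  qed
  then have "Poly_Mapping.lookup (bar_boundary G c) (\<nu> b0) =
      (\<Sum>b\<in>Poly_Mapping.keys c. Poly_Mapping.lookup c b * (if b = b0 then (- 1) ^ m0 else 0))"
    unfolding bar_boundary_def lookup_sum lookup_scale_chain by (intro sum.cong) auto
  also have "\<dots> = Poly_Mapping.lookup c b0 * (- 1) ^ m0"
    using b0(1) by (simp add: if_distrib sum.delta cong: if_cong)
  finally show False using d[of "\<nu> b0"] \<nu>[OF b0(1)] b0(1) by (simp add: in_keys_iff)
qed

text \<open>On \<open>Low\<close> cells only the boundary of \<open>b'\<close> can be nonzero, so
  \<open>boundary_High_inj\<close> kills \<open>b'\<close>. The other two summands are supported on
  disjoint sets of cells.\<close>

lemma decomposes_zero:
  fixes r :: "'x list \<Rightarrow>\<^sub>0 'k::field"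
  assumes "decomposes p 0 r"
  shows "r = 0"
proof -
  obtain b b' :: "_ \<Rightarrow>\<^sub>0 'k" where b: "Poly_Mapping.keys b \<subseteq> cells High p"
    and b': "Poly_Mapping.keys b' \<subseteq> cells High (Suc p)" and r: "Poly_Mapping.keys r \<subseteq> crit_words p"
    and eq: "0 = b + bar_boundary G b' + push (map e) r" using assms by (rule decomposesE)
  have kr: "Poly_Mapping.keys (push (map e) r) \<subseteq> cells Crit p"
    using keys_push_subset[of "map e" r] r cells_Crit by blast
  have lb: "Poly_Mapping.lookup b a = 0" if "kind [] a \<noteq> High" for a
    using that b by (auto simp: cells_def in_keys_iff subset_iff)
  have lr: "Poly_Mapping.lookup (push (map e) r) a = 0" if "kind [] a \<noteq> Crit" for a
    using that kr by (auto simp: cells_def in_keys_iff subset_iff)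
  have "Poly_Mapping.lookup (bar_boundary G b') a = 0" if "kind [] a = Low" for a
    using arg_cong[OF eq, of "\<lambda>x. Poly_Mapping.lookup x a"] lb[of a] lr[of a] that
    by (simp add: lookup_add)
  then have "b' = 0" using boundary_High_inj[of b'] b' by (auto simp: cells_def)
  then have eq2: "0 = b + push (map e) r" using eq by simp
  have "Poly_Mapping.lookup (push (map e) r) a = 0" for a
    using arg_cong[OF eq2, of "\<lambda>x. Poly_Mapping.lookup x a"] lb[of a] lr[of a]
    by (cases "kind [] a") (auto simp add: lookup_add)
  then have "Poly_Mapping.lookup r w = 0" if "w \<in> crit_words p" for w
    using lookup_push_inj[OF inj_on_map_e r that] by simp
  then show "r = 0" using r by (intro poly_mapping_eqI) (auto simp: in_keys_iff subset_iff)
qed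

lemma decomposes_unique:
  assumes "decomposes p c r" "decomposes p c s"
  shows "r = s"
proof -
  have "decomposes p (c + scale_chain (- 1) c) (r + scale_chain (- 1) s)"
    using assms by (intro decomposes_add decomposes_scale)
  then show ?thesis using decomposes_zero[of p "r - s"] by (simp add: scale_chain_minus_one)
qed

definition crit_part :: "nat \<Rightarrow> ('g list \<Rightarrow>\<^sub>0 'k::field) \<Rightarrow> ('x list \<Rightarrow>\<^sub>0 'k)" where
  "crit_part p c = (THE r. decomposes p c r)"

lemma crit_part_eq: "decomposes p c r \<Longrightarrow> crit_part p c = r"
  unfolding crit_part_def using decomposes_unique by (intro the_equality)

lemma decomposes_crit_part:
  "c \<in> carrier (bar_chains G p) \<Longrightarrow> decomposes p c (crit_part p c)"
  using decomposes_exists[of c p] crit_part_eq[of p c] by auto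

lemma crit_part_add:
  "c \<in> carrier (bar_chains G p) \<Longrightarrow> d \<in> carrier (bar_chains G p) \<Longrightarrow>
    crit_part p (c + d) = crit_part p c + crit_part p d"
  by (intro crit_part_eq decomposes_add decomposes_crit_part)

lemma crit_part_scale:
  "c \<in> carrier (bar_chains G p) \<Longrightarrow> crit_part p (scale_chain a c) = scale_chain a (crit_part p c)"
  by (intro crit_part_eq decomposes_scale decomposes_crit_part)

lemma keys_crit_part:
  "c \<in> carrier (bar_chains G p) \<Longrightarrow> Poly_Mapping.keys (crit_part p c) \<subseteq> crit_words p"
  by (erule decomposesE[OF decomposes_crit_part])

text \<open>What remains is \<open>b\<close> plus a boundary. Then \<open>b\<close> is itself a
  cycle of \<open>High\<close> cells and vanishes by \<open>boundary_High_inj\<close>.\<close>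

lemma cycle_crit_part_zero:
  fixes z :: "'g list \<Rightarrow>\<^sub>0 'k::field"
  assumes z: "z \<in> bar_cycles G p" and "crit_part p z = 0"
  shows "z \<in> bar_boundaries G p"
proof -
  have "decomposes p z 0" using decomposes_crit_part[of z p] assms by (simp add: bar_cycles_def)
  then obtain b b' :: "_ \<Rightarrow>\<^sub>0 'k" where b: "Poly_Mapping.keys b \<subseteq> cells High p"
    and b': "Poly_Mapping.keys b' \<subseteq> cells High (Suc p)" and "z = b + bar_boundary G b' + push (map e) 0"
    by (rule decomposesE)
  then have eq: "z = b + bar_boundary G b'" by simp
  have bb: "bar_boundary G b' \<in> bar_boundaries G p"
    using b' unfolding bar_boundaries_def
    by (intro imageI) (auto simp: carrier_bar_chains cells_def)
  then have "bar_boundary G (bar_boundary G b') = 0"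
    using bar_boundaries_subset[OF monoid] by (auto simp: bar_cycles_def)
  then have "bar_boundary G b = 0" using z eq by (simp add: bar_cycles_def bar_boundary_add)
  then have "b = 0" using boundary_High_inj[of b] b by (auto simp: cells_def)
  then show ?thesis using eq bb by simp
qed

end

section \<open>Naturality of the critical part\<close>

locale quadratic_normal_form_hom =
  A: quadratic_normal_form G X e R nf lev N + B: quadratic_normal_form G' X' e' R' nf' lev' N'
  for G :: "'g monoid" and X :: "'x set" and e R nf lev N
    and G' :: "'h monoid" and X' :: "'y set" and e' R' nf' lev' N' +
  fixes \<phi> :: "'g \<Rightarrow> 'h" and \<psi> :: "'x \<Rightarrow> 'y"
  assumes hom: "\<phi> \<in> hom G G'"
    and letter_hom: "x \<in> X \<Longrightarrow> \<psi> x \<in> X'"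
    and e_hom: "x \<in> X \<Longrightarrow> e' (\<psi> x) = \<phi> (e x)"
    and R_hom: "x \<in> X \<Longrightarrow> y \<in> X \<Longrightarrow> R' (\<psi> x) (\<psi> y) \<longleftrightarrow> R x y"
    and one_hom: "\<phi> \<one>\<^bsub>G\<^esub> = \<one>\<^bsub>G'\<^esub>"
begin

lemma hom_mult: "g \<in> carrier G \<Longrightarrow> h \<in> carrier G \<Longrightarrow> \<phi> (g \<otimes>\<^bsub>G\<^esub> h) = \<phi> g \<otimes>\<^bsub>G'\<^esub> \<phi> h"
  using hom by (simp add: hom_def)

lemma hom_closed: "g \<in> carrier G \<Longrightarrow> \<phi> g \<in> carrier G'"
  using hom by (auto simp: hom_def)

lemma successively_hom:
  "set w \<subseteq> X \<Longrightarrow> successively R' (map \<psi> w) \<longleftrightarrow> successively R w"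
  "set w \<subseteq> X \<Longrightarrow> successively (\<lambda>x y. \<not> R' x y) (map \<psi> w) \<longleftrightarrow> successively (\<lambda>x y. \<not> R x y) w"
  unfolding successively_map using R_hom by (auto cong: successively_cong simp: subset_iff)

lemma eval_hom: "set w \<subseteq> X \<Longrightarrow> B.eval (map \<psi> w) = \<phi> (A.eval w)"
  by (induction w) (simp_all add: one_hom hom_mult A.letter A.eval_closed e_hom)

text \<open>The map \<open>\<psi>\<close> turns the normal word of \<open>g\<close> into a reduced
  word with value \<open>\<phi> g\<close>, and normal forms are unique.\<close>

lemma nf_hom:
  assumes "g \<in> carrier G"
  shows "nf' (\<phi> g) = map \<psi> (nf g)"
proof -
  have X: "set (nf g) \<subseteq> X" by (rule A.nf_letters[OF assms])
  then have X': "set (map \<psi> (nf g)) \<subseteq> X'" using letter_hom by auto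
  have "successively R' (map \<psi> (nf g))"
    using successively_hom(1)[OF X] A.nf_reduced[OF assms] by simp
  from B.nf_eval'[OF X' this] show ?thesis using eval_hom[OF X] assms by simp
qed

text \<open>Runs of the identity must not grow under \<open>\<phi>\<close>. They do not, since
  normal forms keep their length.\<close>

lemma hom_one_iff: "g \<in> carrier G \<Longrightarrow> \<one>\<^bsub>G'\<^esub> = \<phi> g \<longleftrightarrow> \<one>\<^bsub>G\<^esub> = g"
  using A.nf_Nil_iff[of g] B.nf_Nil_iff[of "\<phi> g"] nf_hom[of g] hom_closed[of g] by auto

lemma run_hom: "set gs \<subseteq> carrier G \<Longrightarrow> B.run (map \<phi> gs) = A.run gs"
  by (induction gs) (auto simp: A.run_def B.run_def hom_one_iff)

lemma kind_hom:
  "set p \<subseteq> X \<Longrightarrow> set gs \<subseteq> carrier G \<Longrightarrow> B.kind (map \<psi> p) (map \<phi> gs) = A.kind p gs"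
proof (induction gs arbitrary: p)
  case (Cons g gs)
  have g: "g \<in> carrier G" "set gs \<subseteq> carrier G" using Cons.prems by auto
  show ?case
  proof (cases "nf g")
    case Nil
    then show ?thesis using nf_hom[OF g(1)] run_hom[of "g # gs"] Cons.prems by simp
  next
    case (Cons y ys)
    have y: "y \<in> X" using A.nf_letters[OF g(1)] Cons by auto
    have IH: "B.kind (map \<psi> p @ [\<psi> y]) (map \<phi> gs) = A.kind (p @ [y]) gs"
      using Cons.IH[of "p @ [y]"] Cons.prems y by simp
    have last: "p \<noteq> [] \<Longrightarrow> R' (last (map \<psi> p)) (\<psi> y) \<longleftrightarrow> R (last p) y"
      using Cons.prems(1) y R_hom[of "last p" y] by (auto simp: last_map subset_iff)
    show ?thesis using nf_hom[OF g(1)] Cons IH last by auto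
  qed
qed simp

lemma essential_hom: "A.essential w \<Longrightarrow> B.essential (map \<psi> w)"
  using letter_hom successively_hom(2)[of w] by (auto simp: A.essential_def B.essential_def)

lemma bar_face_hom:
  assumes "set gs \<subseteq> carrier G" "gs \<noteq> []" "j \<le> length gs"
  shows "bar_face G' j (map \<phi> gs) = map \<phi> (bar_face G j gs)"
proof (rule nth_equalityI)
  have ne: "map \<phi> gs \<noteq> []" using assms by simp
  show "length (bar_face G' j (map \<phi> gs)) = length (map \<phi> (bar_face G j gs))"
    using length_bar_face[OF ne, of j G'] length_bar_face[OF assms(2,3), of G] assms by simp
  fix t assume "t < length (bar_face G' j (map \<phi> gs))"
  then have t: "t < length gs - 1" using length_bar_face[OF ne, of j G'] assms by simp
  have c: "gs ! t \<in> carrier G" "gs ! (t + 1) \<in> carrier G"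
    using t assms(1) by (auto simp: subset_iff)
  show "bar_face G' j (map \<phi> gs) ! t = map \<phi> (bar_face G j gs) ! t"
    using t hom_mult[OF c] assms(3) length_bar_face[OF assms(2,3), of G]
    by (auto simp add: nth_bar_face)
qed

lemma bar_boundary_basis_hom:
  assumes "set gs \<subseteq> carrier G"
  shows "bar_boundary_basis G' (map \<phi> gs) = (push (map \<phi>) (bar_boundary_basis G gs) :: _ \<Rightarrow>\<^sub>0 'k::field)"
proof (cases "gs = []")
  case False
  have "(\<Sum>j\<le>length gs. Poly_Mapping.single (bar_face G' j (map \<phi> gs)) ((- 1) ^ j :: 'k)) =
      (\<Sum>j\<le>length gs. Poly_Mapping.single (map \<phi> (bar_face G j gs)) ((- 1) ^ j))"
    using bar_face_hom[OF assms False] by (intro sum.cong) auto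
  then show ?thesis using False by (simp add: bar_boundary_basis_def push_sum)
qed (simp add: bar_boundary_basis_def)

lemma bar_boundary_hom:
  fixes c :: "'g list \<Rightarrow>\<^sub>0 'k::field"
  assumes "\<And>gs. gs \<in> Poly_Mapping.keys c \<Longrightarrow> set gs \<subseteq> carrier G"
  shows "bar_boundary G' (push (map \<phi>) c) = push (map \<phi>) (bar_boundary G c)"
proof -
  have "bar_boundary G' (push (map \<phi>) c) =
      (\<Sum>gs\<in>Poly_Mapping.keys c. scale_chain (Poly_Mapping.lookup c gs) (bar_boundary_basis G' (map \<phi> gs)))"
    unfolding push_def by (simp add: bar_boundary_sum bar_boundary_single)
  also have "\<dots> = (\<Sum>gs\<in>Poly_Mapping.keys c. scale_chain (Poly_Mapping.lookup c gs) (push (map \<phi>) (bar_boundary_basis G gs)))"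
    using assms by (intro sum.cong refl) (simp add: bar_boundary_basis_hom)
  also have "\<dots> = push (map \<phi>) (bar_boundary G c)"
    by (simp add: bar_boundary_def push_sum push_scale)
  finally show ?thesis .
qed

lemma push_cells:
  assumes "Poly_Mapping.keys c \<subseteq> A.cells K p"
  shows "Poly_Mapping.keys (push (map \<phi>) c) \<subseteq> B.cells K p"
proof
  fix hs assume "hs \<in> Poly_Mapping.keys (push (map \<phi>) c)"
  then obtain gs where gs: "gs \<in> Poly_Mapping.keys c" "hs = map \<phi> gs" by (rule keys_pushE)
  then have c: "set gs \<subseteq> carrier G" "length gs = p" "A.kind [] gs = K"
    using assms by (auto simp: A.cells_def)
  then have "B.kind [] hs = K" using kind_hom[of "[]" gs] gs(2) by simp
  moreover have "set hs \<subseteq> carrier G'" using c(1) gs(2) hom_closed by auto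
  ultimately show "hs \<in> B.cells K p" using c(2) gs(2) by (simp add: B.cells_def)
qed

lemma push_bar_chains:
  assumes "c \<in> carrier (bar_chains G p)"
  shows "push (map \<phi>) c \<in> carrier (bar_chains G' p)"
  unfolding carrier_bar_chains
proof
  fix gs assume "gs \<in> Poly_Mapping.keys (push (map \<phi>) c)"
  then obtain hs where "hs \<in> Poly_Mapping.keys c" "gs = map \<phi> hs" by (rule keys_pushE)
  then show "length gs = p \<and> set gs \<subseteq> carrier G'"
    using assms hom_closed by (auto simp: carrier_bar_chains)
qed

text \<open>Kinds of cells are preserved and the boundary commutes with the push-forward, so each of
  the three summands goes to a summand of the same type. Uniqueness of decompositions then makes
  \<open>crit_part\<close> natural.\<close>

lemma decomposes_hom:
  assumes "A.decomposes p c r"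
  shows "B.decomposes p (push (map \<phi>) c) (push (map \<psi>) r)"
  using assms
proof (rule A.decomposesE)
  fix b b' assume b: "Poly_Mapping.keys b \<subseteq> A.cells High p"
    and b': "Poly_Mapping.keys b' \<subseteq> A.cells High (Suc p)" and r: "Poly_Mapping.keys r \<subseteq> A.crit_words p"
    and c: "c = b + bar_boundary G b' + push (map e) r"
  have rr: "push (map \<phi>) (push (map e) r) = push (map e') (push (map \<psi>) r)"
    unfolding push_push
  proof (rule push_cong)
    fix w assume "w \<in> Poly_Mapping.keys r"
    then have "set w \<subseteq> X" using r A.essential_letters by (auto simp: A.crit_words_def)
    then show "(map \<phi> \<circ> map e) w = (map e' \<circ> map \<psi>) w"
      using e_hom by (auto simp: subset_iff)
  qed
  show ?thesis
  proof (rule B.decomposesI)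
    show "Poly_Mapping.keys (push (map \<phi>) b) \<subseteq> B.cells High p" by (rule push_cells[OF b])
    show "Poly_Mapping.keys (push (map \<phi>) b') \<subseteq> B.cells High (Suc p)" by (rule push_cells[OF b'])
    show "Poly_Mapping.keys (push (map \<psi>) r) \<subseteq> B.crit_words p"
    proof
      fix v assume "v \<in> Poly_Mapping.keys (push (map \<psi>) r)"
      then obtain w where "w \<in> Poly_Mapping.keys r" "v = map \<psi> w" by (rule keys_pushE)
      then show "v \<in> B.crit_words p"
        using r essential_hom[of w] by (auto simp: A.crit_words_def B.crit_words_def)
    qed
    have "push (map \<phi>) (bar_boundary G b') = bar_boundary G' (push (map \<phi>) b')"
      by (rule bar_boundary_hom[symmetric]) (use b' in \<open>auto simp: A.cells_def\<close>)
    then show "push (map \<phi>) c = push (map \<phi>) b + bar_boundary G' (push (map \<phi>) b') + push (map e') (push (map \<psi>) r)"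
      unfolding c push_add rr by simp
  qed
qed

lemma crit_part_hom:
  "c \<in> carrier (bar_chains G p) \<Longrightarrow>
    B.crit_part p (push (map \<phi>) c) = push (map \<psi>) (A.crit_part p c)"
  by (intro B.crit_part_eq decomposes_hom A.decomposes_crit_part)

lemma push_cycles: "c \<in> bar_cycles G p \<Longrightarrow> push (map \<phi>) c \<in> bar_cycles G' p"
  using bar_boundary_hom[of c] push_bar_chains[of c p]
  by (auto simp: bar_cycles_def carrier_bar_chains)

lemma push_boundaries:
  assumes "c \<in> bar_boundaries G p"
  shows "push (map \<phi>) c \<in> bar_boundaries G' p"
proof -
  obtain d where d: "d \<in> carrier (bar_chains G (Suc p))" "c = bar_boundary G d"
    using assms by (auto simp: bar_boundaries_def)
  then have "push (map \<phi>) c = bar_boundary G' (push (map \<phi>) d)"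
    using bar_boundary_hom[of d] by (auto simp: carrier_bar_chains)
  then show ?thesis using push_bar_chains[OF d(1)] by (auto simp: bar_boundaries_def)
qed

end

section \<open>Dimensions from leading words\<close>

definition chain_subspace :: "('a \<Rightarrow>\<^sub>0 'k::field) set \<Rightarrow> bool" where
  "chain_subspace S \<longleftrightarrow> 0 \<in> S \<and> (\<forall>c\<in>S. \<forall>d\<in>S. c + d \<in> S) \<and> (\<forall>a. \<forall>c\<in>S. scale_chain a c \<in> S)"

lemma chain_subspaceD:
  assumes "chain_subspace S"
  shows "0 \<in> S" "c \<in> S \<Longrightarrow> d \<in> S \<Longrightarrow> c + d \<in> S" "c \<in> S \<Longrightarrow> scale_chain a c \<in> S"
  using assms by (simp_all add: chain_subspace_def)

lemma chain_subspace_sum: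
  "chain_subspace S \<Longrightarrow> (\<And>x. x \<in> A \<Longrightarrow> f x \<in> S) \<Longrightarrow> sum f A \<in> S"
  by (induction A rule: infinite_finite_induct) (simp_all add: chain_subspaceD)

definition lead :: "('w::linorder \<Rightarrow>\<^sub>0 'k::field) \<Rightarrow> 'w" where
  "lead v = Max (Poly_Mapping.keys v)"

definition leads :: "('w::linorder \<Rightarrow>\<^sub>0 'k::field) set \<Rightarrow> 'w set" where
  "leads W = lead ` (W - {0})"

lemma lead_in_keys: "v \<noteq> 0 \<Longrightarrow> lead v \<in> Poly_Mapping.keys v"
  unfolding lead_def by (intro Max_in) auto

lemma lookup_lead: "v \<noteq> 0 \<Longrightarrow> Poly_Mapping.lookup v (lead v) \<noteq> 0"
  using lead_in_keys by (simp add: in_keys_iff)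

lemma lookup_above_lead: "lead v < x \<Longrightarrow> Poly_Mapping.lookup v x = 0"
proof (rule ccontr)
  assume "lead v < x" "Poly_Mapping.lookup v x \<noteq> 0"
  then have "x \<le> lead v" unfolding lead_def by (intro Max_ge) (simp_all add: in_keys_iff)
  with \<open>lead v < x\<close> show False by simp
qed

lemma leadI:
  assumes "Poly_Mapping.lookup v m \<noteq> 0" "\<And>x. m < x \<Longrightarrow> Poly_Mapping.lookup v x = 0"
  shows "v \<noteq> 0 \<and> lead v = m"
proof
  show "v \<noteq> 0" using assms(1) by auto
  show "lead v = m"
    unfolding lead_def by (rule Max_eqI) (use assms in \<open>auto simp: in_keys_iff not_less[symmetric]\<close>)
qed

text \<open>Gaussian elimination. For each \<open>s\<close> in \<open>T\<close>, the chain
  \<open>\<zeta> s\<close> is chosen with leading word \<open>s\<close> of its image. A leading word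
  from \<open>B\<close> is cancelled by an element of \<open>B\<close>, any other one by some
  \<open>\<zeta> s\<close>, and a chain with zero image lies in \<open>B\<close> by assumption.
  Conversely, the largest index of a nontrivial combination lying in \<open>B\<close> would be a
  leading word from \<open>B\<close>, hence outside \<open>T\<close>.\<close>

lemma quotient_leads:
  fixes \<pi> :: "('a \<Rightarrow>\<^sub>0 'k::field) \<Rightarrow> ('w::linorder \<Rightarrow>\<^sub>0 'k)"
  assumes Z: "chain_subspace Z" and B: "chain_subspace B" "B \<subseteq> Z"
    and add: "\<And>c d. c \<in> Z \<Longrightarrow> d \<in> Z \<Longrightarrow> \<pi> (c + d) = \<pi> c + \<pi> d"
    and scale: "\<And>a c. c \<in> Z \<Longrightarrow> \<pi> (scale_chain a c) = scale_chain a (\<pi> c)"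
    and F: "finite F" "\<And>c. c \<in> Z \<Longrightarrow> Poly_Mapping.keys (\<pi> c) \<subseteq> F"
    and ker: "\<And>c. c \<in> Z \<Longrightarrow> \<pi> c = 0 \<Longrightarrow> c \<in> B"
  defines "T \<equiv> leads (\<pi> ` Z) - leads (\<pi> ` B)"
  obtains \<zeta> where "\<And>s. s \<in> T \<Longrightarrow> \<zeta> s \<in> Z"
    "\<And>z. z \<in> Z \<Longrightarrow> \<exists>a. \<exists>b\<in>B. z = b + (\<Sum>s\<in>T. scale_chain (a s) (\<zeta> s))"
    "\<And>a s. (\<Sum>s\<in>T. scale_chain (a s) (\<zeta> s)) \<in> B \<Longrightarrow> s \<in> T \<Longrightarrow> a s = 0"
proof -
  have "leads (\<pi> ` Z) \<subseteq> F" using F(2) lead_in_keys unfolding leads_def by blast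
  then have finT: "finite T" using F(1) unfolding T_def by (meson finite_Diff finite_subset)
  have "\<forall>s\<in>T. \<exists>z. z \<in> Z \<and> \<pi> z \<noteq> 0 \<and> lead (\<pi> z) = s"
    unfolding T_def leads_def by auto
  then obtain \<zeta> where \<zeta>: "\<And>s. s \<in> T \<Longrightarrow> \<zeta> s \<in> Z" "\<And>s. s \<in> T \<Longrightarrow> \<pi> (\<zeta> s) \<noteq> 0"
    "\<And>s. s \<in> T \<Longrightarrow> lead (\<pi> (\<zeta> s)) = s" by metis
  have \<pi>sum: "\<pi> (\<Sum>s\<in>A. scale_chain (a s) (\<zeta> s)) = (\<Sum>s\<in>A. scale_chain (a s) (\<pi> (\<zeta> s)))"
    if "A \<subseteq> T" for A a
    using finite_subset[OF that finT] that
  proof (induction A rule: finite_induct)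
    case empty
    have "\<pi> (scale_chain 0 0) = scale_chain 0 (\<pi> 0)" by (rule scale[OF chain_subspaceD(1)[OF Z]])
    then show ?case by (simp add: scale_chain_distrib)
  next
    case (insert s A)
    have "scale_chain (a s) (\<zeta> s) \<in> Z" "(\<Sum>s\<in>A. scale_chain (a s) (\<zeta> s)) \<in> Z"
      using insert.prems by (auto intro!: chain_subspace_sum[OF Z] chain_subspaceD(3)[OF Z] \<zeta>(1))
    then show ?case using insert by (simp add: add scale \<zeta>(1))
  qed
  have span: "\<exists>a. \<exists>b\<in>B. z = b + (\<Sum>s\<in>T. scale_chain (a s) (\<zeta> s))" if "z \<in> Z" for z
    using that
  \<comment> \<open>The measure counts the words of \<open>F\<close> up to the leading word, so it
    drops whenever the leading term is cancelled; it is zero if \<open>\<pi> z = 0\<close>.\<close>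
  proof (induction "card {x \<in> F. \<exists>y\<in>Poly_Mapping.keys (\<pi> z). x \<le> y}" arbitrary: z rule: less_induct)
    case less
    show ?case
    proof (cases "\<pi> z = 0")
      case True
      then have "z \<in> B" using ker less.prems by blast
      then show ?thesis
        by (intro exI[of _ "\<lambda>_. 0"] bexI[of _ z]) (simp_all add: scale_chain_distrib)
    next
      case False
      define m where "m = lead (\<pi> z)"
      have step: "\<exists>c a'. \<exists>b\<in>B. z = b + scale_chain c y + (\<Sum>s\<in>T. scale_chain (a' s) (\<zeta> s))"
        if y: "y \<in> Z" "\<pi> y \<noteq> 0" "lead (\<pi> y) = m" for y
      proof -
        define c where "c = Poly_Mapping.lookup (\<pi> z) m / Poly_Mapping.lookup (\<pi> y) m"
        define z' where "z' = z + scale_chain (- c) y"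
        have z': "z' \<in> Z" unfolding z'_def
          by (intro chain_subspaceD(2)[OF Z] chain_subspaceD(3)[OF Z] less.prems y(1))
        have l: "Poly_Mapping.lookup (\<pi> z') x = Poly_Mapping.lookup (\<pi> z) x - c * Poly_Mapping.lookup (\<pi> y) x" for x
          using add[OF less.prems chain_subspaceD(3)[OF Z y(1)], of "- c"] scale[OF y(1), of "- c"]
          by (simp add: z'_def lookup_add)
        have "Poly_Mapping.lookup (\<pi> y) m \<noteq> 0" using lookup_lead[OF y(2)] y(3) by simp
        then have "Poly_Mapping.lookup (\<pi> z') m = 0" by (simp add: l c_def)
        moreover have "Poly_Mapping.lookup (\<pi> z') x = 0" if "m < x" for x
          using that y(3) by (simp add: l lookup_above_lead m_def)
        ultimately have below: "x < m" if "x \<in> Poly_Mapping.keys (\<pi> z')" for x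
          using that by (cases x m rule: linorder_cases) (auto simp: in_keys_iff)
        have mk: "m \<in> Poly_Mapping.keys (\<pi> z)" unfolding m_def by (rule lead_in_keys[OF False])
        then have mF: "m \<in> F" using F(2)[OF less.prems] by blast
        have "card {x \<in> F. \<exists>y\<in>Poly_Mapping.keys (\<pi> z'). x \<le> y} < card {x \<in> F. \<exists>y\<in>Poly_Mapping.keys (\<pi> z). x \<le> y}"
        proof (rule psubset_card_mono)
          show "finite {x \<in> F. \<exists>y\<in>Poly_Mapping.keys (\<pi> z). x \<le> y}" using F(1) by simp
          have "{x \<in> F. \<exists>y\<in>Poly_Mapping.keys (\<pi> z'). x \<le> y} \<subseteq> {x \<in> F. \<exists>y\<in>Poly_Mapping.keys (\<pi> z). x \<le> y}"
          proof
            fix x assume "x \<in> {x \<in> F. \<exists>y\<in>Poly_Mapping.keys (\<pi> z'). x \<le> y}"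
            then have "x \<in> F" "x \<le> m" using below by force+
            then show "x \<in> {x \<in> F. \<exists>y\<in>Poly_Mapping.keys (\<pi> z). x \<le> y}" using mk by blast
          qed
          moreover have "m \<in> {x \<in> F. \<exists>y\<in>Poly_Mapping.keys (\<pi> z). x \<le> y}" using mk mF by blast
          moreover have "m \<notin> {x \<in> F. \<exists>y\<in>Poly_Mapping.keys (\<pi> z'). x \<le> y}" using below by force
          ultimately show "{x \<in> F. \<exists>y\<in>Poly_Mapping.keys (\<pi> z'). x \<le> y} \<subset> {x \<in> F. \<exists>y\<in>Poly_Mapping.keys (\<pi> z). x \<le> y}"
            by blast
        qed
        from less.hyps[OF this z'] obtain a b where "b \<in> B" "z' = b + (\<Sum>s\<in>T. scale_chain (a s) (\<zeta> s))" by blast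
        moreover have "z = scale_chain c y + z'"
          unfolding z'_def by (rule poly_mapping_eqI) (simp add: lookup_add)
        ultimately have "z = b + scale_chain c y + (\<Sum>s\<in>T. scale_chain (a s) (\<zeta> s))" by simp
        then show ?thesis using \<open>b \<in> B\<close> by blast
      qed
      show ?thesis
      proof (cases "m \<in> leads (\<pi> ` B)")
        case True
        then obtain y where y: "y \<in> B" "\<pi> y \<noteq> 0" "lead (\<pi> y) = m" unfolding leads_def by auto
        from step[OF subsetD[OF B(2) y(1)] y(2,3)] obtain c a b where
          "b \<in> B" "z = b + scale_chain c y + (\<Sum>s\<in>T. scale_chain (a s) (\<zeta> s))" by blast
        moreover have "b + scale_chain c y \<in> B"
          by (intro chain_subspaceD(2)[OF B(1)] chain_subspaceD(3)[OF B(1)] y(1) \<open>b \<in> B\<close>)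
        ultimately show ?thesis by blast
      next
        case False
        have "m \<in> leads (\<pi> ` Z)" using less.prems \<open>\<pi> z \<noteq> 0\<close> unfolding leads_def m_def by blast
        then have m: "m \<in> T" using False by (simp add: T_def)
        from step[OF \<zeta>[OF m]] obtain c a b where
          b: "b \<in> B" "z = b + scale_chain c (\<zeta> m) + (\<Sum>s\<in>T. scale_chain (a s) (\<zeta> s))" by blast
        have "scale_chain c (\<zeta> m) + (\<Sum>s\<in>T. scale_chain (a s) (\<zeta> s)) =
            (\<Sum>s\<in>T. scale_chain (if s = m then c else 0) (\<zeta> s)) + (\<Sum>s\<in>T. scale_chain (a s) (\<zeta> s))"
          using finT m by (simp add: if_distrib[of "\<lambda>x. scale_chain x _"] scale_chain_distrib sum.delta cong: if_cong)
        also have "\<dots> = (\<Sum>s\<in>T. scale_chain ((if s = m then c else 0) + a s) (\<zeta> s))"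
          by (simp add: scale_chain_distrib sum.distrib)
        finally have "z = b + (\<Sum>s\<in>T. scale_chain ((if s = m then c else 0) + a s) (\<zeta> s))"
          using b(2) by (simp add: add.assoc)
        then show ?thesis using b(1) by (intro exI[of _ "\<lambda>s. (if s = m then c else 0) + a s"] bexI[of _ b])
      qed
    qed
  qed
  have indep: "a s = 0" if a: "(\<Sum>s\<in>T. scale_chain (a s) (\<zeta> s)) \<in> B" and s: "s \<in> T" for a s
  proof (rule ccontr)
    assume "a s \<noteq> 0"
    define U where "U = {s \<in> T. a s \<noteq> 0}"
    define m where "m = Max U"
    have U: "finite U" "U \<noteq> {}" using finT s \<open>a s \<noteq> 0\<close> by (auto simp: U_def)
    have m: "m \<in> T" "a m \<noteq> 0" using Max_in[OF U] by (auto simp: m_def U_def)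
    have above: "a s = 0" if "s \<in> T" "m < s" for s
    proof (rule ccontr)
      assume "a s \<noteq> 0"
      then have "s \<le> m" unfolding m_def using that(1) by (intro Max_ge U(1)) (simp add: U_def)
      with that(2) show False by simp
    qed
    let ?c = "\<Sum>s\<in>T. scale_chain (a s) (\<zeta> s)"
    have l: "Poly_Mapping.lookup (\<pi> ?c) x = (\<Sum>s\<in>T. a s * Poly_Mapping.lookup (\<pi> (\<zeta> s)) x)" for x
      by (simp add: \<pi>sum lookup_sum)
    have z: "a s * Poly_Mapping.lookup (\<pi> (\<zeta> s)) x = 0" if "s \<in> T" "s \<noteq> m \<or> m < x" "m \<le> x" for s x
    proof (cases "m < s")
      case True
      then show ?thesis using above[OF that(1)] by simp
    next
      case False
      then have "s < x" using that by auto
      then show ?thesis using lookup_above_lead[of "\<pi> (\<zeta> s)" x] \<zeta>(3)[OF that(1)] by simp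
    qed
    have "Poly_Mapping.lookup (\<pi> ?c) m = a m * Poly_Mapping.lookup (\<pi> (\<zeta> m)) m"
    proof -
      have "(\<Sum>s\<in>T - {m}. a s * Poly_Mapping.lookup (\<pi> (\<zeta> s)) m) = 0"
      proof (rule sum.neutral, rule ballI)
        fix s assume "s \<in> T - {m}"
        then show "a s * Poly_Mapping.lookup (\<pi> (\<zeta> s)) m = 0" by (intro z) auto
      qed
      then show ?thesis unfolding l using finT m(1) by (simp add: sum.remove[of T m])
    qed
    then have "Poly_Mapping.lookup (\<pi> ?c) m \<noteq> 0"
      using m lookup_lead[OF \<zeta>(2)[OF m(1)]] \<zeta>(3)[OF m(1)] by simp
    moreover have "Poly_Mapping.lookup (\<pi> ?c) x = 0" if "m < x" for x
      unfolding l
    proof (rule sum.neutral, rule ballI)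
      fix s assume "s \<in> T"
      then show "a s * Poly_Mapping.lookup (\<pi> (\<zeta> s)) x = 0" using that by (intro z) auto
    qed
    ultimately have "\<pi> ?c \<noteq> 0 \<and> lead (\<pi> ?c) = m" by (rule leadI)
    then have "m \<in> leads (\<pi> ` B)" using a unfolding leads_def by blast
    then show False using m(1) by (simp add: T_def)
  qed
  show thesis
  proof (rule that[of \<zeta>])
    show "\<zeta> s \<in> Z" if "s \<in> T" for s by (rule \<zeta>(1)[OF that])
    show "\<exists>a. \<exists>b\<in>B. z = b + (\<Sum>s\<in>T. scale_chain (a s) (\<zeta> s))" if "z \<in> Z" for z
      by (rule span[OF that])
    show "a s = 0" if "(\<Sum>s\<in>T. scale_chain (a s) (\<zeta> s)) \<in> B" "s \<in> T" for a s
      by (rule indep[OF that])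
  qed
qed

text \<open>The cosets of the chains \<open>\<zeta> s\<close> are a basis: \<open>span\<close> and
  \<open>indep\<close> express generation and independence modulo \<open>B\<close>. The lemma
  carries the result of the elimination over to the abstract dimension.\<close>

lemma dim_quotient_module:
  fixes G :: "('g, 'm) monoid_scheme" and p :: nat
    and Z B :: "('g list \<Rightarrow>\<^sub>0 'k::field) set" and \<zeta> :: "'w \<Rightarrow> 'g list \<Rightarrow>\<^sub>0 'k"
  assumes Z: "chain_subspace Z" and B: "chain_subspace B" "B \<subseteq> Z"
  defines "Q \<equiv> quotient_module ((bar_chains G p)\<lparr>carrier := Z\<rparr>) B"
  assumes vs: "vectorspace class_ring Q" and T: "finite T"
    and \<zeta>: "\<And>s. s \<in> T \<Longrightarrow> \<zeta> s \<in> Z"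
    and span: "\<And>z. z \<in> Z \<Longrightarrow> \<exists>a. \<exists>b\<in>B. z = b + (\<Sum>s\<in>T. scale_chain (a s) (\<zeta> s))"
    and indep: "\<And>a s. (\<Sum>s\<in>T. scale_chain (a s) (\<zeta> s)) \<in> B \<Longrightarrow> s \<in> T \<Longrightarrow> a s = 0"
  shows "vectorspace.fin_dim class_ring Q \<and> vectorspace.dim class_ring Q = card T"
proof -
  interpret Q: vectorspace "class_ring :: 'k ring" Q by (rule vs)
  define cs where "cs = (\<lambda>z. (\<lambda>b. b + z) ` B)"
  have Bm: "b - b' \<in> B" if "b \<in> B" "b' \<in> B" for b b'
    using chain_subspaceD(2)[OF B(1) that(1) chain_subspaceD(3)[OF B(1) that(2)], of "- 1"]
    by (simp add: scale_chain_minus_one)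
  have coset: "a_r_coset ((bar_chains G p)\<lparr>carrier := Z\<rparr>) B z = cs z" for z
    by (auto simp: a_r_coset_def' cs_def bar_chains_ops)
  have carr: "carrier Q = cs ` Z"
    by (auto simp: Q_def quotient_module_def A_RCOSETS_def' coset)
  have zero: "zero Q = B" by (simp add: Q_def quotient_module_def)
  have cs_eq: "cs z = cs z' \<longleftrightarrow> z - z' \<in> B" for z z'
  proof
    assume "cs z = cs z'"
    moreover have "z \<in> cs z" using chain_subspaceD(1)[OF B(1)] by (auto simp: cs_def image_iff intro!: bexI[of _ 0])
    ultimately show "z - z' \<in> B" by (auto simp: cs_def)
  next
    assume d: "z - z' \<in> B"
    have "b + z \<in> cs z'" if "b \<in> B" for b
      unfolding cs_def by (rule image_eqI[of _ _ "b + (z - z')"]) (use chain_subspaceD(2)[OF B(1) that d] in auto)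
    moreover have "b + z' \<in> cs z" if "b \<in> B" for b
      unfolding cs_def by (rule image_eqI[of _ _ "b - (z - z')"]) (use Bm[OF that d] in auto)
    ultimately show "cs z = cs z'" unfolding cs_def by blast
  qed
  have B_cs: "B = cs 0" by (simp add: cs_def)
  have add: "add Q (cs z) (cs z') = cs (z + z')" for z z'
  proof -
    have "add Q (cs z) (cs z') = {c + d | c d. c \<in> cs z \<and> d \<in> cs z'}"
      by (auto simp: Q_def quotient_module_def set_add_def' bar_chains_ops)
    also have "\<dots> = cs (z + z')"
    proof (intro equalityI subsetI)
      fix x assume "x \<in> {c + d | c d. c \<in> cs z \<and> d \<in> cs z'}"
      then obtain b b' where "b \<in> B" "b' \<in> B" "x = (b + z) + (b' + z')" by (auto simp: cs_def)
      then show "x \<in> cs (z + z')"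
        unfolding cs_def using chain_subspaceD(2)[OF B(1), of b b'] by (intro image_eqI[of _ _ "b + b'"]) (auto simp: add_ac)
    next
      fix x assume "x \<in> cs (z + z')"
      then obtain b where "b \<in> B" "x = (b + z) + (0 + z')" by (auto simp: cs_def add_ac)
      then show "x \<in> {c + d | c d. c \<in> cs z \<and> d \<in> cs z'}"
        using chain_subspaceD(1)[OF B(1)] unfolding cs_def by blast
    qed
    finally show ?thesis .
  qed
  have smult: "smult Q a (cs z) = cs (scale_chain a z)" for a z
  proof -
    have "cs (scale_chain a x) = cs (scale_chain a z)" if x: "x \<in> cs z" for x
    proof -
      obtain b where "b \<in> B" "x = b + z" using x by (auto simp: cs_def)
      then have "scale_chain a x - scale_chain a z \<in> B"
        using chain_subspaceD(3)[OF B(1), of b a] by (simp add: scale_chain_distrib)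
      then show ?thesis by (simp add: cs_eq)
    qed
    moreover have "z \<in> cs z" using cs_eq chain_subspaceD(1)[OF B(1)] by (auto simp: cs_def image_iff intro!: bexI[of _ 0])
    ultimately have "(\<Union>x\<in>cs z. cs (scale_chain a x)) = cs (scale_chain a z)" by blast
    then show ?thesis by (simp add: Q_def quotient_module_def coset bar_chains_ops)
  qed
  define E where "E = (\<lambda>s. cs (\<zeta> s))"
  have E_carr: "E s \<in> carrier Q" if "s \<in> T" for s using \<zeta>[OF that] by (auto simp: carr E_def)
  have inj: "inj_on E T"
  proof (rule inj_onI, rule ccontr)
    fix s t assume st: "s \<in> T" "t \<in> T" "E s = E t" "s \<noteq> t"
    \<comment> \<open>Equal cosets for \<open>s\<close> and \<open>t\<close> amount to the relation
      \<open>\<zeta> s - \<zeta> t \<in> B\<close>.\<close>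
    define a where "a = (\<lambda>x. if x = s then 1 else if x = t then - 1 else 0 :: 'k)"
    have "(\<Sum>x\<in>T. scale_chain (a x) (\<zeta> x)) = (\<Sum>x\<in>{s, t}. scale_chain (a x) (\<zeta> x))"
      by (rule sum.mono_neutral_right) (use T st in \<open>auto simp: a_def scale_chain_distrib\<close>)
    also have "\<dots> = \<zeta> s - \<zeta> t"
      using st(4) by (simp add: a_def scale_chain_distrib scale_chain_minus_one)
    also have "\<dots> \<in> B" using st(3) by (simp add: E_def cs_eq)
    finally have "a s = 0" using indep st(1) by blast
    then show False by (simp add: a_def)
  qed
  have lincomb: "Q.lincomb a (E ` T) = cs (\<Sum>s\<in>T. scale_chain (a (E s)) (\<zeta> s))" for a
  proof -
    have "(finsum Q (\<lambda>v. smult Q (a v) v) (E ` A) = cs (\<Sum>s\<in>A. scale_chain (a (E s)) (\<zeta> s)))" if "A \<subseteq> T" for A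
      using finite_subset[OF that T] that
    proof (induction A rule: finite_induct)
      case empty
      then show ?case by (simp add: zero B_cs[symmetric])
    next
      case (insert s A)
      have "E s \<notin> E ` A" using insert.hyps insert.prems inj by (auto dest: inj_onD)
      then have "finsum Q (\<lambda>v. smult Q (a v) v) (E ` insert s A) =
          add Q (smult Q (a (E s)) (E s)) (finsum Q (\<lambda>v. smult Q (a v) v) (E ` A))"
        using insert.hyps insert.prems E_carr
        by (simp add: Q.M.finsum_insert Pi_def) (subst Q.M.finsum_insert, auto)
      also have "\<dots> = cs (\<Sum>s\<in>insert s A. scale_chain (a (E s)) (\<zeta> s))"
        using insert by (simp add: add smult E_def)
      finally show ?case .
    qed
    then show ?thesis unfolding Q.lincomb_def by simp
  qed
  have gen: "Q.gen_set (E ` T)"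
  proof
    show "Q.span (E ` T) \<subseteq> carrier Q" using E_carr by (intro Q.span_is_subset2) auto
    show "carrier Q \<subseteq> Q.span (E ` T)"
    proof
      fix x assume "x \<in> carrier Q"
      then obtain z where z: "z \<in> Z" "x = cs z" by (auto simp: carr)
      from span[OF z(1)] obtain a b where ab: "b \<in> B" "z = b + (\<Sum>s\<in>T. scale_chain (a s) (\<zeta> s))" by blast
      have "x = cs (\<Sum>s\<in>T. scale_chain (a s) (\<zeta> s))" using z(2) ab by (simp add: cs_eq)
      also have "(\<Sum>s\<in>T. scale_chain (a s) (\<zeta> s)) = (\<Sum>s\<in>T. scale_chain ((a \<circ> inv_into T E) (E s)) (\<zeta> s))"
        by (intro sum.cong refl) (simp add: inv_into_f_f[OF inj])
      finally have "x = Q.lincomb (a \<circ> inv_into T E) (E ` T)" by (simp add: lincomb)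
      then show "x \<in> Q.span (E ` T)"
        using T E_carr by (subst Q.finite_span) auto
    qed
  qed
  have li: "Q.lin_indpt (E ` T)"
  proof (rule Q.finite_lin_indpt2)
    fix a assume "Q.lincomb a (E ` T) = zero Q"
    then have "cs (\<Sum>s\<in>T. scale_chain (a (E s)) (\<zeta> s)) = cs 0" by (simp add: lincomb zero B_cs[symmetric])
    then have "(\<Sum>s\<in>T. scale_chain (a (E s)) (\<zeta> s)) \<in> B" by (simp add: cs_eq)
    then have "a (E s) = 0" if "s \<in> T" for s using indep[of "\<lambda>s. a (E s)" s] that by simp
    then show "\<forall>v\<in>E ` T. a v = zero class_ring" by simp
  qed (use T E_carr in auto)
  have "Q.basis (E ` T)" unfolding Q.basis_def using gen li E_carr by auto
  moreover have "card (E ` T) = card T" by (rule card_image[OF inj])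
  ultimately have "Q.dim = card T" using Q.dim_basis[of "E ` T"] T by simp
  moreover have "Q.fin_dim" unfolding Q.fin_dim_def using gen T E_carr by (intro exI[of _ "E ` T"]) auto
  ultimately show ?thesis by simp
qed

lemma chain_subspace_cycles: "chain_subspace (bar_cycles G p)"
  by (simp add: chain_subspace_def bar_cycles_def bar_chains_zero bar_chains_add bar_chains_scale
      bar_boundary_add bar_boundary_scale scale_chain_distrib)

lemma chain_subspace_boundaries: "chain_subspace (bar_boundaries G p)"
  unfolding chain_subspace_def
proof (intro conjI ballI allI)
  show "0 \<in> bar_boundaries G p"
    unfolding bar_boundaries_def by (rule image_eqI[of _ _ 0]) (simp_all add: bar_chains_zero)
  fix c :: "'a list \<Rightarrow>\<^sub>0 'b" assume "c \<in> bar_boundaries G p"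
  then obtain c' where c: "c = bar_boundary G c'" "c' \<in> carrier (bar_chains G (Suc p))"
    by (auto simp: bar_boundaries_def)
  show "scale_chain a c \<in> bar_boundaries G p" for a
    unfolding bar_boundaries_def
    by (rule image_eqI[of _ _ "scale_chain a c'"]) (simp_all add: c bar_boundary_scale bar_chains_scale)
  fix d :: "'a list \<Rightarrow>\<^sub>0 'b" assume "d \<in> bar_boundaries G p"
  then obtain d' where d: "d = bar_boundary G d'" "d' \<in> carrier (bar_chains G (Suc p))"
    by (auto simp: bar_boundaries_def)
  show "c + d \<in> bar_boundaries G p"
    unfolding bar_boundaries_def
    by (rule image_eqI[of _ _ "c' + d'"]) (simp_all add: c d bar_boundary_add bar_chains_add)
qed

section \<open>Counting words that are stable under insertions\<close>

lemma insert_index_eq_iff: "insert_index k i = insert_index k j \<longleftrightarrow> i = j"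
  by (simp add: insert_index_def)

lemma insert_index_less: "insert_index k i < insert_index k j \<longleftrightarrow> i < j"
  by (simp add: insert_index_def)

text \<open>The last entry of a list plays the role of the ambient size \<open>n\<close>, the other ones form a subset of
  \<open>{..<n}\<close>; the gaps between the entries turn shift-closed sets into upward closed sets of exponent
  vectors, that is, into monomial ideals.\<close>

definition shift_closed :: "nat \<Rightarrow> nat list set \<Rightarrow> bool" where
  "shift_closed d T \<longleftrightarrow> T \<subseteq> {v. length v = d \<and> sorted_wrt (<) v} \<and>
     (\<forall>v\<in>T. \<forall>k. map (insert_index k) v \<in> T)"

lemma shift_closed_elem: "shift_closed d T \<Longrightarrow> v \<in> T \<Longrightarrow> length v = d \<and> sorted_wrt (<) v"
  unfolding shift_closed_def by blast

lemma shift_closedD: "shift_closed d T \<Longrightarrow> v \<in> T \<Longrightarrow> map (insert_index k) v \<in> T"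
  by (simp add: shift_closed_def)

text \<open>Corresponds to fixing the exponent of the first variable: the remaining entries are
  renumbered so that the position right after \<open>t\<close> becomes 0.\<close>

definition tail_slice :: "nat list set \<Rightarrow> nat \<Rightarrow> nat list set" where
  "tail_slice T t = {v. t # map (\<lambda>x. Suc (x + t)) v \<in> T}"

lemma shift_closed_tail_slice:
  assumes "shift_closed (Suc d) T"
  shows "shift_closed d (tail_slice T t)"
  unfolding shift_closed_def
proof (intro conjI subsetI ballI allI)
  fix v assume v: "v \<in> tail_slice T t"
  then have v': "t # map (\<lambda>x. Suc (x + t)) v \<in> T" by (simp add: tail_slice_def)
  then have "length (t # map (\<lambda>x. Suc (x + t)) v) = Suc d" "sorted_wrt (<) (t # map (\<lambda>x. Suc (x + t)) v)"
    using shift_closed_elem[OF assms v'] by auto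
  then show "v \<in> {v. length v = d \<and> sorted_wrt (<) v}" by (simp add: sorted_wrt_map)
  fix k
  have "map (insert_index (Suc (k + t))) (t # map (\<lambda>x. Suc (x + t)) v) \<in> T"
    by (rule shift_closedD[OF assms v'])
  moreover have "map (insert_index (Suc (k + t))) (t # map (\<lambda>x. Suc (x + t)) v) =
      t # map (\<lambda>x. Suc (x + t)) (map (insert_index k) v)"
    by (simp add: insert_index_def)
  ultimately show "map (insert_index k) v \<in> tail_slice T t"
    unfolding tail_slice_def mem_Collect_eq by (simp only:)
qed

text \<open>An index inserted in front of the first entry moves the whole list up by one and leaves
  the renumbered tail unchanged.\<close>

lemma tail_slice_mono:
  assumes "shift_closed (Suc d) T" "t \<le> t'"
  shows "tail_slice T t \<subseteq> tail_slice T t'"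
  using assms(2)
proof (induction rule: dec_induct)
  case (step n)
  have "v \<in> tail_slice T (Suc n)" if "v \<in> tail_slice T n" for v
  proof -
    have "map (insert_index 0) (n # map (\<lambda>x. Suc (x + n)) v) \<in> T"
      by (rule shift_closedD[OF assms(1)]) (use that in \<open>simp add: tail_slice_def\<close>)
    moreover have "map (insert_index 0) (n # map (\<lambda>x. Suc (x + n)) v) = Suc n # map (\<lambda>x. Suc (x + Suc n)) v"
      by (simp add: insert_index_def)
    ultimately show ?thesis unfolding tail_slice_def mem_Collect_eq by (simp only:)
  qed
  then show ?case using step by blast
qed simp

lemma shift_closed_Cons:
  assumes "shift_closed (Suc d) T" "v \<in> T"
  obtains t w where "v = t # map (\<lambda>x. Suc (x + t)) w" "w \<in> tail_slice T t"
proof -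
  obtain t u where u: "v = t # u" "sorted_wrt (<) (t # u)"
    using shift_closed_elem[OF assms] by (cases v) auto
  have "map (\<lambda>x. Suc (x + t)) (map (\<lambda>y. y - Suc t) u) = u"
    unfolding map_map by (rule map_idI) (use u(2) in auto)
  then show ?thesis using that[of t "map (\<lambda>y. y - Suc t) u"] u assms(2) by (simp add: tail_slice_def)
qed

lemma shift_closed_eqI:
  assumes "shift_closed (Suc d) T" "shift_closed (Suc d) T'" "\<And>t. tail_slice T t = tail_slice T' t"
  shows "T = T'"
proof -
  have "T \<subseteq> T'" if "shift_closed (Suc d) T" "\<And>t. tail_slice T t \<subseteq> tail_slice T' t" for T T'
  proof
    fix v assume "v \<in> T"
    from shift_closed_Cons[OF that(1) this] obtain t w
      where w: "v = t # map (\<lambda>x. Suc (x + t)) w" "w \<in> tail_slice T t" .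
    then have "w \<in> tail_slice T' t" using that(2) by blast
    then show "v \<in> T'" using w(1) by (simp add: tail_slice_def)
  qed
  from this[of T T'] this[of T' T] show ?thesis using assms by simp
qed

text \<open>The ascending chain condition for monomial ideals, proved as in Hilbert's basis theorem.
  The diagonal slices \<open>tail_slice (T i) i\<close> stabilise at some \<open>m\<close>, which
  settles all slices with \<open>t \<ge> m\<close> at once; the finitely many slices with
  \<open>t < m\<close> stabilise one by one.\<close>

lemma shift_closed_chain_stable:
  fixes T :: "nat \<Rightarrow> nat list set"
  assumes "\<And>i. shift_closed d (T i)" "mono T"
  shows "\<exists>i0. \<forall>i\<ge>i0. T i = T i0"
  using assms
proof (induction d arbitrary: T)
  case 0
  have sub: "T i \<subseteq> {[]}" for i using 0(1)[of i] by (auto simp: shift_closed_def)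
  show ?case
  proof (cases "\<exists>i. T i = {[]}")
    case True
    then obtain i0 where i0: "T i0 = {[]}" ..
    have "T i = T i0" if "i \<ge> i0" for i
      using monoD[OF 0(2) that] sub[of i] i0 by blast
    then show ?thesis by blast
  next
    case False
    then have "T i = {}" for i using sub[of i] by auto
    then show ?thesis by simp
  qed
next
  case (Suc d)
  have slice: "shift_closed d (tail_slice (T i) t)" for i t
    by (rule shift_closed_tail_slice[OF Suc.prems(1)])
  have mono_i: "tail_slice (T i) t \<subseteq> tail_slice (T i') t" if "i \<le> i'" for i i' t
    using monoD[OF Suc.prems(2) that] by (auto simp: tail_slice_def)
  have mono_t: "tail_slice (T i) t \<subseteq> tail_slice (T i) t'" if "t \<le> t'" for i t t'
    by (rule tail_slice_mono[OF Suc.prems(1) that])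
  have "mono (\<lambda>i. tail_slice (T i) i)"
    by (intro monoI) (use mono_i mono_t in blast)
  then obtain m where m: "\<And>i. i \<ge> m \<Longrightarrow> tail_slice (T i) i = tail_slice (T m) m"
    using Suc.IH[of "\<lambda>i. tail_slice (T i) i"] slice by blast
  have "\<exists>i0. \<forall>i\<ge>i0. tail_slice (T i) t = tail_slice (T i0) t" for t
    using Suc.IH[of "\<lambda>i. tail_slice (T i) t"] slice mono_i by (metis monoI)
  then obtain f where f: "\<And>t i. i \<ge> f t \<Longrightarrow> tail_slice (T i) t = tail_slice (T (f t)) t" by metis
  define i0 where "i0 = Max (insert m (f ` {..<m}))"
  have i0: "m \<le> i0" "\<And>t. t < m \<Longrightarrow> f t \<le> i0" by (auto simp: i0_def)
  have "T i = T i0" if i: "i \<ge> i0" for i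
  proof (rule shift_closed_eqI[OF Suc.prems(1) Suc.prems(1)])
    fix t
    show "tail_slice (T i) t = tail_slice (T i0) t"
    proof (cases "t < m")
      case True
      then show ?thesis using f[of t i] f[of t i0] i i0(2)[OF True] by simp
    next
      case False
      \<comment> \<open>By monotonicity in both arguments the slice lies between the diagonal slices
        at \<open>m\<close> and at \<open>max j t\<close>, which agree.\<close>
      have "tail_slice (T j) t = tail_slice (T m) m" if "m \<le> j" for j
      proof
        show "tail_slice (T j) t \<subseteq> tail_slice (T m) m"
          using mono_i[of j "max j t" t] mono_t[of t "max j t" "max j t"] m[of "max j t"] that False by fastforce
        show "tail_slice (T m) m \<subseteq> tail_slice (T j) t"
          using mono_i[of m j m] mono_t[of m t j] that False by fastforce
      qed
      then show ?thesis using i i0(1) by simp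
    qed
  qed
  then show ?case by blast
qed

section \<open>Eventually polynomial functions\<close>

definition eventually_poly :: "(nat \<Rightarrow> rat) \<Rightarrow> bool" where
  "eventually_poly f \<longleftrightarrow> (\<exists>q. \<forall>\<^sub>F n in sequentially. f n = poly q (of_nat n))"

lemma eventually_poly_const: "eventually_poly (\<lambda>n. c)"
  unfolding eventually_poly_def by (rule exI[of _ "[:c:]"]) simp

lemma eventually_poly_add:
  assumes "eventually_poly f" "eventually_poly g"
  shows "eventually_poly (\<lambda>n. f n + g n)"
proof -
  obtain p q where "\<forall>\<^sub>F n in sequentially. f n = poly p (of_nat n)" "\<forall>\<^sub>F n in sequentially. g n = poly q (of_nat n)"
    using assms by (auto simp: eventually_poly_def)
  then have "\<forall>\<^sub>F n in sequentially. f n + g n = poly (p + q) (of_nat n)"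
    by eventually_elim simp
  then show ?thesis unfolding eventually_poly_def ..
qed

lemma eventually_poly_diff:
  assumes "eventually_poly f" "eventually_poly g"
  shows "eventually_poly (\<lambda>n. f n - g n)"
proof -
  obtain p q where "\<forall>\<^sub>F n in sequentially. f n = poly p (of_nat n)" "\<forall>\<^sub>F n in sequentially. g n = poly q (of_nat n)"
    using assms by (auto simp: eventually_poly_def)
  then have "\<forall>\<^sub>F n in sequentially. f n - g n = poly (p - q) (of_nat n)"
    by eventually_elim simp
  then show ?thesis unfolding eventually_poly_def ..
qed

lemma eventually_poly_sum:
  "(\<And>x. x \<in> S \<Longrightarrow> eventually_poly (f x)) \<Longrightarrow> eventually_poly (\<lambda>n. \<Sum>x\<in>S. f x n)"
  by (induction S rule: infinite_finite_induct) (auto intro: eventually_poly_const eventually_poly_add)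

lemma eventually_poly_cong:
  assumes "eventually_poly f" "\<forall>\<^sub>F n in sequentially. f n = g n"
  shows "eventually_poly g"
proof -
  obtain p where "\<forall>\<^sub>F n in sequentially. f n = poly p (of_nat n)"
    using assms(1) by (auto simp: eventually_poly_def)
  with assms(2) have "\<forall>\<^sub>F n in sequentially. g n = poly p (of_nat n)"
    by eventually_elim simp
  then show ?thesis unfolding eventually_poly_def ..
qed

lemma eventually_poly_delay:
  assumes "eventually_poly f"
  shows "eventually_poly (\<lambda>n. f (n - k))"
proof -
  obtain p where p: "\<forall>\<^sub>F n in sequentially. f n = poly p (of_nat n)"
    using assms(1) by (auto simp: eventually_poly_def)
  have "\<forall>\<^sub>F n in sequentially. f (n - k) = poly p (of_nat (n - k))"
    using p by (rule eventually_compose_filterlim[OF _ filterlim_minus_const_nat_at_top])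
  then have "\<forall>\<^sub>F n in sequentially. f (n - k) = poly (pcompose p [:- of_nat k, 1:]) (of_nat n)"
    using eventually_ge_at_top[of k] by eventually_elim (simp add: poly_pcompose of_nat_diff)
  then show ?thesis unfolding eventually_poly_def ..
qed

text \<open>The difference of the monomial of degree \<open>d + 1\<close> has degree
  \<open>d\<close> and leading coefficient \<open>d + 1\<close>. Subtracting the difference of a
  suitable multiple \<open>M\<close> from \<open>q\<close> thus lowers the degree or leaves
  zero.\<close>

lemma poly_antidifference:
  fixes q :: "rat poly"
  shows "\<exists>Q. \<forall>x. poly Q (x + 1) - poly Q x = poly q x"
proof (induction "degree q" arbitrary: q rule: less_induct)
  case less
  show ?case
  proof (cases "q = 0")
    case True
    then show ?thesis by (intro exI[of _ 0]) simp
  next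
    case False
    define d where "d = degree q"
    define M where "M = Polynomial.smult (lead_coeff q / of_nat (Suc d)) (monom (1::rat) (Suc d))"
    define D where "D = pcompose M [:1, 1:] - M"
    have D: "poly D x = poly M (x + 1) - poly M x" for x
      by (simp add: D_def poly_pcompose add.commute)
    have pw: "pcompose (monom (1::rat) m) [:1, 1:] = [:1, 1:] ^ m" for m
      by (induction m) (simp_all add: monom_0 monom_Suc pcompose_pCons)
    have coeff1: "coeff ([:1, 1:] ^ m :: rat poly) k = of_nat (m choose k)" for m k
      using coeff_linear_poly_power[of k m 1 1] by (cases "k \<le> m") (auto simp: coeff_eq_0 degree_linear_power)
    have cD: "coeff D k = lead_coeff q / of_nat (Suc d) * (of_nat (Suc d choose k) - (if k = Suc d then 1 else 0))" for k
      unfolding D_def M_def coeff_diff pcompose_smult pw Polynomial.coeff_smult coeff1 by (simp add: right_diff_distrib del: power_Suc binomial_Suc_Suc)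
    have "degree (q - D) \<le> d"
    proof (rule degree_le, intro allI impI)
      fix i assume "d < i"
      then have "coeff q i = 0" "coeff D i = 0"
        using cD[of i] by (auto simp: d_def coeff_eq_0 binomial_eq_0 Suc_lessI le_less_Suc_eq)
      then show "coeff (q - D) i = 0" by simp
    qed
    moreover have "coeff (q - D) d = 0"
      using cD[of d] by (simp add: d_def)
    ultimately have less_or: "degree (q - D) < d \<or> q - D = 0"
      by (metis eq_zero_or_degree_less)
    have "\<exists>Q. \<forall>x. poly Q (x + 1) - poly Q x = poly (q - D) x"
      using less_or
    proof
      assume "degree (q - D) < d"
      then show ?thesis using less[of "q - D"] by (simp add: d_def)
    next
      assume "q - D = 0"
      then show ?thesis by (intro exI[of _ 0]) simp
    qed
    then obtain Q where Q: "\<And>x. poly Q (x + 1) - poly Q x = poly (q - D) x" by blast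
    show ?thesis
      by (rule exI[of _ "Q + M"]) (use Q D in \<open>auto simp: algebra_simps\<close>)
  qed
qed

lemma eventually_poly_partial_sums:
  assumes "eventually_poly f"
  shows "eventually_poly (\<lambda>n. \<Sum>t<n. f t)"
proof -
  obtain q n0 where q: "\<And>n. n \<ge> n0 \<Longrightarrow> f n = poly q (of_nat n)"
    using assms by (auto simp: eventually_poly_def eventually_sequentially)
  obtain Q where Q: "\<And>x. poly Q (x + 1) - poly Q x = poly q x"
    using poly_antidifference by blast
  define c where "c = (\<Sum>t<n0. f t) - poly Q (of_nat n0)"
  have "(\<Sum>t<n. f t) = poly (Q + [:c:]) (of_nat n)" if "n \<ge> n0" for n
    using that
  proof (induction rule: dec_induct)
    case (step n)
    then show ?case using Q[of "of_nat n"] q[of n] by (simp add: algebra_simps)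
  qed (simp add: c_def)
  then show ?thesis unfolding eventually_poly_def eventually_sequentially by blast
qed

section \<open>Hilbert functions of shift-closed sets\<close>

lemma finite_shift_closed_last:
  assumes "shift_closed (Suc d) T"
  shows "finite {v \<in> T. last v = n}"
proof (rule finite_subset)
  show "finite {v. set v \<subseteq> {..n} \<and> length v = Suc d}" by (rule finite_lists_length_eq) simp
  show "{v \<in> T. last v = n} \<subseteq> {v. set v \<subseteq> {..n} \<and> length v = Suc d}"
  proof
    fix v assume v: "v \<in> {v \<in> T. last v = n}"
    then have l: "length v = Suc d" "sorted_wrt (<) v" using shift_closed_elem[OF assms, of v] by auto
    then obtain u where "v = u @ [n]" using v by (cases v rule: rev_cases) auto
    then show "v \<in> {v. set v \<subseteq> {..n} \<and> length v = Suc d}" using l by (fastforce simp: sorted_wrt_append)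
  qed
qed

text \<open>The lists are sorted by their first entry \<open>t\<close>; removing it and renumbering
  turns the last entry \<open>n\<close> into \<open>n - Suc t\<close>.\<close>

lemma shift_closed_count_slices:
  assumes T: "shift_closed (Suc (Suc d)) T"
  shows "card {v \<in> T. last v = n} = (\<Sum>t<n. card {w \<in> tail_slice T t. last w = n - Suc t})"
proof -
  define F where "F = (\<lambda>t w. t # map (\<lambda>x. Suc (x + t)) w :: nat list)"
  define A where "A = (\<lambda>t. {w \<in> tail_slice T t. last w = n - Suc t})"
  have slice: "shift_closed (Suc d) (tail_slice T t)" for t by (rule shift_closed_tail_slice[OF T])
  have last: "last (F t w) = Suc (last w + t)" if "w \<in> tail_slice T t" for t w
    using shift_closed_elem[OF slice that] by (cases w rule: rev_cases) (auto simp: F_def)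
  have fin: "finite (A t)" for t unfolding A_def by (rule finite_shift_closed_last[OF slice])
  have "{v \<in> T. last v = n} = (\<Union>t<n. F t ` A t)"
  proof (intro equalityI subsetI)
    fix v assume v: "v \<in> {v \<in> T. last v = n}"
    then obtain t w where w: "v = F t w" "w \<in> tail_slice T t"
      using shift_closed_Cons[OF T, of v] by (auto simp: F_def)
    then have "t < n" "w \<in> A t" using v last[OF w(2)] by (auto simp: A_def)
    then show "v \<in> (\<Union>t<n. F t ` A t)" using w(1) by blast
  next
    fix v assume "v \<in> (\<Union>t<n. F t ` A t)"
    then obtain t w where "t < n" "w \<in> A t" "v = F t w" by blast
    then show "v \<in> {v \<in> T. last v = n}"
      using last[of w t] by (auto simp: A_def tail_slice_def F_def)
  qed
  also have "card \<dots> = (\<Sum>t<n. card (F t ` A t))"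
    by (rule card_UN_disjoint) (auto simp: fin, auto simp: F_def)
  also have "\<dots> = (\<Sum>t<n. card (A t))"
    by (intro sum.cong refl card_image inj_onI) (auto simp: F_def inj_on_def dest: map_injective)
  finally show ?thesis by (simp add: A_def)
qed

text \<open>By the chain condition the slices are constant from some \<open>t0\<close> on. The
  slices before \<open>t0\<close> contribute finitely many delayed counting functions, the later
  ones a partial sum of a single counting function.\<close>

lemma eventually_poly_shift_closed:
  "shift_closed (Suc d) T \<Longrightarrow> eventually_poly (\<lambda>n. of_nat (card {v \<in> T. last v = n}))"
proof (induction d arbitrary: T)
  case 0
  have T: thesis if "v \<in> T" "\<And>n. v = [n] \<Longrightarrow> thesis" for v thesis
    using shift_closed_elem[OF 0 that(1)] that(2)[of "hd v"] by (cases v) simp_all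
  show ?case
  proof (cases "T = {}")
    case True
    then show ?thesis using eventually_poly_const[of 0] by simp
  next
    case False
    then obtain v where "v \<in> T" by blast
    from T[OF this] this obtain n0 where n0: "[n0] \<in> T" by metis
    \<comment> \<open>With the size as the only entry, \<open>T\<close> is an upward closed set of
      numbers: inserting the index 0 turns \<open>[n]\<close> into \<open>[Suc n]\<close>.\<close>
    have "{v \<in> T. last v = n} = {[n]}" if "n \<ge> n0" for n
    proof -
      have "[n] \<in> T" using that
      proof (induction rule: dec_induct)
        case (step n)
        then show ?case using shift_closedD[OF 0 step.IH, of 0] by simp
      qed (rule n0)
      moreover have "v \<in> {[n]}" if "v \<in> {v \<in> T. last v = n}" for v
        by (rule T[of v]) (use that in auto)
      ultimately show ?thesis by (intro equalityI subsetI) simp_all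
    qed
    then have "\<forall>\<^sub>F n in sequentially. (1::rat) = of_nat (card {v \<in> T. last v = n})"
      unfolding eventually_sequentially by (intro exI[of _ n0]) simp
    then show ?thesis by (rule eventually_poly_cong[OF eventually_poly_const])
  qed
next
  case (Suc d)
  define c where "c = (\<lambda>t n. of_nat (card {w \<in> tail_slice T t. last w = n}) :: rat)"
  have slice: "shift_closed (Suc d) (tail_slice T t)" for t by (rule shift_closed_tail_slice[OF Suc.prems])
  have "mono (tail_slice T)" by (rule monoI) (rule tail_slice_mono[OF Suc.prems])
  from shift_closed_chain_stable[of "Suc d" "tail_slice T", OF slice this]
  obtain t0 where "\<forall>t\<ge>t0. tail_slice T t = tail_slice T t0" ..
  note t0 = this[rule_format]
  have c: "eventually_poly (c t)" for t unfolding c_def by (rule Suc.IH[OF slice])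
  have ct: "c t x = c t0 x" if "t \<ge> t0" for t x
    unfolding c_def t0[OF that] ..
  have eq: "(\<Sum>t<t0. c t (n - Suc t)) + (\<Sum>s<n - t0. c t0 s) = of_nat (card {v \<in> T. last v = n})"
    if "n \<ge> t0" for n
  proof -
    have "of_nat (card {v \<in> T. last v = n}) = (\<Sum>t<n. c t (n - Suc t))"
      by (simp add: shift_closed_count_slices[OF Suc.prems] c_def)
    also have "{..<n} = {..<t0} \<union> {t0..<n}" using that by auto
    also have "(\<Sum>t\<in>{..<t0} \<union> {t0..<n}. c t (n - Suc t)) = (\<Sum>t<t0. c t (n - Suc t)) + (\<Sum>t=t0..<n. c t (n - Suc t))"
      by (rule sum.union_disjoint) auto
    also have "(\<Sum>t=t0..<n. c t (n - Suc t)) = (\<Sum>t=t0..<n. c t0 (n - Suc t))"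
      by (intro sum.cong refl ct) simp
    also have "\<dots> = (\<Sum>s<n - t0. c t0 s)"
      by (rule sum.reindex_bij_witness[of _ "\<lambda>s. n - Suc s" "\<lambda>t. n - Suc t"]) auto
    finally show ?thesis by simp
  qed
  have "eventually_poly (\<lambda>n. (\<Sum>t<t0. c t (n - Suc t)) + (\<Sum>s<n - t0. c t0 s))"
    by (rule eventually_poly_add[OF eventually_poly_sum[OF eventually_poly_delay[OF c]]
          eventually_poly_delay[OF eventually_poly_partial_sums[OF c]]])
  moreover have "\<forall>\<^sub>F n in sequentially. (\<Sum>t<t0. c t (n - Suc t)) + (\<Sum>s<n - t0. c t0 s) =
      of_nat (card {v \<in> T. last v = n})"
    unfolding eventually_sequentially using eq by (intro exI[of _ t0]) simp
  ultimately show ?case by (rule eventually_poly_cong)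
qed

section \<open>Words whose letters carry two indices\<close>

type_synonym 't indexed_word = "(nat \<times> nat \<times> 't) list"

definition relabel :: "(nat \<Rightarrow> nat) \<Rightarrow> 't indexed_word \<Rightarrow> 't indexed_word" where
  "relabel f = map (\<lambda>(i, j, t). (f i, f j, t))"

definition support :: "'t indexed_word \<Rightarrow> nat set" where
  "support w = (\<Union>(i, j, t)\<in>set w. {i, j})"

lemma finite_support [simp]: "finite (support w)"
  by (auto simp: support_def)

lemma card_support: "card (support w) \<le> 2 * length w"
proof (induction w)
  case (Cons x w)
  obtain i j t where x: "x = (i, j, t)" by (cases x)
  have "support (x # w) = {i, j} \<union> support w" by (auto simp: support_def x)
  then have "card (support (x # w)) \<le> card {i, j} + card (support w)"
    by (metis card_Un_le)
  also have "card {i, j} \<le> 2" by (cases "i = j") auto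
  finally show ?case using Cons by simp
qed (simp add: support_def)

lemma relabel_cong: "(\<And>i. i \<in> support w \<Longrightarrow> f i = g i) \<Longrightarrow> relabel f w = relabel g w"
  unfolding relabel_def support_def by (intro map_cong) auto

lemma relabel_relabel: "relabel f (relabel g w) = relabel (f \<circ> g) w"
  by (auto simp: relabel_def)

lemma relabel_id: "(\<And>i. i \<in> support w \<Longrightarrow> f i = i) \<Longrightarrow> relabel f w = w"
  unfolding relabel_def support_def by (intro map_idI) auto

lemma length_relabel [simp]: "length (relabel f w) = length w"
  by (simp add: relabel_def)

lemma support_relabel: "support (relabel f w) = f ` support w"
  by (force simp: support_def relabel_def)

lemma relabel_inj:
  assumes "relabel f w = relabel f w'" "inj_on f (support w \<union> support w')"
  shows "w = w'"
proof -
  define A where "A = support w \<union> support w'"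
  have "relabel (inv_into A f) (relabel f v) = v" if "support v \<subseteq> A" for v
    unfolding relabel_relabel
    by (rule relabel_id) (use that assms(2) in \<open>auto simp: A_def[symmetric]\<close>)
  from this[of w] this[of w'] show ?thesis using assms(1) by (simp add: A_def)
qed

lemma strict_sorted_last:
  assumes "sorted_wrt (<) (u :: nat list)" "i < length u"
  shows "u ! i \<le> last u"
proof -
  have "last u = u ! (length u - 1)" using assms(2) by (intro last_conv_nth) auto
  moreover have "u ! i \<le> u ! (length u - 1)"
    using sorted_wrt_nth_less[OF assms(1), of i "length u - 1"] assms(2)
    by (cases "i = length u - 1") (auto intro: less_imp_le)
  ultimately show ?thesis by simp
qed

text \<open>Every word is a pattern in \<open>P\<close>, whose support is an initial segment,
  relabelled by the increasing enumeration of its own support. A word of length \<open>p\<close> has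
  at most \<open>2 * p\<close> indices, so there are finitely many patterns. For a fixed pattern,
  the enumerations with the size \<open>n\<close> appended as last entry form a shift-closed
  set.\<close>

proposition eventually_poly_indexed_words:
  fixes S :: "nat \<Rightarrow> 't indexed_word set"
  assumes T: "finite T"
    and S: "\<And>n w. w \<in> S n \<Longrightarrow> length w = p \<and> support w \<subseteq> {..<n} \<and> (snd \<circ> snd) ` set w \<subseteq> T"
    and closed: "\<And>n w k. w \<in> S n \<Longrightarrow> k \<le> n \<Longrightarrow> relabel (insert_index k) w \<in> S (Suc n)"
  shows "eventually_poly (\<lambda>n. of_nat (card (S n)))"
proof -
  define P where "P = {w :: 't indexed_word. length w = p \<and> (snd \<circ> snd) ` set w \<subseteq> T \<and>
      (\<forall>i. i \<in> support w \<longleftrightarrow> i < card (support w))}"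
  define V where "V = (\<lambda>w0 :: 't indexed_word. {u. length u = Suc (card (support w0)) \<and> sorted_wrt (<) u \<and>
      relabel ((!) u) w0 \<in> S (last u)})"
  have P_support: "i < card (support w)" if "w \<in> P" "i \<in> support w" for w i
    using that unfolding P_def by blast
  have P_eq: "support w = {..<card (support w)}" if "w \<in> P" for w
    using that unfolding P_def by (intro equalityI subsetI; simp)
  have "P \<subseteq> {w. set w \<subseteq> {..<2 * p} \<times> {..<2 * p} \<times> T \<and> length w = p}"
  proof
    fix w assume w: "w \<in> P"
    then have "card (support w) \<le> 2 * p" using card_support[of w] by (simp add: P_def)
    then have s: "support w \<subseteq> {..<2 * p}" using P_support[OF w] by fastforce
    have "set w \<subseteq> {..<2 * p} \<times> {..<2 * p} \<times> T"
    proof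
      fix x assume x: "x \<in> set w"
      obtain i j t where ijt: "x = (i, j, t)" by (cases x)
      have "i \<in> support w" "j \<in> support w" using x ijt by (force simp: support_def)+
      moreover have "t \<in> T" using w x ijt by (force simp: P_def)
      ultimately show "x \<in> {..<2 * p} \<times> {..<2 * p} \<times> T" using s ijt by auto
    qed
    then show "w \<in> {w. set w \<subseteq> {..<2 * p} \<times> {..<2 * p} \<times> T \<and> length w = p}"
      using w by (auto simp: P_def)
  qed
  moreover have "finite {w. set w \<subseteq> {..<2 * p} \<times> {..<2 * p} \<times> T \<and> length w = p}"
    by (rule finite_lists_length_eq) (simp add: T)
  ultimately have finP: "finite P" by (rule finite_subset)
  have V: "shift_closed (Suc (card (support w0))) (V w0)" if w0: "w0 \<in> P" for w0
    unfolding shift_closed_def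
  proof (intro conjI subsetI ballI allI)
    fix u assume u: "u \<in> V w0"
    then show "u \<in> {v. length v = Suc (card (support w0)) \<and> sorted_wrt (<) v}"
      by (simp add: V_def)
    have u1: "length u = Suc (card (support w0))" "sorted_wrt (<) u" "relabel ((!) u) w0 \<in> S (last u)"
      using u by (auto simp: V_def)
    have ne: "u \<noteq> []" using u1(1) by auto
    have idx: "i < length u" if "i \<in> support w0" for i
      using P_support[OF w0 that] u1(1) by simp
    fix k
    show "map (insert_index k) u \<in> V w0"
    \<comment> \<open>An index up to the size \<open>last u\<close> is a genuine insertion and also
      raises the last entry, in step with the passage to \<open>S (Suc n)\<close>; a larger one
      changes no entry of \<open>u\<close>.\<close>
    proof (cases "k \<le> last u")
      case True
      have "relabel ((!) (map (insert_index k) u)) w0 = relabel (insert_index k) (relabel ((!) u) w0)"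
        unfolding relabel_relabel using idx by (intro relabel_cong) simp
      then have "relabel ((!) (map (insert_index k) u)) w0 \<in> S (Suc (last u))"
        using closed[OF u1(3) True] by simp
      moreover have "last (map (insert_index k) u) = Suc (last u)"
        using ne True by (simp add: last_map)
      ultimately show ?thesis using u1 by (simp add: V_def sorted_wrt_map insert_index_less)
    next
      case False
      have "map (insert_index k) u = u"
      proof (rule map_idI)
        fix x assume "x \<in> set u"
        then have "x \<le> last u" using strict_sorted_last[OF u1(2)] by (metis in_set_conv_nth)
        then show "insert_index k x = x" using False by simp
      qed
      then show ?thesis using u by simp
    qed
  qed
  have supp: "support (relabel ((!) u) w0) = set (butlast u)" if "w0 \<in> P" "u \<in> V w0" for w0 u
  proof -
    have l: "length u = Suc (card (support w0))" using that by (auto simp: V_def)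
    have "set (butlast u) = (\<lambda>i. butlast u ! i) ` {..<card (support w0)}"
      using l by (auto simp: set_conv_nth)
    also have "\<dots> = (!) u ` {..<card (support w0)}"
      by (intro image_cong) (use l in \<open>auto simp: nth_butlast\<close>)
    also have "{..<card (support w0)} = support w0" by (rule P_eq[OF that(1), symmetric])
    finally show ?thesis by (simp add: support_relabel)
  qed
  have unique: "u = u'" if "w0 \<in> P" "w1 \<in> P" "u \<in> V w0" "u' \<in> V w1" "last u = last u'"
      \<comment> \<open>The support of the relabelled word is the set of entries before the last,
        and an increasing list is determined by its set. So even words from different patterns have
        the same enumeration.\<close>
      "relabel ((!) u) w0 = relabel ((!) u') w1" for w0 w1 u u'
  proof -
    have ne: "u \<noteq> []" "u' \<noteq> []" using that by (auto simp: V_def)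
    have "set (butlast u) = set (butlast u')"
      using supp[OF that(1,3)] supp[OF that(2,4)] that(6) by simp
    moreover have "sorted_wrt (<) (butlast u)" "sorted_wrt (<) (butlast u')"
      using that(3,4) ne by (auto simp: V_def butlast_conv_take sorted_wrt_take)
    ultimately have "butlast u = butlast u'" by (metis strict_sorted_equal)
    then show ?thesis using ne that(5) by (metis append_butlast_last_id)
  qed
  have S_eq: "S n = (\<Union>w0\<in>P. (\<lambda>u. relabel ((!) u) w0) ` {u \<in> V w0. last u = n})" for n
  proof (intro equalityI subsetI)
    fix w assume w: "w \<in> S n"
    define l where "l = sorted_list_of_set (support w)"
    have l: "set l = support w" "sorted_wrt (<) l" "distinct l" "length l = card (support w)"
      by (auto simp: l_def)
    have bij: "bij_betw ((!) l) {..<card (support w)} (support w)"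
      using bij_betw_nth[OF l(3), of "{..<length l}" "set l"] l by (simp add: lessThan_atLeast0)
    define rank where "rank = inv_into {..<card (support w)} ((!) l)"
    have rank: "bij_betw rank (support w) {..<card (support w)}"
      unfolding rank_def by (rule bij_betw_inv_into[OF bij])
    have lr: "l ! rank i = i" if "i \<in> support w" for i
      using that bij unfolding rank_def by (simp add: bij_betw_def f_inv_into_f)
    define w0 where "w0 = relabel rank w"
    have s0: "support w0 = {..<card (support w)}"
      using rank by (simp add: w0_def support_relabel bij_betw_def)
    have "(snd \<circ> snd) ` set w0 = (snd \<circ> snd) ` set w"
      unfolding w0_def relabel_def by force
    moreover have "length w0 = length w" by (simp add: w0_def)
    ultimately have w0: "w0 \<in> P" using S[OF w] s0 unfolding P_def by simp
    have eq: "relabel ((!) (l @ [n])) w0 = w"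
      unfolding w0_def relabel_relabel
    proof (rule relabel_id)
      fix i assume i: "i \<in> support w"
      then have "rank i < length l" using rank l(4) by (auto simp: bij_betw_def)
      then show "((!) (l @ [n]) \<circ> rank) i = i" using lr[OF i] by (simp add: nth_append)
    qed
    have "l @ [n] \<in> {u \<in> V w0. last u = n}"
      using l S[OF w] w eq s0 by (auto simp: V_def sorted_wrt_append)
    then show "w \<in> (\<Union>w0\<in>P. (\<lambda>u. relabel ((!) u) w0) ` {u \<in> V w0. last u = n})"
      using w0 eq by (intro UN_I[of w0] image_eqI[of _ _ "l @ [n]"]) simp_all
  next
    fix w assume "w \<in> (\<Union>w0\<in>P. (\<lambda>u. relabel ((!) u) w0) ` {u \<in> V w0. last u = n})"
    then show "w \<in> S n" by (auto simp: V_def)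
  qed
  have "card (S n) = (\<Sum>w0\<in>P. card {u \<in> V w0. last u = n})" for n
  proof -
    have "card (S n) = (\<Sum>w0\<in>P. card ((\<lambda>u. relabel ((!) u) w0) ` {u \<in> V w0. last u = n}))"
      unfolding S_eq
    proof (rule card_UN_disjoint[OF finP])
      show "\<forall>w0\<in>P. finite ((\<lambda>u. relabel ((!) u) w0) ` {u \<in> V w0. last u = n})"
        using finite_shift_closed_last[OF V] by auto
      show "\<forall>w0\<in>P. \<forall>w1\<in>P. w0 \<noteq> w1 \<longrightarrow>
          (\<lambda>u. relabel ((!) u) w0) ` {u \<in> V w0. last u = n} \<inter>
          (\<lambda>u. relabel ((!) u) w1) ` {u \<in> V w1. last u = n} = {}"
      proof (intro ballI impI, rule ccontr)
        fix w0 w1 assume P: "w0 \<in> P" "w1 \<in> P" and "w0 \<noteq> w1"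
          and "(\<lambda>u. relabel ((!) u) w0) ` {u \<in> V w0. last u = n} \<inter>
            (\<lambda>u. relabel ((!) u) w1) ` {u \<in> V w1. last u = n} \<noteq> {}"
        then obtain u u' where u: "u \<in> V w0" "last u = n" "u' \<in> V w1" "last u' = n"
          "relabel ((!) u) w0 = relabel ((!) u') w1" by blast
        have uu: "u = u'" using unique[OF P u(1,3)] u by simp
        have lu: "length u = Suc (card (support w0))" "length u = Suc (card (support w1))" "sorted_wrt (<) u"
          using u uu by (auto simp: V_def)
        have "support w0 \<union> support w1 \<subseteq> {..<length u}"
          using lu P_support[OF P(1)] P_support[OF P(2)] by fastforce
        moreover have "inj_on ((!) u) {..<length u}"
          using lu(3) by (intro inj_on_nth) (auto simp: strict_sorted_iff)
        ultimately have "inj_on ((!) u) (support w0 \<union> support w1)" by (rule inj_on_subset[rotated])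
        from relabel_inj[OF _ this] u(5) uu \<open>w0 \<noteq> w1\<close> show False by simp
      qed
    qed
    also have "\<dots> = (\<Sum>w0\<in>P. card {u \<in> V w0. last u = n})"
    proof (intro sum.cong refl card_image inj_onI)
      fix w0 u u' assume "w0 \<in> P" "u \<in> {u \<in> V w0. last u = n}" "u' \<in> {u \<in> V w0. last u = n}"
        "relabel ((!) u) w0 = relabel ((!) u') w0"
      then show "u = u'" using unique[of w0 w0 u u'] by simp
    qed
    finally show ?thesis .
  qed
  then have "(\<lambda>n. of_nat (card (S n)) :: rat) = (\<lambda>n. \<Sum>w0\<in>P. of_nat (card {u \<in> V w0. last u = n}))"
    by (simp add: fun_eq_iff)
  then show ?thesis
    using eventually_poly_sum[of P "\<lambda>w0 n. of_nat (card {u \<in> V w0. last u = n})"]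
      eventually_poly_shift_closed[OF V] by simp
qed

section \<open>Normal forms in a finitely generated additive group\<close>

locale additive_generators =
  fixes s :: "nat \<Rightarrow> 'r::ring_1"
begin

definition sub :: "nat \<Rightarrow> 'r set" where
  "sub c = {x. \<exists>k. x = (\<Sum>i<c. of_int (k i) * s i)}"

lemma subI: "x = (\<Sum>i<c. of_int (k i) * s i) \<Longrightarrow> x \<in> sub c"
  unfolding sub_def by blast

lemma sub_0: "sub 0 = {0}"
  by (simp add: sub_def)

lemma zero_in_sub: "0 \<in> sub c"
  unfolding sub_def by (intro CollectI exI[of _ "\<lambda>_. 0"]) simp

lemma sub_diff: "x \<in> sub c \<Longrightarrow> y \<in> sub c \<Longrightarrow> x - y \<in> sub c"
proof -
  assume "x \<in> sub c" "y \<in> sub c"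
  then obtain k l where "x = (\<Sum>i<c. of_int (k i) * s i)" "y = (\<Sum>i<c. of_int (l i) * s i)"
    by (auto simp: sub_def)
  then have "x - y = (\<Sum>i<c. of_int (k i - l i) * s i)"
    by (simp add: sum_subtractf algebra_simps)
  then show "x - y \<in> sub c" by (rule subI)
qed

lemma sub_add: "x \<in> sub c \<Longrightarrow> y \<in> sub c \<Longrightarrow> x + y \<in> sub c"
  using sub_diff[of x c "0 - y"] sub_diff[OF zero_in_sub, of y c] by simp

lemma sub_mult: "x \<in> sub c \<Longrightarrow> of_int q * x \<in> sub c"
proof -
  assume "x \<in> sub c"
  then obtain k where "x = (\<Sum>i<c. of_int (k i) * s i)" by (auto simp: sub_def)
  then have "of_int q * x = (\<Sum>i<c. of_int (q * k i) * s i)"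
    by (simp add: sum_distrib_left mult.assoc)
  then show ?thesis by (rule subI)
qed

lemma sub_Suc: "x \<in> sub (Suc c) \<longleftrightarrow> (\<exists>K. \<exists>h\<in>sub c. x = of_int K * s c + h)"
proof
  assume "x \<in> sub (Suc c)"
  then obtain k where "x = (\<Sum>i<c. of_int (k i) * s i) + of_int (k c) * s c" by (auto simp: sub_def)
  then show "\<exists>K. \<exists>h\<in>sub c. x = of_int K * s c + h"
    by (intro exI[of _ "k c"] bexI[of _ "\<Sum>i<c. of_int (k i) * s i"]) (auto simp: sub_def add.commute)
next
  assume "\<exists>K. \<exists>h\<in>sub c. x = of_int K * s c + h"
  then obtain K k where x: "x = of_int K * s c + (\<Sum>i<c. of_int (k i) * s i)" by (auto simp: sub_def)
  have "(\<Sum>i<c. of_int ((k(c := K)) i) * s i) = (\<Sum>i<c. of_int (k i) * s i)"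
    by (intro sum.cong) auto
  then have "x = (\<Sum>i<Suc c. of_int ((k(c := K)) i) * s i)" by (simp add: x add.commute)
  then show "x \<in> sub (Suc c)" by (rule subI)
qed

text \<open>The value 0 encodes that no positive multiple of \<open>s c\<close> lies in \<open>sub c\<close>.\<close>

definition per :: "nat \<Rightarrow> nat" where
  "per c = (if \<exists>m>0. of_nat m * s c \<in> sub c then LEAST m. m > 0 \<and> of_nat m * s c \<in> sub c else 0)"

lemma per_in_sub: "of_int (int (per c)) * s c \<in> sub c"
proof (cases "\<exists>m>0. of_nat m * s c \<in> sub c")
  case True
  then have "per c > 0 \<and> of_nat (per c) * s c \<in> sub c"
    using LeastI_ex[OF True] by (simp add: per_def)
  then show ?thesis by simp
next
  case False
  then have "per c = 0" unfolding per_def by (rule if_not_P)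
  then show ?thesis by (simp add: zero_in_sub)
qed

text \<open>Minimality of \<open>per c\<close> applied to \<open>\<bar>j\<bar>\<close>, since the
  subgroup is closed under negation.\<close>

lemma not_in_sub:
  assumes "of_int j * s c \<in> sub c" "per c = 0 \<or> \<bar>j\<bar> < int (per c)"
  shows "j = 0"
proof (rule ccontr)
  assume j: "j \<noteq> 0"
  have "of_nat (nat \<bar>j\<bar>) * s c \<in> sub c"
  proof (cases "j > 0")
    case True then show ?thesis using assms(1) by (simp add: of_nat_nat)
  next
    case False
    then have "of_nat (nat \<bar>j\<bar>) * s c = of_int (- 1) * (of_int j * s c)" by (simp add: of_nat_nat)
    then show ?thesis using sub_mult[OF assms(1), of "- 1"] by simp
  qed
  moreover have "nat \<bar>j\<bar> > 0" using j by simp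
  ultimately have ex: "\<exists>m>0. of_nat m * s c \<in> sub c"
    and le: "(LEAST m. m > 0 \<and> of_nat m * s c \<in> sub c) \<le> nat \<bar>j\<bar>"
    by (blast, intro Least_le) simp
  have "per c > 0" using LeastI_ex[OF ex] ex by (simp add: per_def)
  moreover have "per c \<le> nat \<bar>j\<bar>" using ex le by (simp add: per_def)
  ultimately show False using assms(2) by linarith
qed

text \<open>A generator of infinite order modulo its predecessors gets just two opposite letters, so
  that the alphabet stays finite. One of finite order gets all its nonzero residues: with a single
  letter, its order relation would involve long powers instead of pairs.\<close>

definition letters :: "nat \<Rightarrow> (nat \<times> int) set" where
  "letters r = {(c, k). c < r \<and> k \<noteq> 0 \<and> (if per c = 0 then \<bar>k\<bar> = 1 else 0 < k \<and> k < int (per c))}"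

lemma finite_letters: "finite (letters r)"
proof (rule finite_subset)
  show "letters r \<subseteq> (\<Union>c<r. {c} \<times> {- 1 - int (per c)..1 + int (per c)})"
    by (auto simp: letters_def split: if_splits)
qed auto

definition val :: "nat \<times> int \<Rightarrow> 'r" where
  "val x = of_int (snd x) * s (fst x)"

definition valw :: "(nat \<times> int) list \<Rightarrow> 'r" where
  "valw w = sum_list (map val w)"

lemma valw_simps [simp]: "valw [] = 0" "valw (x # w) = val x + valw w" "valw (u @ w) = valw u + valw w"
  by (simp_all add: valw_def)

text \<open>Generators with larger index come first. Only letters of infinite order may be repeated,
  so a reduced word contains neither opposite letters nor two residues of the same
  generator.\<close>

definition below :: "nat \<times> int \<Rightarrow> nat \<times> int \<Rightarrow> bool" where
  "below x y \<longleftrightarrow> fst y < fst x \<or> x = y \<and> per (fst x) = 0"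

lemma below_trans: "below x y \<Longrightarrow> below y z \<Longrightarrow> below x z"
  by (auto simp: below_def)

definition words :: "nat \<Rightarrow> (nat \<times> int) list set" where
  "words r = {w. set w \<subseteq> letters r \<and> sorted_wrt below w}"

text \<open>The normal word of a multiple of one generator: a power of one signed letter, or a
  single residue.\<close>

definition block :: "nat \<Rightarrow> int \<Rightarrow> (nat \<times> int) list" where
  "block c K = (if per c = 0 then replicate (nat \<bar>K\<bar>) (c, sgn K) else if K = 0 then [] else [(c, K)])"

definition coeff_range :: "nat \<Rightarrow> int set" where
  "coeff_range c = (if per c = 0 then UNIV else {0..<int (per c)})"

lemma valw_block: "valw (block c K) = of_int K * s c"
proof -
  have "valw (replicate n x) = of_nat n * val x" for n x
    by (induction n) (auto simp: algebra_simps)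
  moreover have "of_nat (nat \<bar>K\<bar>) * (of_int (sgn K) * s c) = of_int K * s c"
    by (cases K "0 :: int" rule: linorder_cases) (simp_all add: of_nat_nat)
  ultimately show ?thesis by (simp add: block_def val_def)
qed

lemma words_mono: "c \<le> d \<Longrightarrow> words c \<subseteq> words d"
  by (auto simp: words_def letters_def)

lemma block_word:
  assumes "K \<in> coeff_range c" "v \<in> words c"
  shows "block c K @ v \<in> words (Suc c)"
proof -
  have v: "v \<in> words (Suc c)" "\<And>y. y \<in> set v \<Longrightarrow> fst y < c"
    using assms(2) words_mono[of c "Suc c"] by (auto simp: words_def letters_def)
  have "set (block c K) \<subseteq> letters (Suc c) \<and> sorted_wrt below (block c K) \<and> (\<forall>x\<in>set (block c K). fst x = c)"
    using assms(1) by (auto simp: block_def coeff_range_def letters_def below_def sorted_wrt_iff_nth_less sgn_if split: if_splits)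
  then show ?thesis using v by (auto simp: words_def sorted_wrt_append below_def)
qed

text \<open>The generator with the largest index comes first in a reduced word, so its letters form
  an initial block.\<close>

lemma words_Suc:
  assumes "w \<in> words (Suc c)"
  obtains K v where "K \<in> coeff_range c" "v \<in> words c" "w = block c K @ v"
  using assms
proof (induction w arbitrary: thesis)
  case Nil
  show ?case by (rule Nil.prems(1)[of 0 "[]"]) (auto simp: coeff_range_def words_def block_def)
next
  case (Cons x w)
  have w: "w \<in> words (Suc c)" and x: "x \<in> letters (Suc c)" and xw: "\<And>y. y \<in> set w \<Longrightarrow> below x y"
    using Cons.prems(2) by (auto simp: words_def)
  obtain K v where Kv: "K \<in> coeff_range c" "v \<in> words c" "w = block c K @ v"
    using Cons.IH[OF _ w] by blast
  obtain c' k where ck: "x = (c', k)" by (cases x)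
  show ?case
  proof (cases "c' = c")
    case False
    then have "c' < c" using x ck by (simp add: letters_def)
    have "block c K = []"
    proof (rule ccontr)
      assume "block c K \<noteq> []"
      then have "\<exists>k. (c, k) \<in> set w" using Kv(3) by (auto simp: block_def split: if_splits)
      then show False using xw ck \<open>c' < c\<close> by (force simp: below_def)
    qed
    then have "x # w \<in> words c"
      using Cons.prems(2) Kv(2,3) x ck \<open>c' < c\<close> by (auto simp: words_def letters_def)
    moreover have "0 \<in> coeff_range c" "block c 0 = []" by (auto simp: coeff_range_def block_def)
    ultimately show ?thesis by (intro Cons.prems(1)[of 0 "x # w"]) simp_all
  next
    case True
    have k: "k \<in> coeff_range c" "block c k = [x]"
      using x ck True by (auto simp: letters_def coeff_range_def block_def sgn_if abs_if split: if_splits)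
    show ?thesis
    proof (cases "block c K = []")
      case True
      then show ?thesis by (intro Cons.prems(1)[of k v]) (use k Kv in auto)
    next
      case False
      then obtain k' where k': "(c, k') \<in> set (block c K)" "per c = 0 \<longrightarrow> k' = sgn K"
        by (auto simp: block_def split: if_splits)
      then have "below x (c, k')" using xw Kv(3) by simp
      then have *: "per c = 0" "k = k'" using ck \<open>c' = c\<close> by (auto simp: below_def)
      then have "k = sgn K" "K \<noteq> 0" using k'(2) False by (auto simp: block_def)
      then have "nat \<bar>k + K\<bar> = Suc (nat \<bar>K\<bar>)" "sgn (k + K) = k"
        by (auto simp: sgn_if split: if_splits)
      then have "block c (k + K) = x # block c K"
        using * ck \<open>c' = c\<close> \<open>k = sgn K\<close> by (simp add: block_def)
      then show ?thesis using Kv * by (intro Cons.prems(1)[of "k + K" v]) (auto simp: coeff_range_def)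
    qed
  qed
qed

lemma valw_in_sub: "w \<in> words c \<Longrightarrow> valw w \<in> sub c"
proof (induction c arbitrary: w)
  case 0
  then have "w = []" by (auto simp: words_def letters_def)
  then show ?case by (simp add: sub_0)
next
  case (Suc c)
  obtain K v where "K \<in> coeff_range c" "v \<in> words c" "w = block c K @ v" using words_Suc[OF Suc.prems] .
  then show ?case unfolding sub_Suc using Suc.IH[of v]
    by (intro exI[of _ K] bexI[of _ "valw v"]) (simp_all add: valw_block)
qed

lemma block_decomp:
  assumes "x \<in> sub (Suc c)"
  obtains K h where "K \<in> coeff_range c" "h \<in> sub c" "x = of_int K * s c + h"
proof -
  obtain K0 h0 where x: "h0 \<in> sub c" "x = of_int K0 * s c + h0" using assms by (auto simp: sub_Suc)
  show ?thesis
  proof (cases "per c = 0")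
    case True
    then show ?thesis using that[of K0 h0] x by (simp add: coeff_range_def)
  next
    case False
    let ?m = "int (per c)"
    have "K0 = K0 mod ?m + K0 div ?m * ?m" by simp
    then have "of_int K0 * s c = of_int (K0 mod ?m) * s c + of_int (K0 div ?m) * (of_int ?m * s c)"
      by (metis (no_types, lifting) distrib_right mult.assoc of_int_add of_int_mult)
    then have "x = of_int (K0 mod ?m) * s c + (of_int (K0 div ?m) * (of_int ?m * s c) + h0)"
      using x(2) by (simp add: add.assoc)
    moreover have "of_int (K0 div ?m) * (of_int ?m * s c) + h0 \<in> sub c"
      by (intro sub_add sub_mult per_in_sub x(1))
    moreover have "K0 mod ?m \<in> coeff_range c" using False by (simp add: coeff_range_def)
    ultimately show ?thesis using that by blast
  qed
qed

text \<open>Induction along the chain of subgroups: every coset of \<open>sub c\<close> in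
  \<open>sub (Suc c)\<close> contains \<open>K * s c\<close> for exactly one \<open>K\<close> in
  \<open>coeff_range c\<close>, and the remainder has a unique word by the induction
  hypothesis.\<close>

lemma bij_valw: "bij_betw valw (words c) (sub c)"
proof (induction c)
  case 0
  have "words 0 = {[]}" by (auto simp: words_def letters_def)
  then show ?case by (simp add: sub_0 bij_betw_def)
next
  case (Suc c)
  show ?case
  proof (rule bij_betwI')
    fix w w' assume w: "w \<in> words (Suc c)" "w' \<in> words (Suc c)"
    obtain K v where Kv: "K \<in> coeff_range c" "v \<in> words c" "w = block c K @ v" using words_Suc[OF w(1)] .
    obtain K' v' where Kv': "K' \<in> coeff_range c" "v' \<in> words c" "w' = block c K' @ v'" using words_Suc[OF w(2)] .
    show "valw w = valw w' \<longleftrightarrow> w = w'"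
    proof
      assume "valw w = valw w'"
      then have eq: "of_int K * s c + valw v = of_int K' * s c + valw v'"
        by (simp add: Kv(3) Kv'(3) valw_block)
      then have "of_int (K - K') * s c = valw v' - valw v" by (simp add: algebra_simps)
      then have "of_int (K - K') * s c \<in> sub c"
        using sub_diff[OF valw_in_sub[OF Kv'(2)] valw_in_sub[OF Kv(2)]] by simp
      moreover have "per c = 0 \<or> \<bar>K - K'\<bar> < int (per c)"
        using Kv(1) Kv'(1) by (auto simp: coeff_range_def split: if_splits)
      ultimately have "K = K'" using not_in_sub[of "K - K'" c] by simp
      moreover from this eq have "valw v = valw v'" by simp
      then have "v = v'" using Suc.IH Kv(2) Kv'(2) by (auto simp: bij_betw_def dest: inj_onD)
      ultimately show "w = w'" by (simp add: Kv(3) Kv'(3))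
    qed simp
  next
    fix w assume "w \<in> words (Suc c)" then show "valw w \<in> sub (Suc c)" by (rule valw_in_sub)
  next
    fix x assume "x \<in> sub (Suc c)"
    then obtain K h where Kh: "K \<in> coeff_range c" "h \<in> sub c" "x = of_int K * s c + h" by (rule block_decomp)
    have "h \<in> valw ` words c" using Suc.IH Kh(2) by (simp add: bij_betw_def)
    then obtain v where "v \<in> words c" "h = valw v" by blast
    then show "\<exists>w\<in>words (Suc c). x = valw w"
      using block_word[OF Kh(1)] Kh(3) by (intro bexI[of _ "block c K @ v"]) (simp_all add: valw_block)
  qed
qed

definition nfw :: "nat \<Rightarrow> 'r \<Rightarrow> (nat \<times> int) list" where
  "nfw r = inv_into (words r) valw"

lemma nfw:
  assumes "x \<in> sub r"
  shows "nfw r x \<in> words r" "valw (nfw r x) = x"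
proof -
  have "x \<in> valw ` words r" using assms bij_valw[of r] by (simp add: bij_betw_def)
  then show "nfw r x \<in> words r" "valw (nfw r x) = x"
    unfolding nfw_def by (auto intro: inv_into_into f_inv_into_f)
qed

lemma nfw_valw: "w \<in> words r \<Longrightarrow> nfw r (valw w) = w"
  using bij_valw[of r] unfolding nfw_def bij_betw_def by (simp add: inv_into_f_f)

text \<open>For infinite order a bad pair consists of opposite letters, which cancel. For finite
  order the sum is reduced modulo \<open>per\<close>, and the carry lies in the previous subgroup,
  so it produces only letters of generators with smaller index.\<close>

lemma nfw_rewrite:
  assumes "x \<in> letters r" "y \<in> letters r" "fst x = fst y" "\<not> below x y"
  obtains zs cs where "nfw r (val x + val y) = zs @ cs" "\<And>z. z \<in> set cs \<Longrightarrow> fst z < fst x"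
    "zs = [] \<or> (\<exists>k. zs = [(fst x, k)])"
proof (cases "per (fst x) = 0")
  case True
  then have "snd x = - snd y" using assms by (auto simp: letters_def below_def prod_eq_iff split: if_splits)
  then have "val x + val y = valw []" by (simp add: val_def assms(3))
  then have "nfw r (val x + val y) = []" using nfw_valw[of "[]" r] by (simp add: words_def)
  then show ?thesis using that[of "[]" "[]"] by simp
next
  case False
  define c where "c = fst x"
  have "val x + val y = of_int (snd x + snd y) * s c"
    by (simp add: val_def c_def assms(3) algebra_simps)
  then have "val x + val y \<in> sub (Suc c)"
    unfolding sub_Suc using zero_in_sub by (intro exI[of _ "snd x + snd y"] bexI[of _ 0]) simp_all
  then obtain K h where Kh: "K \<in> coeff_range c" "h \<in> sub c" "val x + val y = of_int K * s c + h"
    by (rule block_decomp)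
  have "c < r" using assms(1) by (auto simp: letters_def c_def)
  then have w: "block c K @ nfw c h \<in> words r"
    using block_word[OF Kh(1) nfw(1)[OF Kh(2)]] words_mono[of "Suc c" r] by auto
  have "valw (block c K @ nfw c h) = val x + val y" by (simp add: Kh(3) valw_block nfw(2)[OF Kh(2)])
  then have "nfw r (val x + val y) = block c K @ nfw c h" using nfw_valw[OF w] by simp
  moreover have "fst z < fst x" if "z \<in> set (nfw c h)" for z
    using nfw(1)[OF Kh(2)] that by (auto simp: words_def letters_def c_def)
  moreover have "block c K = [] \<or> (\<exists>k. block c K = [(fst x, k)])"
    using False by (simp add: block_def c_def)
  ultimately show ?thesis by (rule that)
qed

lemma group_closure_sub: "s ` {..<r} = S \<Longrightarrow> group_closure S \<subseteq> sub r"
proof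
  fix x assume S: "s ` {..<r} = S" and "x \<in> group_closure S"
  from this(2) show "x \<in> sub r"
  proof (induction rule: group_closure.induct)
    case (base x)
    show ?case
    proof (cases "x = 0")
      case False
      then obtain i where i: "i < r" "x = s i" using base S by auto
      then have "x = (\<Sum>j<r. of_int (if j = i then 1 else 0) * s j)"
        by (simp add: if_distrib[of of_int] if_distrib[of "\<lambda>x. x * _"] sum.delta cong: if_cong)
      then show ?thesis by (rule subI)
    qed (simp add: zero_in_sub)
  qed (rule sub_diff)
qed

end

section \<open>Normal forms of unitriangular matrices\<close>

type_synonym unitri_letter = "nat \<times> nat \<times> nat \<times> int"

lemma mult_add_less:
  fixes a b m x y :: nat
  assumes "a < b" "x < m"
  shows "a * m + x < b * m + y"
proof -
  have "a * m + x < Suc a * m" using assms(2) by simp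
  also have "\<dots> \<le> b * m" using assms(1) by (intro mult_right_mono) auto
  finally show ?thesis by simp
qed

locale additive_presentation = additive_generators s for s :: "nat \<Rightarrow> 'r::ring_1" +
  fixes r :: nat
  assumes sub_UNIV: "sub r = UNIV"
begin

lemmas nfw_words = nfw(1)[of _ r, unfolded sub_UNIV, OF UNIV_I]
  and valw_nfw = nfw(2)[of _ r, unfolded sub_UNIV, OF UNIV_I]

definition uletters :: "nat \<Rightarrow> unitri_letter set" where
  "uletters n = {(i, j, l). i < j \<and> j < n \<and> l \<in> letters r}"

definition elem :: "nat \<Rightarrow> unitri_letter \<Rightarrow> 'r mat" where
  "elem n x = mat n n (\<lambda>(a, b). if a = b then 1 else if a = fst x \<and> b = fst (snd x) then val (snd (snd x)) else 0)"

text \<open>Rows are ordered from the bottom to the top. This order is preserved by insertions of indices, and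
  commutators of two letters are later than both of them.\<close>

definition ubelow :: "unitri_letter \<Rightarrow> unitri_letter \<Rightarrow> bool" where
  "ubelow = (\<lambda>(i, j, l) (i', j', l'). i' < i \<or> i = i' \<and> (j < j' \<or> j = j' \<and> below l l'))"

lemma ubelow_iff [simp]:
  "ubelow (i, j, l) (i', j', l') \<longleftrightarrow> i' < i \<or> i = i' \<and> (j < j' \<or> j = j' \<and> below l l')"
  by (simp add: ubelow_def)

lemma transp_ubelow: "transp ubelow"
  by (rule transpI) (auto simp: ubelow_def dest: below_trans)

definition part :: "nat \<Rightarrow> nat \<Rightarrow> unitri_letter list \<Rightarrow> (nat \<times> int) list" where
  "part a b w = map (snd \<circ> snd) (filter (\<lambda>x. fst x = a \<and> fst (snd x) = b) w)"

lemma part_simps [simp]: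
  "part a b [] = []"
  "part a b (x # w) = (if fst x = a \<and> fst (snd x) = b then snd (snd x) # part a b w else part a b w)"
  "part a b (u @ w) = part a b u @ part a b w"
  by (simp_all add: part_def)

lemma part_map_Pair: "part a b (map (\<lambda>l. (i, j, l)) ls) = (if i = a \<and> j = b then ls else [])"
  by (induction ls) auto

lemma part_Nil_iff: "part a b w = [] \<longleftrightarrow> (\<forall>l. (a, b, l) \<notin> set w)"
  by (auto simp: part_def filter_empty_conv)

lemma elem_closed: "x \<in> uletters n \<Longrightarrow> elem n x \<in> carrier (unitriangular_group n)"
  by (auto simp: uletters_def elem_def unitriangular_group_def upper_triangular_def)

lemma elem_mult_entry:
  assumes "i < j" "j < n" "M \<in> carrier_mat n n" "a < n" "b < n"
  shows "(elem n (i, j, l) * M) $$ (a, b) = M $$ (a, b) + (if a = i then val l * M $$ (j, b) else 0)"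
proof -
  have "elem n (i, j, l) \<in> carrier_mat n n" by (simp add: elem_def)
  then have "(elem n (i, j, l) * M) $$ (a, b) = (\<Sum>k<n. elem n (i, j, l) $$ (a, k) * M $$ (k, b))"
    using assms by (intro unitriangular_mult_entry)
  also have "\<dots> = (\<Sum>k<n. (if k = a then M $$ (a, b) else 0) + (if k = j then if a = i then val l * M $$ (j, b) else 0 else 0))"
    using assms by (intro sum.cong) (auto simp: elem_def)
  also have "\<dots> = M $$ (a, b) + (if a = i then val l * M $$ (j, b) else 0)"
    using assms by (simp add: sum.distrib)
  finally show ?thesis .
qed

definition ueval :: "nat \<Rightarrow> unitri_letter list \<Rightarrow> 'r mat" where
  "ueval n w = foldr (\<lambda>x h. elem n x * h) w (1\<^sub>m n)"

text \<open>With weakly decreasing row indices no product \<open>E\<^sub>i\<^sub>j E\<^sub>j\<^sub>k\<close> arises, so the entries just add up.\<close>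

lemma ueval_entries:
  assumes "set w \<subseteq> uletters n" "sorted_wrt (\<lambda>x y. fst y \<le> fst x) w"
  shows "ueval n w = mat n n (\<lambda>(a, b). if a = b then 1 else valw (part a b w))"
  using assms
proof (induction w)
  case Nil
  show ?case by (rule eq_matI) (auto simp: ueval_def)
next
  case (Cons x w)
  obtain i j l where x: "x = (i, j, l)" by (cases x)
  have ij: "i < j" "j < n" using Cons.prems x by (auto simp: uletters_def)
  define M where "M = ueval n w"
  have M: "M = mat n n (\<lambda>(a, b). if a = b then 1 else valw (part a b w))"
    using Cons by (simp add: M_def)
  have j: "part j b w = []" for b
    unfolding part_Nil_iff using Cons.prems(2) x ij by force
  have "ueval n (x # w) = elem n x * M" by (simp add: ueval_def M_def)
  also have "\<dots> = mat n n (\<lambda>(a, b). if a = b then 1 else valw (part a b (x # w)))"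
  proof (rule eq_matI)
    fix a b assume "a < dim_row (mat n n (\<lambda>(a, b). if a = b then 1 else valw (part a b (x # w))))"
      "b < dim_col (mat n n (\<lambda>(a, b). if a = b then 1 else valw (part a b (x # w))))"
    then have ab: "a < n" "b < n" by simp_all
    have Mc: "M \<in> carrier_mat n n" by (simp add: M)
    show "(elem n x * M) $$ (a, b) = mat n n (\<lambda>(a, b). if a = b then 1 else valw (part a b (x # w))) $$ (a, b)"
      unfolding x elem_mult_entry[OF ij Mc ab] using ab ij by (auto simp: M j)
  qed (simp_all add: elem_def M)
  finally show ?case .
qed

section \<open>Normal words of unitriangular matrices\<close>

definition positions :: "nat \<Rightarrow> (nat \<times> nat) list" where
  "positions n = concat (map (\<lambda>a. map (Pair a) [Suc a..<n]) (rev [0..<n]))"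

definition pless :: "nat \<times> nat \<Rightarrow> nat \<times> nat \<Rightarrow> bool" where
  "pless p q \<longleftrightarrow> fst q < fst p \<or> fst p = fst q \<and> snd p < snd q"

lemma set_positions: "set (positions n) = {(a, b). a < b \<and> b < n}"
proof -
  have "(a, b) \<in> set (positions n)" if "a < b" "b < n" for a b
    using that by (auto simp: positions_def intro!: bexI[of _ a])
  then show ?thesis by (auto simp: positions_def)
qed

lemma sorted_positions: "sorted_wrt pless (positions n)"
proof -
  have "sorted_wrt pless (concat (map (\<lambda>a. map (Pair a) [Suc a..<n]) as))" if "sorted_wrt (>) as" for as
    using that by (induction as) (auto simp: sorted_wrt_append sorted_wrt_map pless_def)
  moreover have "sorted_wrt (>) (rev [0..<n])" by (simp add: sorted_wrt_rev)
  ultimately show ?thesis by (simp add: positions_def)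
qed

definition spread :: "(nat \<times> nat \<Rightarrow> (nat \<times> int) list) \<Rightarrow> (nat \<times> nat) list \<Rightarrow> unitri_letter list" where
  "spread f ps = concat (map (\<lambda>p. map (\<lambda>l. (fst p, snd p, l)) (f p)) ps)"

lemma sorted_spread:
  assumes "sorted_wrt pless ps" "\<And>p. sorted_wrt below (f p)"
  shows "sorted_wrt ubelow (spread f ps)"
  using assms(1)
proof (induction ps)
  case (Cons p ps)
  have "sorted_wrt ubelow (map (\<lambda>l. (fst p, snd p, l)) (f p))"
    using assms(2)[of p] by (simp add: sorted_wrt_map)
  then show ?case using Cons by (auto simp: spread_def sorted_wrt_append pless_def)
qed (simp add: spread_def)

lemma part_spread:
  assumes "sorted_wrt pless ps"
  shows "part a b (spread f ps) = (if (a, b) \<in> set ps then f (a, b) else [])"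
  using assms
proof (induction ps)
  case (Cons p ps)
  have "p \<notin> set ps" using Cons.prems by (auto simp: pless_def)
  then show ?case using Cons by (cases p) (auto simp: spread_def part_map_Pair)
qed (simp add: spread_def)

definition unf :: "nat \<Rightarrow> 'r mat \<Rightarrow> unitri_letter list" where
  "unf n g = spread (\<lambda>p. nfw r (g $$ p)) (positions n)"

lemma unf_letters: "set (unf n g) \<subseteq> uletters n"
  using nfw_words by (auto simp: unf_def spread_def set_positions uletters_def words_def)

lemma unf_sorted: "sorted_wrt ubelow (unf n g)"
  unfolding unf_def by (rule sorted_spread[OF sorted_positions]) (use nfw_words in \<open>simp add: words_def\<close>)

lemma ubelow_rows: "sorted_wrt ubelow w \<Longrightarrow> sorted_wrt (\<lambda>x y. fst y \<le> fst x) w"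
  by (rule sorted_wrt_mono_rel) (auto simp: ubelow_def)

lemma ueval_unf:
  assumes "g \<in> carrier (unitriangular_group n)"
  shows "ueval n (unf n g) = g"
proof -
  have g: "g \<in> carrier_mat n n" "\<And>a b. b < a \<Longrightarrow> a < n \<Longrightarrow> g $$ (a, b) = 0" "\<And>a. a < n \<Longrightarrow> g $$ (a, a) = 1"
    using assms unfolding unitriangular_group_def by auto
  have p: "part a b (unf n g) = (if a < b \<and> b < n then nfw r (g $$ (a, b)) else [])" for a b
    unfolding unf_def part_spread[OF sorted_positions] by (simp add: set_positions)
  show ?thesis
    unfolding ueval_entries[OF unf_letters ubelow_rows[OF unf_sorted]]
    by (rule eq_matI) (use g in \<open>auto simp: p valw_nfw\<close>)
qed

text \<open>Each word has a letter at the position of the other's first letter, so neither first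
  position precedes the other. Hence the first letters agree and can be removed.\<close>

lemma sorted_parts_eq:
  assumes "sorted_wrt ubelow w" "sorted_wrt ubelow w'" "\<And>a b. part a b w = part a b w'"
  shows "w = w'"
  using assms
proof (induction w arbitrary: w')
  case Nil
  show ?case
  proof (cases w')
    case (Cons y v)
    then show ?thesis using Nil.prems(3)[of "fst y" "fst (snd y)"] by simp
  qed simp
next
  case (Cons x v)
  obtain i j l where x: "x = (i, j, l)" by (cases x)
  have xp: "part i j w' = l # part i j v" using Cons.prems(3)[of i j] x by simp
  then obtain y v' where w': "w' = y # v'" by (cases w') auto
  obtain i' j' l' where y: "y = (i', j', l')" by (cases y)
  have yp: "part i' j' (x # v) = l' # part i' j' v'" using Cons.prems(3)[of i' j'] w' y by simp
  obtain m where "(i, j, m) \<in> set w'" using xp part_Nil_iff[of i j w'] by auto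
  then have "(i, j, m) = y \<or> ubelow y (i, j, m)" using Cons.prems(2) w' by auto
  then have "i < i' \<or> i' = i \<and> j' \<le> j" using y by auto
  moreover obtain m' where "(i', j', m') \<in> set (x # v)" using yp part_Nil_iff[of i' j' "x # v"] by auto
  then have "(i', j', m') = x \<or> ubelow x (i', j', m')" using Cons.prems(1) by auto
  then have "i' < i \<or> i = i' \<and> j \<le> j'" using x by auto
  ultimately have eq: "i' = i" "j' = j" by linarith+
  then have "l = l'" using xp w' y by simp
  then have xy: "x = y" using x y eq by simp
  have "part a b v = part a b v'" for a b
    using Cons.prems(3)[of a b] w' xy by (simp split: if_splits)
  then have "v = v'" using Cons.IH[of v'] Cons.prems(1,2) w' by simp
  then show ?case using w' xy by simp
qed

lemma part_words:
  assumes "set w \<subseteq> uletters n" "sorted_wrt ubelow w"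
  shows "part a b w \<in> words r"
proof -
  have "sorted_wrt ubelow (filter (\<lambda>x. fst x = a \<and> fst (snd x) = b) w)"
    using assms(2) by (rule sorted_wrt_filter)
  then have "sorted_wrt (\<lambda>x y. below (snd (snd x)) (snd (snd y))) (filter (\<lambda>x. fst x = a \<and> fst (snd x) = b) w)"
    by (rule sorted_wrt_mono_rel[rotated]) (auto simp: ubelow_def)
  then show ?thesis
    using assms(1) by (auto simp: words_def part_def sorted_wrt_map uletters_def)
qed

lemma unf_ueval:
  assumes w: "set w \<subseteq> uletters n" "sorted_wrt ubelow w"
  shows "unf n (ueval n w) = w"
proof (rule sorted_parts_eq[OF unf_sorted w(2)])
  fix a b
  show "part a b (unf n (ueval n w)) = part a b w"
  proof (cases "a < b \<and> b < n")
    case True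
    then have "part a b (unf n (ueval n w)) = nfw r (ueval n w $$ (a, b))"
      unfolding unf_def part_spread[OF sorted_positions] by (simp add: set_positions)
    also have "\<dots> = nfw r (valw (part a b w))"
      unfolding ueval_entries[OF w(1) ubelow_rows[OF w(2)]] using True by simp
    also have "\<dots> = part a b w" by (rule nfw_valw[OF part_words[OF w]])
    finally show ?thesis .
  next
    case False
    then have "part a b w = []" unfolding part_Nil_iff using w(1) by (auto simp: uletters_def)
    then show ?thesis using False
      unfolding unf_def part_spread[OF sorted_positions] by (auto simp: set_positions)
  qed
qed

text \<open>A numbering of the order behind \<open>ubelow\<close>: rows from the bottom up, then
  columns, then generators from large to small index. Multiples of the same generator at one
  position share a level, as the merging case of the rewriting system requires.\<close>

definition ulev :: "nat \<Rightarrow> unitri_letter \<Rightarrow> nat" where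
  "ulev n = (\<lambda>(i, j, c, k). ((n - Suc i) * n + j) * r + (r - Suc c))"

lemma ulev_pless:
  assumes "(i, j, c, k) \<in> uletters n" "(i', j', c', k') \<in> uletters n" "pless (i, j) (i', j')"
  shows "ulev n (i, j, c, k) < ulev n (i', j', c', k')"
proof -
  have *: "i < n" "j < n" "c < r" using assms by (auto simp: uletters_def letters_def)
  have "(n - Suc i) * n + j < (n - Suc i') * n + j'"
  proof (cases "i' < i")
    case True
    then have "n - Suc i < n - Suc i'" using * by auto
    then show ?thesis using * by (intro mult_add_less)
  next
    case False
    then show ?thesis using assms(3) by (auto simp: pless_def)
  qed
  then show ?thesis unfolding ulev_def prod.case by (rule mult_add_less) (use * in auto)
qed

lemma ulev_less:
  assumes "x \<in> uletters n"
  shows "ulev n x < n * n * r"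
proof -
  obtain i j c k where x: "x = (i, j, c, k)" by (cases x)
  have *: "i < n" "j < n" "c < r" using assms x by (auto simp: uletters_def letters_def)
  then have "n - Suc i < n" by simp
  then have "(n - Suc i) * n + j < n * n" using mult_add_less[of "n - Suc i" n j n 0] * by simp
  then show ?thesis using mult_add_less[of "(n - Suc i) * n + j" "n * n" "r - Suc c" r 0] * x
    by (simp add: ulev_def)
qed

text \<open>Letters at the same position add up in the ring. Otherwise \<open>x\<close> and
  \<open>y\<close> are exchanged, which costs the entry \<open>val l * val l'\<close> at
  \<open>(i, j')\<close> if \<open>j = i'\<close>; this position comes after \<open>(i, j)\<close>,
  so the extra letters have higher level. The other coincidence \<open>j' = i\<close> is impossible,
  since \<open>y\<close> lies in row \<open>i\<close> or below it.\<close>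

lemma uletters_rewrite:
  assumes x: "x \<in> uletters n" and y: "y \<in> uletters n" and R: "\<not> ubelow x y"
  shows "\<exists>zs cs. map (ulev n) (unf n (elem n x * elem n y)) = zs @ cs \<and> (\<forall>c\<in>set cs. ulev n x < c) \<and>
    (ulev n y < ulev n x \<and> zs = [ulev n y, ulev n x] \<or>
     ulev n y = ulev n x \<and> (zs = [] \<or> zs = [ulev n x]))"
proof -
  obtain i j l where xd: "x = (i, j, l)" by (cases x)
  obtain i' j' l' where yd: "y = (i', j', l')" by (cases y)
  have ij: "i < j" "j < n" "i' < j'" "j' < n" "l \<in> letters r" "l' \<in> letters r"
    using x y xd yd by (auto simp: uletters_def)
  have lc: "fst l < r" "fst l' < r" using ij by (auto simp: letters_def)
  have yc: "elem n y \<in> carrier_mat n n" by (simp add: elem_def)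
  have prod: "elem n x * elem n y = mat n n (\<lambda>(a, b). elem n y $$ (a, b) + (if a = i then val l * elem n y $$ (j, b) else 0))"
  proof (rule eq_matI)
    show "(elem n x * elem n y) $$ (a, b) = mat n n (\<lambda>(a, b). elem n y $$ (a, b) + (if a = i then val l * elem n y $$ (j, b) else 0)) $$ (a, b)"
      if "a < dim_row (mat n n (\<lambda>(a, b). elem n y $$ (a, b) + (if a = i then val l * elem n y $$ (j, b) else 0)))"
        "b < dim_col (mat n n (\<lambda>(a, b). elem n y $$ (a, b) + (if a = i then val l * elem n y $$ (j, b) else 0)))" for a b
      using that elem_mult_entry[OF ij(1,2) yc, of a b l] by (simp add: xd)
  qed (simp_all add: elem_def)
  \<comment> \<open>Normal forms are verified rather than computed: a sorted word with the right
    matrix entries is the normal form.\<close>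
  have unfI: "unf n (elem n x * elem n y) = w"
    if w: "set w \<subseteq> uletters n" "sorted_wrt ubelow w"
      and eq: "\<And>a b. a < n \<Longrightarrow> b < n \<Longrightarrow> (if a = b then 1 else valw (part a b w)) =
        elem n y $$ (a, b) + (if a = i then val l * elem n y $$ (j, b) else 0)" for w
  proof -
    have "elem n x * elem n y = ueval n w"
      unfolding ueval_entries[OF w(1) ubelow_rows[OF w(2)]] prod by (rule cong_mat) (simp_all add: eq)
    then show ?thesis using unf_ueval[OF w] by simp
  qed
  consider (same) "i = i'" "j = j'" "fst l = fst l'" "\<not> below l l'"
    | (same_pos) "i = i'" "j = j'" "fst l < fst l'"
    | (less) "pless (i', j') (i, j)"
    using R by (fastforce simp: xd yd pless_def below_def)
  then show ?thesis
  proof cases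
    case same
    from nfw_rewrite[OF ij(5,6) same(3,4)] obtain zs cs where
      zc: "nfw r (val l + val l') = zs @ cs" "\<And>z. z \<in> set cs \<Longrightarrow> fst z < fst l"
      "zs = [] \<or> (\<exists>k. zs = [(fst l, k)])" by blast
    define w where "w = map (\<lambda>l. (i, j, l)) (zs @ cs)"
    have zw: "zs @ cs \<in> words r" using nfw_words[of "val l + val l'"] zc(1) by simp
    have v: "valw (zs @ cs) = val l + val l'" using valw_nfw[of "val l + val l'"] zc(1) by simp
    have w: "unf n (elem n x * elem n y) = w"
    proof (rule unfI)
      show "set w \<subseteq> uletters n" using zw ij by (auto simp: w_def uletters_def words_def)
      show "sorted_wrt ubelow w" unfolding w_def sorted_wrt_map using zw by (simp add: words_def)
      have p: "part a b w = (if i = a \<and> j = b then zs @ cs else [])" for a b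
        unfolding w_def by (rule part_map_Pair)
      fix a b assume "a < n" "b < n"
      then show "(if a = b then 1 else valw (part a b w)) =
          elem n y $$ (a, b) + (if a = i then val l * elem n y $$ (j, b) else 0)"
        using ij same unfolding p by (auto simp: elem_def yd v simp del: valw_simps(2,3))
    qed
    have lx: "ulev n (i, j, fst l, k) = ulev n x" for k
      by (cases l) (simp add: xd ulev_def)
    have ly: "ulev n y = ulev n x"
      using same by (cases l; cases l') (simp add: xd yd ulev_def)
    have lcs: "ulev n x < ulev n (i, j, z)" if "z \<in> set cs" for z
      using zc(2)[OF that] lc by (cases z; cases l) (auto simp: xd ulev_def)
    show ?thesis
      unfolding w by (rule exI[of _ "map (\<lambda>l. ulev n (i, j, l)) zs"], rule exI[of _ "map (\<lambda>l. ulev n (i, j, l)) cs"])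
        (use zc(3) lx ly lcs in \<open>auto simp: w_def\<close>)
  next
    case same_pos
    have w: "unf n (elem n x * elem n y) = [y, x]"
    proof (rule unfI)
      show "set [y, x] \<subseteq> uletters n" using x y by simp
      show "sorted_wrt ubelow [y, x]" using same_pos by (simp add: xd yd below_def)
      fix a b assume "a < n" "b < n"
      then show "(if a = b then 1 else valw (part a b [y, x])) =
          elem n y $$ (a, b) + (if a = i then val l * elem n y $$ (j, b) else 0)"
        using ij same_pos by (auto simp: elem_def yd xd)
    qed
    have "ulev n y < ulev n x"
      using same_pos lc by (cases l; cases l') (auto simp: xd yd ulev_def)
    then show ?thesis unfolding w by (intro exI[of _ "[ulev n y, ulev n x]"] exI[of _ "[]"]) simp
  next
    case less
    \<comment> \<open>The normal word of the commutator of the two letters, empty unless column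
      \<open>j\<close> of \<open>x\<close> meets row \<open>i'\<close> of \<open>y\<close>.\<close>
    define ext where "ext = (if j = i' then map (\<lambda>l. (i, j', l)) (nfw r (val l * val l')) else [])"
    have extX: "set ext \<subseteq> uletters n"
      using nfw_words[of "val l * val l'"] ij by (auto simp: ext_def uletters_def words_def)
    have ext_pos: "\<exists>m. z = (i, j', m) \<and> j = i'" if "z \<in> set ext" for z
      using that by (auto simp: ext_def split: if_splits)
    have w: "unf n (elem n x * elem n y) = y # x # ext"
    proof (rule unfI)
      show "set (y # x # ext) \<subseteq> uletters n" using x y extX by simp
      have "sorted_wrt ubelow ext"
        using nfw_words[of "val l * val l'"] by (simp add: ext_def sorted_wrt_map words_def)
      moreover have "ubelow y x" using less by (auto simp: xd yd pless_def)
      moreover have "ubelow y z \<and> ubelow x z" if "z \<in> set ext" for z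
        using ext_pos[OF that] ij by (auto simp: xd yd)
      ultimately show "sorted_wrt ubelow (y # x # ext)" by simp
      have p: "part a b ext = (if j = i' \<and> i = a \<and> j' = b then nfw r (val l * val l') else [])" for a b
        unfolding ext_def using part_map_Pair by auto
      fix a b assume "a < n" "b < n"
      then show "(if a = b then 1 else valw (part a b (y # x # ext))) =
          elem n y $$ (a, b) + (if a = i then val l * elem n y $$ (j, b) else 0)"
        using ij less unfolding pless_def by (auto simp: elem_def yd xd p valw_nfw)
    qed
    have "ulev n y < ulev n x"
      using ulev_pless[of i' j' "fst l'" "snd l'" n i j "fst l" "snd l"] x y less by (simp add: xd yd)
    moreover have "ulev n x < ulev n z" if z: "z \<in> set ext" for z
    proof -
      obtain m where m: "z = (i, j', m)" "j = i'" using ext_pos[OF z] by auto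
      have "pless (i, j) (i, j')" using m ij by (simp add: pless_def)
      then show ?thesis
        using ulev_pless[of i j "fst l" "snd l" n i j' "fst m" "snd m"] x extX z by (auto simp: xd m)
    qed
    ultimately show ?thesis
      unfolding w by (intro exI[of _ "[ulev n y, ulev n x]"] exI[of _ "map (ulev n) ext"]) simp
  qed
qed

lemma unitriangular_normal_form:
  "quadratic_normal_form (unitriangular_group n) (uletters n) (elem n) ubelow (unf n) (ulev n) (n * n * r)"
proof (rule quadratic_normal_form.intro)
  show "monoid (unitriangular_group n :: 'r mat monoid)"
    by (rule group.is_monoid[OF unitriangular_group_is_group])
  show "elem n x \<in> carrier (unitriangular_group n)" if "x \<in> uletters n" for x by (rule elem_closed[OF that])
  show "set (unf n g) \<subseteq> uletters n" for g by (rule unf_letters)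
  show "successively ubelow (unf n g)" for g
    by (rule successively_if_sorted_wrt[OF unf_sorted])
  have ev: "foldr (\<lambda>x h. elem n x \<otimes>\<^bsub>unitriangular_group n\<^esub> h) w \<one>\<^bsub>unitriangular_group n\<^esub> = ueval n w" for w
    by (simp add: unitriangular_group_def ueval_def)
  show "foldr (\<lambda>x h. elem n x \<otimes>\<^bsub>unitriangular_group n\<^esub> h) (unf n g) \<one>\<^bsub>unitriangular_group n\<^esub> = g"
    if "g \<in> carrier (unitriangular_group n)" for g
    unfolding ev by (rule ueval_unf[OF that])
  show "unf n (foldr (\<lambda>x h. elem n x \<otimes>\<^bsub>unitriangular_group n\<^esub> h) w \<one>\<^bsub>unitriangular_group n\<^esub>) = w"
    if "set w \<subseteq> uletters n" "successively ubelow w" for w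
    unfolding ev using that successively_conv_sorted_wrt[OF transp_ubelow] by (intro unf_ueval) simp_all
  show "ulev n x < n * n * r" if "x \<in> uletters n" for x by (rule ulev_less[OF that])
  show "\<exists>zs cs. map (ulev n) (unf n (elem n x \<otimes>\<^bsub>unitriangular_group n\<^esub> elem n y)) = zs @ cs \<and>
      (\<forall>c\<in>set cs. ulev n x < c) \<and>
      (ulev n y < ulev n x \<and> zs = [ulev n y, ulev n x] \<or> ulev n y = ulev n x \<and> (zs = [] \<or> zs = [ulev n x]))"
    if "x \<in> uletters n" "y \<in> uletters n" "\<not> ubelow x y" for x y
    using uletters_rewrite[OF that] by (simp add: unitriangular_group_def)
qed

section \<open>Insertion of an identity row and column\<close>

definition insert_mat :: "nat \<Rightarrow> nat \<Rightarrow> 'r mat \<Rightarrow> 'r mat" where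
  "insert_mat n k g = mat (Suc n) (Suc n) (\<lambda>(a, b). if a = k \<or> b = k then if a = b then 1 else 0
     else g $$ (delete_index k a, delete_index k b))"

definition insert_letter :: "nat \<Rightarrow> unitri_letter \<Rightarrow> unitri_letter" where
  "insert_letter k = (\<lambda>(i, j, l). (insert_index k i, insert_index k j, l))"

lemma delete_index_less: "k \<le> n \<Longrightarrow> a < Suc n \<Longrightarrow> a \<noteq> k \<Longrightarrow> delete_index k a < n"
  by (auto simp: delete_index_def)

lemma delete_index_strict: "a \<noteq> k \<Longrightarrow> b \<noteq> k \<Longrightarrow> b < a \<Longrightarrow> delete_index k b < delete_index k a"
  by (auto simp: delete_index_def)

lemma insert_mat_closed:
  assumes "k \<le> n" "g \<in> carrier (unitriangular_group n)"
  shows "insert_mat n k g \<in> carrier (unitriangular_group (Suc n))"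
proof -
  have g: "g \<in> carrier_mat n n" "\<And>a b. b < a \<Longrightarrow> a < n \<Longrightarrow> g $$ (a, b) = 0" "\<And>a. a < n \<Longrightarrow> g $$ (a, a) = 1"
    using assms(2) unfolding unitriangular_group_def by auto
  show ?thesis
    unfolding unitriangular_group_def insert_mat_def
    using g delete_index_less[OF assms(1)] delete_index_strict by auto
qed

lemma insert_mat_entry:
  assumes "a < Suc n" "b < Suc n"
  shows "insert_mat n k g $$ (a, b) = (if a = k \<or> b = k then if a = b then 1 else 0
    else g $$ (delete_index k a, delete_index k b))"
  using assms by (simp add: insert_mat_def)

lemma insert_mat_mult:
  assumes k: "k \<le> n" and g: "g \<in> carrier_mat n n" and h: "h \<in> carrier_mat n n"
  shows "insert_mat n k (g * h) = insert_mat n k g * insert_mat n k h"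
proof (rule eq_matI)
  have c: "insert_mat n k g \<in> carrier_mat (Suc n) (Suc n)" "insert_mat n k h \<in> carrier_mat (Suc n) (Suc n)"
    by (simp_all add: insert_mat_def)
  show "dim_row (insert_mat n k (g * h)) = dim_row (insert_mat n k g * insert_mat n k h)"
    "dim_col (insert_mat n k (g * h)) = dim_col (insert_mat n k g * insert_mat n k h)"
    by (simp_all add: insert_mat_def)
  fix a b assume "a < dim_row (insert_mat n k g * insert_mat n k h)" "b < dim_col (insert_mat n k g * insert_mat n k h)"
  then have ab: "a < Suc n" "b < Suc n" by (simp_all add: insert_mat_def)
  \<comment> \<open>The inner summation index is either the new one or the image of exactly one old
    index; the new one contributes only to the entry \<open>(k, k)\<close>.\<close>
  have I: "{..<Suc n} = insert k (insert_index k ` {..<n})"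
  proof (intro equalityI subsetI)
    fix u assume "u \<in> {..<Suc n}"
    show "u \<in> insert k (insert_index k ` {..<n})"
    proof (cases "u = k")
      case False
      then have "u = insert_index k (delete_index k u)" "delete_index k u < n"
        using insert_delete_index delete_index_less[OF k, of u] \<open>u \<in> {..<Suc n}\<close> by auto
      then show ?thesis by blast
    qed simp
  next
    fix u assume "u \<in> insert k (insert_index k ` {..<n})"
    then show "u \<in> {..<Suc n}" using k by (elim insertE imageE) (simp_all add: insert_index_def)
  qed
  have nk: "k \<notin> insert_index k ` {..<n}" by (auto simp: insert_index_def)
  have inj: "inj_on (insert_index k) {..<n}" by (rule inj_onI) (simp add: insert_index_eq_iff)
  have ik: "insert_index k u \<noteq> k" "insert_index k u < Suc n \<longleftrightarrow> u < n" for u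
    using k by (auto simp: insert_index_def)
  have "(insert_mat n k g * insert_mat n k h) $$ (a, b) =
      (\<Sum>u<Suc n. insert_mat n k g $$ (a, u) * insert_mat n k h $$ (u, b))"
    by (rule unitriangular_mult_entry[OF c ab])
  also have "\<dots> = insert_mat n k g $$ (a, k) * insert_mat n k h $$ (k, b) +
      (\<Sum>u<n. insert_mat n k g $$ (a, insert_index k u) * insert_mat n k h $$ (insert_index k u, b))"
    unfolding I using nk by (simp add: sum.reindex[OF inj] del: lessThan_Suc)
  also have "\<dots> = insert_mat n k (g * h) $$ (a, b)"
  proof (cases "a = k \<or> b = k")
    case True
    have "insert_mat n k g $$ (a, insert_index k u) * insert_mat n k h $$ (insert_index k u, b) = 0"
      if "u < n" for u
      using True that ab k ik[of u] ik(1)[of u, symmetric]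
      by (auto simp add: insert_mat_entry simp del: insert_index)
    then have "(\<Sum>u<n. insert_mat n k g $$ (a, insert_index k u) * insert_mat n k h $$ (insert_index k u, b)) = 0"
      by (intro sum.neutral) simp
    moreover have "k < Suc n" using k by simp
    ultimately show ?thesis using True ab by (auto simp add: insert_mat_entry)
  next
    case False
    have d: "delete_index k a < n" "delete_index k b < n" using delete_index_less[OF k] ab False by auto
    have "(\<Sum>u<n. insert_mat n k g $$ (a, insert_index k u) * insert_mat n k h $$ (insert_index k u, b)) =
        (\<Sum>u<n. g $$ (delete_index k a, u) * h $$ (u, delete_index k b))"
      by (intro sum.cong refl) (use False ab ik in \<open>simp add: insert_mat_entry\<close>)
    also have "\<dots> = (g * h) $$ (delete_index k a, delete_index k b)"
      by (rule unitriangular_mult_entry[OF g h d, symmetric])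
    moreover have "insert_mat n k g $$ (a, k) = 0" "k < Suc n" using False ab k by (simp_all add: insert_mat_entry)
    ultimately show ?thesis using False ab by (simp add: insert_mat_entry)
  qed
  finally show "insert_mat n k (g * h) $$ (a, b) = (insert_mat n k g * insert_mat n k h) $$ (a, b)" by simp
qed

lemma insert_mat_one: "k \<le> n \<Longrightarrow> insert_mat n k (1\<^sub>m n) = 1\<^sub>m (Suc n)"
proof (rule eq_matI)
  assume k: "k \<le> n"
  fix a b assume "a < dim_row (1\<^sub>m (Suc n) :: 'r mat)" "b < dim_col (1\<^sub>m (Suc n) :: 'r mat)"
  then show "insert_mat n k (1\<^sub>m n) $$ (a, b) = 1\<^sub>m (Suc n) $$ (a, b)"
    using delete_index_less[OF k] by (auto simp: insert_mat_def delete_index_def)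
qed (simp_all add: insert_mat_def)

lemma elem_insert:
  assumes k: "k \<le> n" and x: "x \<in> uletters n"
  shows "elem (Suc n) (insert_letter k x) = insert_mat n k (elem n x)"
proof -
  obtain i j l where xd: "x = (i, j, l)" by (cases x)
  have ij: "i < j" "j < n" using x xd by (auto simp: uletters_def)
  have eq: "a = insert_index k c \<longleftrightarrow> delete_index k a = c" if "a \<noteq> k" for a c
    using insert_delete_index[OF that] delete_insert_index by metis
  have eq': "delete_index k a = delete_index k b \<longleftrightarrow> a = b" if "a \<noteq> k" "b \<noteq> k" for a b
    using insert_delete_index[OF that(1)] insert_delete_index[OF that(2)] by metis
  have ne: "k \<noteq> insert_index k c" for c by (simp add: insert_index_def)
  show ?thesis
  proof (rule eq_matI)
    fix a b assume "a < dim_row (insert_mat n k (elem n x))" "b < dim_col (insert_mat n k (elem n x))"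
    then have ab: "a < Suc n" "b < Suc n" by (simp_all add: insert_mat_def)
    show "elem (Suc n) (insert_letter k x) $$ (a, b) = insert_mat n k (elem n x) $$ (a, b)"
    proof (cases "a = k \<or> b = k")
      case True
      then have "\<not> (a = insert_index k i \<and> b = insert_index k j)" using ne by metis
      then show ?thesis unfolding insert_mat_entry[OF ab] using True ab
        by (auto simp add: elem_def insert_letter_def xd simp del: insert_index)
    next
      case False
      then have d: "delete_index k a < n" "delete_index k b < n" using delete_index_less[OF k] ab by auto
      show ?thesis unfolding insert_mat_entry[OF ab] using False ab d
        by (simp add: elem_def insert_letter_def xd eq eq' del: insert_index)
    qed
  qed (simp_all add: elem_def insert_mat_def)
qed

lemma unitriangular_insert_hom:
  assumes k: "k \<le> n"
  shows "quadratic_normal_form_hom (unitriangular_group n) (uletters n) (elem n) ubelow (unf n) (ulev n) (n * n * r)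
    (unitriangular_group (Suc n)) (uletters (Suc n)) (elem (Suc n)) ubelow (unf (Suc n)) (ulev (Suc n)) (Suc n * Suc n * r)
    (insert_mat n k) (insert_letter k)"
proof (intro quadratic_normal_form_hom.intro quadratic_normal_form_hom_axioms.intro unitriangular_normal_form)
  show "insert_mat n k \<in> hom (unitriangular_group n) (unitriangular_group (Suc n))"
  proof (rule homI)
    fix g h :: "'r mat" assume gh: "g \<in> carrier (unitriangular_group n)" "h \<in> carrier (unitriangular_group n)"
    show "insert_mat n k g \<in> carrier (unitriangular_group (Suc n))" by (rule insert_mat_closed[OF k gh(1)])
    show "insert_mat n k (g \<otimes>\<^bsub>unitriangular_group n\<^esub> h) =
        insert_mat n k g \<otimes>\<^bsub>unitriangular_group (Suc n)\<^esub> insert_mat n k h"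
      using insert_mat_mult[OF k, of g h] gh by (simp add: unitriangular_group_def)
  qed
  show "insert_letter k x \<in> uletters (Suc n)" if "x \<in> uletters n" for x
    using that k by (auto simp: uletters_def insert_letter_def insert_index_def)
  show "elem (Suc n) (insert_letter k x) = insert_mat n k (elem n x)" if "x \<in> uletters n" for x
    by (rule elem_insert[OF k that])
  show "ubelow (insert_letter k x) (insert_letter k y) \<longleftrightarrow> ubelow x y" for x y
    by (cases x; cases y) (simp add: insert_letter_def insert_index_less insert_index_eq_iff)
  show "insert_mat n k \<one>\<^bsub>unitriangular_group n\<^esub> = \<one>\<^bsub>unitriangular_group (Suc n)\<^esub>"
    using insert_mat_one[OF k] by (simp add: unitriangular_group_def)
qed

end

section \<open>Betti numbers of unitriangular groups\<close>

lemma list_less_mapI: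
  fixes v w :: "'x::linorder list"
  assumes "\<And>x y. x \<in> set v \<union> set w \<Longrightarrow> y \<in> set v \<union> set w \<Longrightarrow> x < y \<Longrightarrow> f x < (f y :: 'y::linorder)"
    and "v < w"
  shows "map f v < map f w"
  using assms
proof (induction v arbitrary: w)
  case Nil
  then show ?case by (cases w) simp_all
next
  case (Cons x v)
  then obtain y u where w: "w = y # u" by (cases w) simp_all
  show ?case
  proof (cases "x < y")
    case True
    then show ?thesis using Cons.prems(1)[of x y] w by simp
  next
    case False
    then have "x = y" "v < u" using Cons.prems(2) w by auto
    moreover have "map f v < map f u"
      by (rule Cons.IH) (use Cons.prems(1) w \<open>v < u\<close> in auto)
    ultimately show ?thesis using w by simp
  qed
qed

lemma strict_mono_Max_image:
  assumes "finite A" "A \<noteq> {}" "\<And>x y. x < y \<Longrightarrow> f x < (f y :: 'b::linorder)"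
  shows "Max (f ` A) = f (Max (A :: 'a::linorder set))"
proof (rule Max_eqI)
  show "y \<le> f (Max A)" if y: "y \<in> f ` A" for y
  proof -
    obtain x where x: "x \<in> A" "y = f x" using y by auto
    then have "x \<le> Max A" using assms(1) by simp
    then show ?thesis using assms(3)[of x "Max A"] x(2) by (auto simp: le_less)
  qed
qed (use assms in auto)

text \<open>A strictly increasing relabelling is injective, so no terms cancel, and it maps the
  largest word to the largest word.\<close>

lemma lead_push:
  fixes v :: "'a::linorder \<Rightarrow>\<^sub>0 'k::field" and f :: "'a \<Rightarrow> 'b::linorder"
  assumes f: "\<And>x y. x < y \<Longrightarrow> f x < f y" and v: "v \<noteq> 0"
  shows "push f v \<noteq> 0 \<and> lead (push f v) = f (lead v)"
proof -
  have "inj_on f UNIV"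
  proof (rule inj_onI)
    fix x y assume "f x = f y" then show "x = y"
      using f[of x y] f[of y x] by (cases x y rule: linorder_cases) auto
  qed
  then have keys: "Poly_Mapping.keys (push f v) = f ` Poly_Mapping.keys v"
    by (rule keys_push_inj) simp
  moreover have "Poly_Mapping.keys v \<noteq> {}" using v by simp
  ultimately show ?thesis
    using strict_mono_Max_image[of "Poly_Mapping.keys v" f] f unfolding lead_def by auto
qed

locale ordered_quadratic_normal_form = quadratic_normal_form G X e R nf lev N
  for G :: "'g monoid" and X :: "'x::linorder set" and e R nf lev N
begin

text \<open>\<open>quotient_leads\<close> provides a basis of homology indexed by
  \<open>Z - B\<close>; since \<open>B\<close> is contained in the finite set \<open>Z\<close>, its
  size is a difference of two counts.\<close>

lemma homology_dim_leads:
  fixes p :: nat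
  assumes fin_crit: "finite (crit_words p)"
  defines "Z \<equiv> leads (crit_part p ` (bar_cycles G p :: (_ \<Rightarrow>\<^sub>0 'k::field) set))"
    and "B \<equiv> leads (crit_part p ` (bar_boundaries G p :: (_ \<Rightarrow>\<^sub>0 'k) set))"
  shows "vectorspace.fin_dim class_ring (group_homology G p :: ('k, _) module)"
    and "of_nat (vectorspace.dim class_ring (group_homology G p :: ('k, _) module)) =
      (of_nat (card Z) - of_nat (card B) :: rat)"
proof -
  let ?Z = "bar_cycles G p :: (_ \<Rightarrow>\<^sub>0 'k) set" and ?B = "bar_boundaries G p :: (_ \<Rightarrow>\<^sub>0 'k) set"
  have BZ: "?B \<subseteq> ?Z" by (rule bar_boundaries_subset[OF monoid])
  have chains: "c \<in> carrier (bar_chains G p)" if "c \<in> ?Z" for c using that by (simp add: bar_cycles_def)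
  have "Z \<subseteq> crit_words p"
  proof
    fix w assume "w \<in> Z"
    then obtain c where "c \<in> ?Z" "crit_part p c \<noteq> 0" "w = lead (crit_part p c)"
      unfolding Z_def leads_def by auto
    then show "w \<in> crit_words p" using keys_crit_part[OF chains] lead_in_keys by blast
  qed
  then have fin: "finite Z" by (rule finite_subset[OF _ fin_crit])
  have sub: "B \<subseteq> Z" using BZ unfolding B_def Z_def leads_def by blast
  obtain \<zeta> where \<zeta>: "\<And>s. s \<in> Z - B \<Longrightarrow> \<zeta> s \<in> ?Z"
    "\<And>z. z \<in> ?Z \<Longrightarrow> \<exists>a. \<exists>b\<in>?B. z = b + (\<Sum>s\<in>Z - B. scale_chain (a s) (\<zeta> s))"
    "\<And>a s. (\<Sum>s\<in>Z - B. scale_chain (a s) (\<zeta> s)) \<in> ?B \<Longrightarrow> s \<in> Z - B \<Longrightarrow> a s = 0"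
    unfolding Z_def B_def
  proof (rule quotient_leads[OF chain_subspace_cycles chain_subspace_boundaries BZ,
        where \<pi> = "crit_part p" and F = "crit_words p"])
    show "crit_part p (c + d) = crit_part p c + crit_part p d" if "c \<in> ?Z" "d \<in> ?Z" for c d
      using that by (simp add: crit_part_add chains)
    show "crit_part p (scale_chain a c) = scale_chain a (crit_part p c)" if "c \<in> ?Z" for a c
      using that by (simp add: crit_part_scale chains)
    show "Poly_Mapping.keys (crit_part p c) \<subseteq> crit_words p" if "c \<in> ?Z" for c
      by (rule keys_crit_part[OF chains[OF that]])
    show "c \<in> ?B" if "c \<in> ?Z" "crit_part p c = 0" for c
      by (rule cycle_crit_part_zero[OF that])
  qed (use fin_crit in blast)+
  have "vectorspace class_ring (group_homology G p :: ('k, _) module)"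
    by (rule vectorspace_group_homology[OF monoid])
  then have dim: "vectorspace.fin_dim class_ring (group_homology G p :: ('k, _) module) \<and>
      vectorspace.dim class_ring (group_homology G p :: ('k, _) module) = card (Z - B)"
    unfolding group_homology_def
    by (rule dim_quotient_module[OF chain_subspace_cycles chain_subspace_boundaries BZ])
      (use \<zeta> fin in auto)
  then show "vectorspace.fin_dim class_ring (group_homology G p :: ('k, _) module)" ..
  have "card (Z - B) = card Z - card B" by (rule card_Diff_subset[OF finite_subset[OF sub fin] sub])
  then show "of_nat (vectorspace.dim class_ring (group_homology G p :: ('k, _) module)) =
      (of_nat (card Z) - of_nat (card B) :: rat)"
    using dim card_mono[OF fin sub] by (simp add: of_nat_diff)
qed

end

context additive_presentation
begin

sublocale U: ordered_quadratic_normal_form "unitriangular_group n" "uletters n" "elem n" ubelow "unf n" "ulev n" "n * n * r"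
  for n
  by (intro ordered_quadratic_normal_form.intro unitriangular_normal_form)

lemma crit_words_indexed:
  assumes "w \<in> U.crit_words n p"
  shows "length w = p \<and> support w \<subseteq> {..<n} \<and> (snd \<circ> snd) ` set w \<subseteq> letters r"
  using U.crit_wordsD[OF assms] by (fastforce simp: uletters_def support_def)

lemma finite_crit_words: "finite (U.crit_words n p)"
proof (rule finite_subset)
  show "U.crit_words n p \<subseteq> {w. set w \<subseteq> {..<n} \<times> {..<n} \<times> letters r \<and> length w = p}"
    using U.crit_wordsD by (fastforce simp: uletters_def)
  show "finite {w. set w \<subseteq> {..<n} \<times> {..<n} \<times> letters r \<and> length w = p}"
    by (intro finite_lists_length_eq finite_cartesian_product finite_letters) simp_all
qed

text \<open>Insertions are strictly increasing on indices, hence on letters and words in their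
  lexicographic orders. This makes leading words commute with insertions.\<close>

lemma map_insert_letter_less:
  assumes "v < w"
  shows "map (insert_letter k) v < map (insert_letter k) w"
  by (rule list_less_mapI[OF _ assms])
    (auto simp: insert_letter_def less_prod_def' insert_index_less insert_index_eq_iff)

lemma relabel_insert_index: "relabel (insert_index k) w = map (insert_letter k) w"
  by (simp add: relabel_def insert_letter_def)

text \<open>By naturality of the critical part, inserting an index into a leading word gives the
  leading word of the pushed chain. The leading words thus form a family of indexed words that is
  closed under insertions.\<close>

lemma eventually_poly_leads:
  fixes W :: "nat \<Rightarrow> ('r mat list \<Rightarrow>\<^sub>0 'k::field) set"
  assumes chains: "\<And>n. W n \<subseteq> carrier (bar_chains (unitriangular_group n) p)"
    and push: "\<And>n k c. k \<le> n \<Longrightarrow> c \<in> W n \<Longrightarrow> push (map (insert_mat n k)) c \<in> W (Suc n)"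
  shows "eventually_poly (\<lambda>n. of_nat (card (leads (U.crit_part n p ` W n))))"
proof (rule eventually_poly_indexed_words[OF finite_letters])
  fix n w assume "w \<in> leads (U.crit_part n p ` W n)"
  then obtain c where c: "c \<in> W n" "U.crit_part n p c \<noteq> 0" "w = lead (U.crit_part n p c)"
    unfolding leads_def by auto
  have cc: "c \<in> carrier (bar_chains (unitriangular_group n) p)" using chains c(1) by blast
  have "w \<in> U.crit_words n p"
    using U.keys_crit_part[OF cc] lead_in_keys[OF c(2)] c(3) by blast
  then show "length w = p \<and> support w \<subseteq> {..<n} \<and> (snd \<circ> snd) ` set w \<subseteq> letters r"
    by (rule crit_words_indexed)
  fix k assume k: "k \<le> n"
  interpret H: quadratic_normal_form_hom "unitriangular_group n" "uletters n" "elem n" ubelow "unf n" "ulev n" "n * n * r"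
    "unitriangular_group (Suc n)" "uletters (Suc n)" "elem (Suc n)" ubelow "unf (Suc n)" "ulev (Suc n)" "Suc n * Suc n * r"
    "insert_mat n k" "insert_letter k"
    by (rule unitriangular_insert_hom[OF k])
  let ?c = "push (map (insert_mat n k)) c"
  have "U.crit_part (Suc n) p ?c = push (map (insert_letter k)) (U.crit_part n p c)"
    by (rule H.crit_part_hom[OF cc])
  then have "U.crit_part (Suc n) p ?c \<noteq> 0 \<and> lead (U.crit_part (Suc n) p ?c) = map (insert_letter k) w"
    using lead_push[of "map (insert_letter k)", OF map_insert_letter_less c(2)] c(3) by simp
  then show "relabel (insert_index k) w \<in> leads (U.crit_part (Suc n) p ` W (Suc n))"
    using push[OF k c(1)] unfolding relabel_insert_index leads_def
    by (intro image_eqI[of _ _ "U.crit_part (Suc n) p ?c"]) auto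
qed

lemma homology_eventually_poly:
  "\<exists>f :: rat poly. \<forall>\<^sub>F n in sequentially.
    vectorspace.fin_dim (class_ring :: 'k::field ring)
      (group_homology (unitriangular_group n :: 'r mat monoid) p) \<and>
    of_nat (vectorspace.dim (class_ring :: 'k ring)
      (group_homology (unitriangular_group n :: 'r mat monoid) p)) = poly f (of_nat n)"
proof -
  define Z where "Z = (\<lambda>n. bar_cycles (unitriangular_group n :: 'r mat monoid) p :: (_ \<Rightarrow>\<^sub>0 'k) set)"
  define B where "B = (\<lambda>n. bar_boundaries (unitriangular_group n :: 'r mat monoid) p :: (_ \<Rightarrow>\<^sub>0 'k) set)"
  have BZ: "B n \<subseteq> Z n" for n
    unfolding B_def Z_def by (rule bar_boundaries_subset[OF U.monoid])
  have Zc: "Z n \<subseteq> carrier (bar_chains (unitriangular_group n) p)" for n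
    by (auto simp: Z_def bar_cycles_def)
  have "eventually_poly (\<lambda>n. of_nat (card (leads (U.crit_part n p ` Z n))))"
  proof (rule eventually_poly_leads[OF Zc])
    show "push (map (insert_mat n k)) c \<in> Z (Suc n)" if "k \<le> n" "c \<in> Z n" for n k c
      using quadratic_normal_form_hom.push_cycles[OF unitriangular_insert_hom[OF that(1)]] that(2)
      by (simp add: Z_def)
  qed
  moreover have "eventually_poly (\<lambda>n. of_nat (card (leads (U.crit_part n p ` B n))))"
  proof (rule eventually_poly_leads)
    show "B n \<subseteq> carrier (bar_chains (unitriangular_group n) p)" for n using BZ Zc by blast
    show "push (map (insert_mat n k)) c \<in> B (Suc n)" if "k \<le> n" "c \<in> B n" for n k c
      using quadratic_normal_form_hom.push_boundaries[OF unitriangular_insert_hom[OF that(1)]] that(2)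
      by (simp add: B_def)
  qed
  ultimately have "eventually_poly (\<lambda>n. of_nat (card (leads (U.crit_part n p ` Z n))) -
      of_nat (card (leads (U.crit_part n p ` B n))))"
    by (rule eventually_poly_diff)
  then obtain f where f: "\<forall>\<^sub>F n in sequentially. (of_nat (card (leads (U.crit_part n p ` Z n))) -
      of_nat (card (leads (U.crit_part n p ` B n))) :: rat) = poly f (of_nat n)"
    unfolding eventually_poly_def by (elim exE) (rule that)
  have "\<forall>\<^sub>F n in sequentially.
      vectorspace.fin_dim (class_ring :: 'k ring) (group_homology (unitriangular_group n :: 'r mat monoid) p) \<and>
      of_nat (vectorspace.dim (class_ring :: 'k ring)
        (group_homology (unitriangular_group n :: 'r mat monoid) p)) = poly f (of_nat n)"
    using f
  proof eventually_elim
    case (elim n)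
    have "vectorspace.fin_dim (class_ring :: 'k ring) (group_homology (unitriangular_group n :: 'r mat monoid) p)"
      by (rule U.homology_dim_leads(1)[OF finite_crit_words])
    moreover have "(of_nat (vectorspace.dim (class_ring :: 'k ring)
        (group_homology (unitriangular_group n :: 'r mat monoid) p)) :: rat) = poly f (of_nat n)"
      using elim unfolding Z_def B_def by (rule trans[OF U.homology_dim_leads(2)[OF finite_crit_words]])
    ultimately show ?case ..
  qed
  then show ?thesis by (rule exI)
qed

end

theorem theorem1p1:
  fixes i :: nat
  assumes fg: "\<exists>S :: 'r::ring_1 set. finite S \<and> group_closure S = UNIV"
  shows "\<exists>f :: rat poly. \<forall>\<^sub>F n in sequentially.
    vectorspace.fin_dim (class_ring :: 'k::field ring)
      (group_homology (unitriangular_group n :: 'r mat monoid) i) \<and>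
    of_nat (vectorspace.dim (class_ring :: 'k ring)
      (group_homology (unitriangular_group n :: 'r mat monoid) i)) = poly f (of_nat n)"
proof -
  obtain S :: "'r set" where S: "finite S" "group_closure S = UNIV" using fg by blast
  obtain xs where xs: "set xs = S" using finite_list[OF S(1)] by blast
  \<comment> \<open>A list enumerating the generating set serves as the sequence of generators, in
    any order.\<close>
  have "additive_presentation ((!) xs) (length xs)"
  proof
    have "(!) xs ` {..<length xs} = S" using xs by (auto simp: set_conv_nth)
    from additive_generators.group_closure_sub[OF this]
    show "additive_generators.sub ((!) xs) (length xs) = UNIV" using S(2) by blast
  qed
  then show ?thesis by (rule additive_presentation.homology_eventually_poly)
qed

end
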